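(* Every Lorenz link is a T-link, and every T-link is a Lorenz link. Precisely: let $2\le r_1<\dots<r_k$ and $s_1,\dots,s_k\ge 1$ be integers and let $p=s_1+\dots+s_k$. If a link $\mathcal{L}$ is represented by (i.e. is the closure of) the Lorenz braid $\mathbb{L}$ on $p+r_k$ strands with defining vector $\vec d_L=\langle r_1^{s_1},\dots,r_k^{s_k}\rangle$, then $\mathcal{L}$ is also represented by the closure of the $r_k$-strand braid $$\mathbb{T}=(\sigma_1\sigma_2\cdots\sigma_{r_1-1})^{s_1}(\sigma_1\sigma_2\cdots\sigma_{r_2-1})^{s_2}\cdots(\sigma_1\sigma_2\cdots\sigma_{r_k-1})^{s_k},$$ which exhibits $\mathcal{L}$ as the T-link $T((r_1,s_1),\dots,(r_k,s_k))$. Moreover, every T-link arises in this way from some Lorenz link.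
   Context: Links are considered up to ambient isotopy; closed braids are oriented by the braid direction. $\sigma_1,\dots,\sigma_{n-1}$ are the standard generators of the braid group $B_n$; $\sigma_i$ is the crossing in which the strand in position $i$ passes over the strand in position $i+1$, and crossings $\sigma_i$ (as opposed to $\sigma_i^{-1}$) are called positive. Lorenz braids and links: for integers $p\ge 1$ and $1\le d_1\le d_2\le\dots\le d_p$, the Lorenz braid with defining vector $\vec d_L=\langle d_1,\dots,d_p\rangle$ is the positive braid on $p+d_p$ strands in which, for $1\le i\le p$, the strand beginning at position $i$ (an overcrossing strand) ends at position $i+d_i$; the $d_p$ strands beginning at positions $p+1,\dots,p+d_p$ (undercrossing strands) fill the remaining end positions in order-preserving fashion; any two strands cross at most once, and every crossing is an overcrossing strand passing over an undercrossing strand, of type $\sigma_i$. The notation $r^{s}$ in a vector means $r$ repeated $s$ times. A Lorenz link is a link which is the closure of some Lorenz braid (equivalently, a finite collection of closed orbits on the Lorenz template, parallel push-offs being allowed and the two trivial loops parallel to the boundary of the template being excluded). T-links: for integers $2\le r_1\le\dots\le r_k$ and $s_i>0$, $i=1,\dots,k$, the T-link $T((r_1,s_1),\dots,(r_k,s_k))$ is the closure of the $r_k$-strand braid $(\sigma_1\cdots\sigma_{r_1-1})^{s_1}\cdots(\sigma_1\cdots\sigma_{r_k-1})^{s_k}$ (called a T-braid). *)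

theory Defs
  imports "HOL-Analysis.Analysis" "HOL-Combinatorics.Transposition"
begin

type_synonym space = "complex \<times> real"

text \<open>
  An oriented knot is encoded as the set of all its positively oriented simple closed
  parametrisations by the unit interval, with arbitrary base point, and an oriented link as the
  union of these sets over its components. As for all paths in the library, values outside
  the unit interval are irrelevant; the sets below contain every choice of them.
\<close>

definition oriented_knot :: "(real \<Rightarrow> space) \<Rightarrow> (real \<Rightarrow> space) set" where
  "oriented_knot c = {\<gamma>. \<exists>\<phi> :: real \<Rightarrow> real. continuous_on {0..1} \<phi> \<and> strict_mono_on {0..1} \<phi> \<and>
     \<phi> 1 = \<phi> 0 + 1 \<and> (\<forall>t\<in>{0..1}. \<gamma> t = c (frac (\<phi> t)))}"

definition oriented_link :: "(real \<Rightarrow> space) set \<Rightarrow> bool" where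
  "oriented_link L \<longleftrightarrow> (\<exists>C. finite C \<and> C \<noteq> {} \<and>
     (\<forall>c\<in>C. simple_path c \<and> pathfinish c = pathstart c) \<and>
     pairwise (\<lambda>c c'. path_image c \<inter> path_image c' = {}) C \<and>
     L = (\<Union>c\<in>C. oriented_knot c))"

definition ambient_isotopic :: "(real \<Rightarrow> space) set \<Rightarrow> (real \<Rightarrow> space) set \<Rightarrow> bool" where
  "ambient_isotopic L L' \<longleftrightarrow> (\<exists>h :: space \<Rightarrow> space.
     homotopic_with_canon (\<lambda>f. \<exists>g. homeomorphism UNIV UNIV f g) UNIV UNIV id h \<and>
     (\<lambda>\<gamma>. h \<circ> \<gamma>) ` L = L')"

text \<open>
  A positive word in the generators of the braid group on \<open>n\<close> strands is a list with entries in
  \<open>{1..<n}\<close>, the entry \<open>i\<close> standing for \<open>\<sigma>\<^sub>i\<close>; words are read from left to right.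
\<close>

definition braid_word :: "nat \<Rightarrow> nat list \<Rightarrow> bool" where
  "braid_word n w \<longleftrightarrow> set w \<subseteq> {1..<n}"

text \<open>
  The closed braid runs counterclockwise around the axis \<open>{0} \<times> \<real>\<close>; position \<open>k\<close> is the point
  at distance \<open>k\<close> from the axis and height \<open>0\<close>. Points of the half plane bounded by the axis are
  given as (distance, height). The set \<open>crossing_slice n i s\<close> is the cross section of \<open>\<sigma>\<^sub>i\<close> at
  time \<open>s \<in> [0,1]\<close>: the strand moving from position \<open>i\<close> to \<open>i + 1\<close> passes above the one moving
  from \<open>i + 1\<close> to \<open>i\<close>. The \<open>j\<close>-th letter of \<open>w\<close> occupies the \<open>j\<close>-th of \<open>length w\<close> equal sectors.
\<close>

definition crossing_slice :: "nat \<Rightarrow> nat \<Rightarrow> real \<Rightarrow> (real \<times> real) set" where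
  "crossing_slice n i s =
     {(real i + s, s * (1 - s)), (real i + 1 - s, - (s * (1 - s)))} \<union>
     {(real k, 0) | k. k \<in> {1..n} - {i, Suc i}}"

definition closed_braid_set :: "nat \<Rightarrow> nat list \<Rightarrow> space set" where
  "closed_braid_set n w =
     (if w = [] then {(of_nat k * cis \<theta>, 0) | k \<theta>. k \<in> {1..n}}
      else {(of_real \<rho> * cis (2 * pi * (real j + s) / real (length w)), z) | \<rho> z j s.
              j < length w \<and> s \<in> {0..1} \<and> (\<rho>, z) \<in> crossing_slice n (w ! j) s})"

text \<open>The orientation is the one in which the angle around the axis increases.\<close>

definition closed_braid :: "nat \<Rightarrow> nat list \<Rightarrow> (real \<Rightarrow> space) set" where
  "closed_braid n w = {\<gamma>. simple_path \<gamma> \<and> pathfinish \<gamma> = pathstart \<gamma> \<and>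
     path_image \<gamma> \<subseteq> closed_braid_set n w \<and>
     (\<exists>\<theta> :: real \<Rightarrow> real. continuous_on {0..1} \<theta> \<and> strict_mono_on {0..1} \<theta> \<and>
        (\<forall>t\<in>{0..1}. fst (\<gamma> t) = of_real (cmod (fst (\<gamma> t))) * cis (\<theta> t)))}"

definition represented_by :: "(real \<Rightarrow> space) set \<Rightarrow> nat \<Rightarrow> nat list \<Rightarrow> bool" where
  "represented_by L n w \<longleftrightarrow>
     oriented_link L \<and> braid_word n w \<and> ambient_isotopic L (closed_braid n w)"

text \<open>\<open>position w a\<close> is the position, after the word \<open>w\<close>, of the strand beginning at position \<open>a\<close>.\<close>

definition position :: "nat list \<Rightarrow> nat \<Rightarrow> nat" where
  "position w a = fold (\<lambda>i. Transposition.transpose i (Suc i)) w a"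

text \<open>In the \<open>j\<close>-th crossing of \<open>w\<close>, the strand beginning at \<open>a\<close> passes over the one beginning at \<open>b\<close>.\<close>

definition passes_over :: "nat list \<Rightarrow> nat \<Rightarrow> nat \<Rightarrow> nat \<Rightarrow> bool" where
  "passes_over w j a b \<longleftrightarrow>
     position (take j w) a = w ! j \<and> position (take j w) b = Suc (w ! j)"

definition lorenz_vector :: "nat list \<Rightarrow> bool" where
  "lorenz_vector d \<longleftrightarrow> d \<noteq> [] \<and> sorted d \<and> (\<forall>x\<in>set d. 1 \<le> x)"

text \<open>
  The positive words presenting the Lorenz braid with defining vector \<open>d\<close>. They differ only by
  interchanging commuting generators, hence all present the same braid.
\<close>

definition lorenz_braid :: "nat list \<Rightarrow> nat list \<Rightarrow> bool" where
  "lorenz_braid d w \<longleftrightarrow> lorenz_vector d \<and>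
     (let p = length d; n = p + last d in
        braid_word n w \<and>
        (\<forall>i\<in>{1..p}. position w i = i + d ! (i - 1)) \<and>
        strict_mono_on {p+1..n} (position w) \<and>
        (\<forall>a b. \<forall>j<length w. \<forall>j'<length w.
           (passes_over w j a b \<or> passes_over w j b a) \<and>
           (passes_over w j' a b \<or> passes_over w j' b a) \<longrightarrow> j = j') \<and>
        (\<forall>a b. \<forall>j<length w. passes_over w j a b \<longrightarrow> a \<in> {1..p} \<and> b \<in> {p+1..n}))"

definition lorenz_link :: "(real \<Rightarrow> space) set \<Rightarrow> bool" where
  "lorenz_link L \<longleftrightarrow> (\<exists>d w. lorenz_braid d w \<and> represented_by L (length d + last d) w)"

text \<open>The parameters \<open>(r\<^sub>1,s\<^sub>1), \<dots>, (r\<^sub>k,s\<^sub>k)\<close> form a list of pairs; \<open>k \<ge> 1\<close> is required.\<close>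

definition T_params :: "(nat \<times> nat) list \<Rightarrow> bool" where
  "T_params rs \<longleftrightarrow> rs \<noteq> [] \<and> sorted (map fst rs) \<and> (\<forall>(r, s)\<in>set rs. 2 \<le> r \<and> 0 < s)"

definition T_braid :: "(nat \<times> nat) list \<Rightarrow> nat list" where
  "T_braid rs = concat (map (\<lambda>(r, s). concat (replicate s [1..<r])) rs)"

definition T_link_with :: "(nat \<times> nat) list \<Rightarrow> (real \<Rightarrow> space) set \<Rightarrow> bool" where
  "T_link_with rs L \<longleftrightarrow> T_params rs \<and> represented_by L (fst (last rs)) (T_braid rs)"

definition T_link :: "(real \<Rightarrow> space) set \<Rightarrow> bool" where
  "T_link L \<longleftrightarrow> (\<exists>rs. T_link_with rs L)"

text \<open>The vector \<open>\<langle>r\<^sub>1\<^bsup>s\<^sub>1\<^esup>, \<dots>, r\<^sub>k\<^bsup>s\<^sub>k\<^esup>\<rangle>\<close>.\<close>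

definition power_vector :: "(nat \<times> nat) list \<Rightarrow> nat list" where
  "power_vector rs = concat (map (\<lambda>(r, s). replicate s r) rs)"

end

theory Submission
  imports Defs
begin

text \<open>
  The combinatorial reason for the theorem is that every overcrossing strand of a Lorenz braid can
  be removed by one destabilisation. Let the overcrossing strands of the braid \<open>\<langle>d\<^sub>1, \<dots>, d\<^sub>p\<rangle>\<close>
  move to the right one after the other, the rightmost one first; the last one then contributes
  the block \<open>\<sigma>\<^sub>1 \<dots> \<sigma>\<^bsub>d\<^sub>1\<^esub>\<close>, and \<open>\<sigma>\<^sub>1\<close> occurs nowhere else. So the closed braid winds around the
  axis at position \<open>1\<close> in a single loop, which can be pulled off the axis; this leaves the block
  \<open>\<sigma>\<^sub>1 \<dots> \<sigma>\<^bsub>d\<^sub>1 - 1\<^esub>\<close> of the T-braid and the Lorenz braid \<open>\<langle>d\<^sub>2, \<dots>, d\<^sub>p\<rangle>\<close>. In general a word \<open>T\<close> of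
  such blocks has been collected. Because \<open>\<sigma>\<^sub>1 \<dots> \<sigma>\<^sub>m \<sigma>\<^sub>j = \<sigma>\<^bsub>j+1\<^esub> \<sigma>\<^sub>1 \<dots> \<sigma>\<^sub>m\<close> for \<open>j < m\<close>, it
  slides through the next block \<open>\<sigma>\<^sub>1 \<dots> \<sigma>\<^bsub>d\<^sub>i\<^esub>\<close> at the price of raising all its indices by one,
  \<open>\<sigma>\<^sub>1\<close> occurs only once again, and the destabilisation lowers the indices to what they were. This
  uses that the \<open>d\<^sub>i\<close> are sorted, so that the letters of \<open>T\<close> are below \<open>d\<^sub>i\<close>. After \<open>p\<close> steps the
  T-braid remains (\<open>remove_overcrossing_strands\<close>). Entries \<open>1\<close> contribute empty blocks; only the
  Lorenz braids \<open>\<langle>1, \<dots>, 1\<rangle>\<close>, whose T-braid would be empty, need a word of their own.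

  Links are sets of curves in space, so each move has to be realised by an ambient isotopy.
  Conjugation is a rotation about the axis; the other moves come from one criterion,
  \<open>isotopic_to_id_linear_interpolation\<close>: a straight-line motion of a subset of space extends to an
  ambient isotopy as soon as at all times the displacements of any two points differ by at most a
  fixed multiple of their current distance. Cut into short steps, the motion differs from the
  identity by a map of Lipschitz constant below \<open>1\<close>, which extends to all of space, and the
  identity plus a contraction is a homeomorphism. For closed braids compactness reduces the
  criterion to the familiar condition that the strands stay disjoint at all times
  (\<open>geometric_braid_isotopy\<close>).

  This has two uses. First, a part of a word may be replaced by any other with the same
  permutation, provided that in all crossings of both the strand on top is the one that starts
  further to the left (\<open>descending_words_isotopic\<close>): the strands can be lifted to pairwise
  different heights, where they are free to move horizontally. All words presenting one Lorenz
  braid are of this kind, and so are both sides of the sliding relation. Second, in the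
  destabilisation (\<open>closed_braid_destabilisation\<close>) the loop around the axis is tilted to a helix
  of strictly increasing height, and then straightened with its heights kept fixed.

  Conversely, equal neighbouring parameters of a T-link can be merged without changing the
  T-braid, and the same isotopies, read backwards, lead to a Lorenz braid.
\<close>

section \<open>Ambient isotopies of three-space\<close>

text \<open>
  Ambient isotopies are handled through their final homeomorphism, which makes composition and
  inversion of isotopies statements about maps of space.
\<close>

definition isotopic_to_id :: "(space \<Rightarrow> space) \<Rightarrow> bool" where
  "isotopic_to_id h \<longleftrightarrow>
     homotopic_with_canon (\<lambda>f. \<exists>g. homeomorphism UNIV UNIV f g) UNIV UNIV id h"

lemma isotopic_to_id_iff:
  "isotopic_to_id h \<longleftrightarrow> (\<exists>H :: real \<Rightarrow> space \<Rightarrow> space.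
     continuous_on ({0..1} \<times> UNIV) (\<lambda>(t, x). H t x) \<and> (\<forall>x. H 0 x = x) \<and> (\<forall>x. H 1 x = h x) \<and>
     (\<forall>t\<in>{0..1}. \<exists>g. homeomorphism UNIV UNIV (H t) g))" (is "?L \<longleftrightarrow> ?R")
proof
  assume ?L
  then obtain k :: "real \<times> space \<Rightarrow> space" where "continuous_on ({0..1} \<times> UNIV) k"
    "\<forall>x. k (0, x) = x" "\<forall>x. k (1, x) = h x"
    "\<forall>t\<in>{0..1}. \<exists>g. homeomorphism UNIV UNIV (\<lambda>x. k (t, x)) g"
    unfolding isotopic_to_id_def homotopic_with_def
    by (auto simp: prod_topology_subtopology_eu simp flip: subtopology_UNIV simp del:
        split_paired_All)
  then show ?R
    by (intro exI[of _ "\<lambda>t x. k (t, x)"]) (simp add: case_prod_unfold)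
next
  assume ?R
  then obtain H :: "real \<Rightarrow> space \<Rightarrow> space"
      where "continuous_on ({0..1} \<times> UNIV) (\<lambda>(t, x). H t x)" "\<forall>x. H 0 x = x"
    "\<forall>x. H 1 x = h x" "\<forall>t\<in>{0..1}. \<exists>g. homeomorphism UNIV UNIV (H t) g" by blast
  then show ?L
    unfolding isotopic_to_id_def homotopic_with_def
    by (intro exI[of _ "\<lambda>(t, x). H t x"])
      (simp add: prod_topology_subtopology_eu flip: subtopology_UNIV)
qed

lemma isotopic_to_idI:
  fixes H :: "real \<Rightarrow> space \<Rightarrow> space"
  assumes "continuous_on ({0..1} \<times> UNIV) (\<lambda>(t, x). H t x)"
    and "\<And>x. H 0 x = x" and "\<And>x. H 1 x = h x"
    and "\<And>t. t \<in> {0..1} \<Longrightarrow> \<exists>g. homeomorphism UNIV UNIV (H t) g"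
  shows "isotopic_to_id h"
  unfolding isotopic_to_id_iff using assms by blast

lemma isotopic_to_id_homeomorphism:
  assumes "isotopic_to_id h"
  obtains g where "homeomorphism UNIV UNIV h g"
  using assms homotopic_with_imp_property unfolding isotopic_to_id_def by blast

lemma isotopic_to_id_comp:
  assumes "isotopic_to_id h" "isotopic_to_id h'"
  shows "isotopic_to_id (h' \<circ> h)"
proof -
  obtain H :: "real \<Rightarrow> space \<Rightarrow> space" where H: "continuous_on ({0..1} \<times> UNIV) (\<lambda>(t, x). H t x)"
    "\<And>x. H 0 x = x" "\<And>x. H 1 x = h x"
    "\<And>t. t \<in> {0..1} \<Longrightarrow> \<exists>g. homeomorphism UNIV UNIV (H t) g"
    using assms(1) unfolding isotopic_to_id_iff by blast
  obtain H' :: "real \<Rightarrow> space \<Rightarrow> space" where H': "continuous_on ({0..1} \<times> UNIV) (\<lambda>(t, x). H' t x)"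
    "\<And>x. H' 0 x = x" "\<And>x. H' 1 x = h' x"
    "\<And>t. t \<in> {0..1} \<Longrightarrow> \<exists>g. homeomorphism UNIV UNIV (H' t) g"
    using assms(2) unfolding isotopic_to_id_iff by blast
  show ?thesis
  proof (rule isotopic_to_idI[of "\<lambda>t x. H' t (H t x)"])
    have "continuous_on ({0..1} \<times> UNIV) ((\<lambda>(t, x). H' t x) \<circ> (\<lambda>p. (fst p, (\<lambda>(t, x). H t x) p)))"
      by (rule continuous_on_compose)
        (auto intro!: continuous_intros H(1) continuous_on_subset[OF H'(1)])
    then show "continuous_on ({0..1} \<times> UNIV) (\<lambda>(t, x). H' t (H t x))"
      by (simp add: case_prod_unfold o_def)
    show "\<exists>g. homeomorphism UNIV UNIV (\<lambda>x. H' t (H t x)) g" if "t \<in> {0..1}" for t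
      using H(4)[OF that] H'(4)[OF that] homeomorphism_compose[of UNIV UNIV "H t" _ UNIV "H' t"]
      by (fastforce simp: o_def)
  qed (auto simp: H H')
qed

lemma isotopic_to_id_inverse:
  assumes "isotopic_to_id h" and hg: "homeomorphism UNIV UNIV h g"
  shows "isotopic_to_id g"
proof -
  obtain H :: "real \<Rightarrow> space \<Rightarrow> space" where H: "continuous_on ({0..1} \<times> UNIV) (\<lambda>(t, x). H t x)"
    "\<And>x. H 0 x = x" "\<And>x. H 1 x = h x"
    "\<And>t. t \<in> {0..1} \<Longrightarrow> \<exists>g. homeomorphism UNIV UNIV (H t) g"
    using assms(1) unfolding isotopic_to_id_iff by blast
  have gh: "g (h x) = x" "continuous_on UNIV g" "homeomorphism UNIV UNIV g h" for x
    using hg by (auto simp: homeomorphism_def simp del: split_paired_All)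
  show ?thesis
    \<comment> \<open>Running the isotopy backwards and composing with the inverse avoids inverting it jointly
      in time and space.\<close>
  proof (rule isotopic_to_idI[of "\<lambda>t x. g (H (1 - t) x)"])
    have "continuous_on ({0..1} \<times> UNIV) (g \<circ> ((\<lambda>(t, x). H t x) \<circ> (\<lambda>p. (1 - fst p, snd p))))"
      by (intro continuous_on_compose continuous_on_subset[OF gh(2)] continuous_on_subset[OF H(1)])
        (auto intro!: continuous_intros)
    then show "continuous_on ({0..1} \<times> UNIV) (\<lambda>(t, x). g (H (1 - t) x))"
      by (simp add: case_prod_unfold o_def)
    show "\<exists>g'. homeomorphism UNIV UNIV (\<lambda>x. g (H (1 - t) x)) g'" if "t \<in> {0..1}" for t
      using H(4)[of "1 - t"] that gh(3) homeomorphism_compose[of UNIV UNIV "H (1 - t)" _ UNIV g]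
      by (fastforce simp: o_def)
  qed (auto simp: H gh)
qed

lemma isotopic_to_id_id: "isotopic_to_id id"
  by (rule isotopic_to_idI[of "\<lambda>t x. x"])
    (auto intro!: continuous_intros homeomorphism_ident simp: case_prod_unfold)

lemma ambient_isotopic_iff:
  "ambient_isotopic L L' \<longleftrightarrow> (\<exists>h. isotopic_to_id h \<and> (\<lambda>\<gamma>. h \<circ> \<gamma>) ` L = L')"
  unfolding ambient_isotopic_def isotopic_to_id_def by (rule refl)

lemma ambient_isotopic_refl: "ambient_isotopic L L"
  unfolding ambient_isotopic_iff by (rule exI[of _ id]) (auto simp: isotopic_to_id_id)

lemma ambient_isotopic_trans [trans]:
  assumes "ambient_isotopic L L'" "ambient_isotopic L' L''"
  shows "ambient_isotopic L L''"
proof -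
  obtain h h' where h: "isotopic_to_id h" "(\<lambda>\<gamma>. h \<circ> \<gamma>) ` L = L'"
    "isotopic_to_id h'" "(\<lambda>\<gamma>. h' \<circ> \<gamma>) ` L' = L''"
    using assms unfolding ambient_isotopic_iff by metis
  have "(\<lambda>\<gamma>. (h' \<circ> h) \<circ> \<gamma>) ` L = L''"
    unfolding h(2)[symmetric] h(4)[symmetric] image_image by (simp add: o_assoc)
  then show ?thesis
    using isotopic_to_id_comp[OF h(1,3)] unfolding ambient_isotopic_iff by blast
qed

lemma ambient_isotopic_sym:
  assumes "ambient_isotopic L L'"
  shows "ambient_isotopic L' L"
proof -
  obtain h where h: "isotopic_to_id h" "(\<lambda>\<gamma>. h \<circ> \<gamma>) ` L = L'"
    using assms unfolding ambient_isotopic_iff by metis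
  obtain g where g: "homeomorphism UNIV UNIV h g"
    using isotopic_to_id_homeomorphism[OF h(1)] .
  then have "g \<circ> (h \<circ> \<gamma>) = \<gamma>" for \<gamma> :: "real \<Rightarrow> space"
    by (auto simp: homeomorphism_def fun_eq_iff simp del: split_paired_All)
  then have "(\<lambda>\<gamma>. g \<circ> \<gamma>) ` L' = L"
    unfolding h(2)[symmetric] image_image by simp
  then show ?thesis
    using isotopic_to_id_inverse[OF h(1) g] unfolding ambient_isotopic_iff by blast
qed

text \<open>
  The equation \<open>x + g x = y\<close> is a fixed point problem for the contraction \<open>x \<mapsto> y - g x\<close>.
\<close>

lemma homeomorphism_add_contraction:
  fixes g :: "space \<Rightarrow> space"
  assumes c: "c < 1" and g: "c-lipschitz_on UNIV g"
  shows "\<exists>g'. homeomorphism UNIV UNIV (\<lambda>x. x + g x) g'"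
proof -
  have c0: "0 \<le> c" using g by (rule lipschitz_on_nonneg)
  have gl: "norm (g x - g y) \<le> c * norm (x - y)" for x y
    using lipschitz_on_normD[OF g] by simp
  have low: "(1 - c) * norm (x - y) \<le> norm ((x + g x) - (y + g y))" for x y
    using gl[of x y] norm_triangle_ineq2[of "x - y" "g y - g x"]
    by (simp add: algebra_simps norm_minus_commute)
  have ex: "\<exists>x. y = x + g x" for y
  proof -
    have "\<exists>!x. y - g x = x"
      by (rule banach_fix_type[OF c0 c]) (use gl in \<open>auto simp: dist_norm norm_minus_commute\<close>)
    then show ?thesis by (metis diff_add_cancel)
  qed
  then obtain g' where g': "\<And>y. y = g' y + g (g' y)" by metis
  have inj: "x = y" if "x + g x = y + g y" for x y
    using low[of x y] that c by (simp add: mult_le_0_iff)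
  have "(1 / (1 - c))-lipschitz_on UNIV g'"
  proof (rule lipschitz_onI)
    fix x y
    show "dist (g' x) (g' y) \<le> 1 / (1 - c) * dist x y"
      using low[of "g' x" "g' y"] c unfolding g'[symmetric] dist_norm
      by (simp add: field_simps)
  qed (use c in auto)
  then have "continuous_on UNIV g'"
    by (rule lipschitz_on_continuous_on)
  moreover have "continuous_on UNIV (\<lambda>x. x + g x)"
    by (intro continuous_intros lipschitz_on_continuous_on[OF g])
  ultimately have "homeomorphism UNIV UNIV (\<lambda>x. x + g x) g'"
    by (intro homeomorphismI) (auto simp flip: g' intro: inj)
  then show ?thesis by blast
qed

lemma isotopic_to_id_add_contraction:
  fixes g :: "space \<Rightarrow> space"
  assumes c: "c < 1" and g: "c-lipschitz_on UNIV g"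
  shows "isotopic_to_id (\<lambda>x. x + g x)"
proof (rule isotopic_to_idI[of "\<lambda>t x. x + t *\<^sub>R g x"])
  have "continuous_on ({0..1::real} \<times> (UNIV :: space set)) (\<lambda>p. g (snd p))"
    by (rule continuous_on_compose2[OF lipschitz_on_continuous_on[OF g]])
      (auto intro!: continuous_intros)
  then show "continuous_on ({0..1} \<times> UNIV) (\<lambda>(t, x). x + t *\<^sub>R g x)"
    by (auto simp: case_prod_unfold intro!: continuous_intros)
  show "\<exists>g'. homeomorphism UNIV UNIV (\<lambda>x. x + t *\<^sub>R g x) g'" if t: "t \<in> {0..1}" for t
  proof (rule homeomorphism_add_contraction[OF c])
    have "(1 * c)-lipschitz_on UNIV (\<lambda>x. t *\<^sub>R g x)"
      by (rule lipschitz_on_cmult_upper[OF g]) (use t in auto)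
    then show "c-lipschitz_on UNIV (\<lambda>x. t *\<^sub>R g x)" by simp
  qed
qed auto

text \<open>
  McShane's extension: the infimum of the cones of slope \<open>L\<close> standing on the graph of \<open>f\<close>.
\<close>

lemma lipschitz_extension_real:
  fixes f :: "'a::metric_space \<Rightarrow> real"
  assumes f: "L-lipschitz_on A f"
  obtains g where "L-lipschitz_on UNIV g" "\<And>x. x \<in> A \<Longrightarrow> g x = f x"
proof (cases "A = {}")
  case True
  then show ?thesis
    using that[of "\<lambda>_. 0"] lipschitz_on_nonneg[OF f] by (simp add: lipschitz_on_def)
next
  case False
  then obtain a0 where a0: "a0 \<in> A" by auto
  have L0: "0 \<le> L" using f by (rule lipschitz_on_nonneg)
  have fl: "f y \<le> f a + L * dist a y" if "a \<in> A" "y \<in> A" for a y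
    using lipschitz_onD[OF f that] by (auto simp: dist_real_def)
  define g where "g x = (INF a\<in>A. f a + L * dist a x)" for x
  have bdd: "bdd_below ((\<lambda>a. f a + L * dist a x) ` A)" for x
  proof (rule bdd_belowI2)
    fix a assume a: "a \<in> A"
    have "L * dist a a0 \<le> L * dist a x + L * dist a0 x"
      using mult_left_mono[OF dist_triangle2[of a a0 x] L0] by (simp add: algebra_simps)
    then show "f a0 - L * dist a0 x \<le> f a + L * dist a x"
      using fl[OF a a0] by (simp add: dist_commute)
  qed
  have le: "g x \<le> g y + L * dist x y" for x y
  proof -
    have "g x - L * dist x y \<le> f a + L * dist a y" if a: "a \<in> A" for a
    proof -
      have "g x \<le> f a + L * dist a x"
        unfolding g_def by (rule cINF_lower[OF bdd a])
      also have "L * dist a x \<le> L * dist a y + L * dist x y"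
        using mult_left_mono[OF dist_triangle2[of a x y] L0] by (simp add: algebra_simps)
      finally show ?thesis by simp
    qed
    then have "g x - L * dist x y \<le> g y"
      unfolding g_def[of y] using False by (intro cINF_greatest) auto
    then show ?thesis by simp
  qed
  show ?thesis
  proof (rule that[of g])
    show "L-lipschitz_on UNIV g"
    proof (rule lipschitz_onI)
      show "dist (g x) (g y) \<le> L * dist x y" for x y
        using le[of x y] le[of y x] by (auto simp: dist_real_def dist_commute abs_le_iff)
    qed (rule L0)
    show "g x = f x" if x: "x \<in> A" for x
    proof (rule antisym)
      show "g x \<le> f x"
        using cINF_lower[OF bdd[of x] x] by (simp add: g_def)
      show "f x \<le> g x"
        unfolding g_def using False by (intro cINF_greatest) (auto intro: fl x)
    qed
  qed
qed

text \<open>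
  The factor \<open>3\<close> is the price of extending the three coordinates separately; any constant would
  serve.
\<close>

lemma lipschitz_extension_space:
  fixes f :: "'a::metric_space \<Rightarrow> space"
  assumes f: "L-lipschitz_on A f"
  obtains g where "(3 * L)-lipschitz_on UNIV g" "\<And>x. x \<in> A \<Longrightarrow> g x = f x"
proof -
  have L0: "0 \<le> L" using f by (rule lipschitz_on_nonneg)
  have comp: "L-lipschitz_on A (\<lambda>x. p (f x))"
    if p: "\<And>u v. \<bar>p u - p v\<bar> \<le> norm (u - v)" for p :: "space \<Rightarrow> real"
  proof (rule lipschitz_onI[OF _ L0])
    show "dist (p (f x)) (p (f y)) \<le> L * dist x y" if "x \<in> A" "y \<in> A" for x y
      using p[of "f x" "f y"] lipschitz_onD[OF f that] by (auto simp: dist_real_def dist_norm)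
  qed
  have n: "norm (fst u) \<le> norm u" "norm (snd u) \<le> norm u" for u :: space
    by (metis norm_fst_le prod.collapse, metis norm_snd_le prod.collapse)
  have p1: "\<bar>Re (fst u) - Re (fst v)\<bar> \<le> norm (u - v)" for u v :: space
    using abs_Re_le_cmod[of "fst (u - v)"] n(1)[of "u - v"] by simp
  have p2: "\<bar>Im (fst u) - Im (fst v)\<bar> \<le> norm (u - v)" for u v :: space
    using abs_Im_le_cmod[of "fst (u - v)"] n(1)[of "u - v"] by simp
  have p3: "\<bar>snd u - snd v\<bar> \<le> norm (u - v)" for u v :: space
    using n(2)[of "u - v"] by simp
  obtain g1 where g1: "L-lipschitz_on UNIV g1" "\<And>x. x \<in> A \<Longrightarrow> g1 x = Re (fst (f x))"
    using lipschitz_extension_real[OF comp[OF p1]] by metis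
  obtain g2 where g2: "L-lipschitz_on UNIV g2" "\<And>x. x \<in> A \<Longrightarrow> g2 x = Im (fst (f x))"
    using lipschitz_extension_real[OF comp[OF p2]] by metis
  obtain g3 where g3: "L-lipschitz_on UNIV g3" "\<And>x. x \<in> A \<Longrightarrow> g3 x = snd (f x)"
    using lipschitz_extension_real[OF comp[OF p3]] by metis
  show ?thesis
  proof (rule that[of "\<lambda>x. (Complex (g1 x) (g2 x), g3 x)"])
    show "(3 * L)-lipschitz_on UNIV (\<lambda>x. (Complex (g1 x) (g2 x), g3 x))"
    proof (rule lipschitz_onI)
      fix x y
      have "dist (Complex (g1 x) (g2 x), g3 x) (Complex (g1 y) (g2 y), g3 y)
          \<le> norm (Complex (g1 x - g1 y) (g2 x - g2 y)) + norm (g3 x - g3 y)"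
        unfolding dist_norm using norm_Pair_le[of "Complex (g1 x - g1 y) (g2 x - g2 y)"
            "g3 x - g3 y"]
        by (simp add: complex_diff)
      also have "norm (Complex (g1 x - g1 y) (g2 x - g2 y)) \<le> \<bar>g1 x - g1 y\<bar> + \<bar>g2 x - g2 y\<bar>"
        using cmod_le[of "Complex (g1 x - g1 y) (g2 x - g2 y)"] by simp
      finally show "dist (Complex (g1 x) (g2 x), g3 x) (Complex (g1 y) (g2 y), g3 y)
          \<le> 3 * L * dist x y"
        using lipschitz_onD[OF g1(1), of x y] lipschitz_onD[OF g2(1), of x y]
          lipschitz_onD[OF g3(1), of x y] by (simp add: dist_real_def)
    qed (use L0 in auto)
  qed (auto simp: g1 g2 g3 complex_eq_iff prod_eq_iff)
qed

abbreviation interp :: "real \<Rightarrow> 'a::real_vector \<Rightarrow> 'a \<Rightarrow> 'a" where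
  "interp t x y \<equiv> (1 - t) *\<^sub>R x + t *\<^sub>R y"

text \<open>
  For small \<open>1 / N\<close>, the step from time \<open>t\<close> to time \<open>t + 1 / N\<close> displaces \<open>F\<^sub>t x\<close> by \<open>(1 / N) (F\<^sub>1
  x - F\<^sub>0 x)\<close>. The hypothesis makes this a well-defined Lipschitz function of the point \<open>F\<^sub>t x\<close>
  (in particular \<open>F\<^sub>t\<close> identifies the same points at all times), with a constant that tends to \<open>0\<close>
  as \<open>N\<close> grows, so that its extension to space is a contraction and the step is the restriction of
  an ambient isotopy.
\<close>

lemma isotopic_to_id_linear_interpolation:
  fixes F0 F1 :: "'a \<Rightarrow> space"
  assumes C: "\<And>t x y. \<lbrakk>t \<in> {0..1}; x \<in> S; y \<in> S\<rbrakk> \<Longrightarrow>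
      norm ((F1 x - F0 x) - (F1 y - F0 y))
        \<le> C * norm (interp t (F0 x) (F1 x) - interp t (F0 y) (F1 y))"
  obtains h where "isotopic_to_id h" "\<And>x. x \<in> S \<Longrightarrow> h (F0 x) = F1 x"
proof -
  define F where "F t x = interp t (F0 x) (F1 x)" for t x
  define C' where "C' = max C 0"
  have C': "norm ((F1 x - F0 x) - (F1 y - F0 y)) \<le> C' * norm (F t x - F t y)"
    if "t \<in> {0..1}" "x \<in> S" "y \<in> S" for t x y
    using C[OF that] mult_right_mono[of C C' "norm (F t x - F t y)"]
    by (simp add: F_def C'_def)
  have C'0: "0 \<le> C'" by (simp add: C'_def)
  obtain N :: nat where N: "3 * C' < N" using reals_Archimedean2 by blast
  then have Npos: "0 < N" using C'0 by (cases N) auto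
  have step: "\<exists>h. isotopic_to_id h \<and> (\<forall>x\<in>S. h (F t x) = F (t + 1 / N) x)" if t: "t \<in> {0..1}" for t
  proof -
    \<comment> \<open>The displacement at \<open>p\<close>, read off from any of the points of \<open>S\<close> that \<open>F t\<close> sends to \<open>p\<close>.\<close>
    define f where "f p = (1 / N) *\<^sub>R (let x = (SOME x. x \<in> S \<and> F t x = p) in F1 x - F0 x)" for p
    have f: "f (F t x) = (1 / N) *\<^sub>R (F1 x - F0 x)" if x: "x \<in> S" for x
    proof -
      define y where "y = (SOME y. y \<in> S \<and> F t y = F t x)"
      have y: "y \<in> S" "F t y = F t x"
        using someI_ex[of "\<lambda>y. y \<in> S \<and> F t y = F t x"] x unfolding y_def by blast+
      have "F1 y - F0 y = F1 x - F0 x"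
        using C'[OF t y(1) x] y(2) by simp
      then show ?thesis by (simp add: f_def y_def[symmetric] Let_def)
    qed
    have "(C' / N)-lipschitz_on (F t ` S) f"
    proof (rule lipschitz_onI)
      fix p q assume "p \<in> F t ` S" "q \<in> F t ` S"
      then obtain x y where xy: "p = F t x" "q = F t y" "x \<in> S" "y \<in> S" by auto
      show "dist (f p) (f q) \<le> C' / N * dist p q"
        using C'[OF t xy(3,4)] Npos
        by (simp add: xy f dist_norm flip: scaleR_diff_right) (simp add: field_simps)
    qed (use C'0 in auto)
    then obtain g where g: "(3 * (C' / N))-lipschitz_on UNIV g" "\<And>p. p \<in> F t ` S \<Longrightarrow> g p = f p"
      using lipschitz_extension_space by metis
    have "isotopic_to_id (\<lambda>x. x + g x)"
      by (rule isotopic_to_id_add_contraction[OF _ g(1)]) (use N Npos in \<open>simp add: field_simps\<close>)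
    moreover have "F t x + g (F t x) = F (t + 1 / N) x" if "x \<in> S" for x
    proof -
      have "g (F t x) = (1 / N) *\<^sub>R (F1 x - F0 x)" using that by (simp add: g(2) f)
      then show ?thesis by (simp add: F_def algebra_simps)
    qed
    ultimately show ?thesis by (intro exI[of _ "\<lambda>x. x + g x"]) auto
  qed
  have "i \<le> N \<Longrightarrow> \<exists>h. isotopic_to_id h \<and> (\<forall>x\<in>S. h (F0 x) = F (i / N) x)" for i :: nat
  proof (induction i)
    case 0
    then show ?case by (intro exI[of _ id] conjI isotopic_to_id_id) (simp add: F_def)
  next
    case (Suc i)
    then obtain h where h: "isotopic_to_id h" "\<And>x. x \<in> S \<Longrightarrow> h (F0 x) = F (i / N) x" by auto
    obtain h' where h': "isotopic_to_id h'" "\<And>x. x \<in> S \<Longrightarrow> h' (F (i / N) x) = F (i / N + 1 / N) x"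
      using step[of "i / N"] Suc.prems by auto
    have "isotopic_to_id (h' \<circ> h)" using isotopic_to_id_comp[OF h(1) h'(1)] .
    moreover have "\<forall>x\<in>S. (h' \<circ> h) (F0 x) = F (Suc i / N) x"
      using h(2) h'(2) by (simp add: add_divide_distrib add.commute)
    ultimately show ?case by blast
  qed
  from this[of N] show thesis using that Npos by (auto simp: F_def)
qed

section \<open>Links composed of arcs\<close>

text \<open>
  Right after time \<open>t\<close>, the curve \<open>\<gamma>\<close> moves along one of the arcs \<open>c k : [0, 1] \<rightarrow> \<real>\<^sup>3\<close> in its
  direction.
\<close>

abbreviation follows_arcs ::
    "nat set \<Rightarrow> (nat \<Rightarrow> real \<Rightarrow> space) \<Rightarrow> (real \<Rightarrow> space) \<Rightarrow> real \<Rightarrow> bool" where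
  "follows_arcs I c \<gamma> t \<equiv> \<exists>e\<in>{t<..1}. \<exists>k\<in>I. \<exists>\<phi>. continuous_on {t..e} \<phi> \<and>
     strict_mono_on {t..e} \<phi> \<and> \<phi> ` {t..e} \<subseteq> {0..1} \<and> (\<forall>s\<in>{t..e}. \<gamma> s = c k (\<phi> s))"

text \<open>
  The oriented link formed by the arcs: the simple closed curves that follow the arcs in their
  direction. Looking only at a short time interval to the right of each \<open>t\<close> makes the notion
  local: it refers neither to the way the arcs are glued together nor to the number of arcs per
  component, and it is indifferent to subdivision of the arcs.
\<close>

definition curve_link :: "nat set \<Rightarrow> (nat \<Rightarrow> real \<Rightarrow> space) \<Rightarrow> (real \<Rightarrow> space) set" where
  "curve_link I c = {\<gamma>. simple_path \<gamma> \<and> pathfinish \<gamma> = pathstart \<gamma> \<and>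
     (\<forall>t\<in>{0..<1}. follows_arcs I c \<gamma> t)}"

lemma curve_linkD:
  assumes "\<gamma> \<in> curve_link I c" and "t \<in> {0..<1}"
  shows "follows_arcs I c \<gamma> t"
  using assms by (simp add: curve_link_def)

lemma curve_link_image_subset:
  assumes h: "continuous_on UNIV h" "inj h"
    and hc: "\<And>k u. \<lbrakk>k \<in> I; u \<in> {0..1}\<rbrakk> \<Longrightarrow> h (c k u) = c' k u"
    and g: "\<gamma> \<in> curve_link I c"
  shows "h \<circ> \<gamma> \<in> curve_link I c'"
proof -
  have "simple_path (h \<circ> \<gamma>)"
    using g h by (intro simple_path_continuous_image)
      (auto simp: curve_link_def intro: continuous_on_subset inj_on_subset)
  moreover have "pathfinish (h \<circ> \<gamma>) = pathstart (h \<circ> \<gamma>)"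
    using g by (simp add: curve_link_def pathfinish_def pathstart_def)
  moreover have "follows_arcs I c' (h \<circ> \<gamma>) t" if t: "t \<in> {0..<1}" for t
  proof -
    obtain e k \<phi> where "e \<in> {t<..1}" "k \<in> I" "continuous_on {t..e} \<phi>" "strict_mono_on {t..e} \<phi>"
        "\<phi> ` {t..e} \<subseteq> {0..1}" "\<forall>s\<in>{t..e}. \<gamma> s = c k (\<phi> s)"
      using curve_linkD[OF g t] by (elim bexE exE conjE) (rule that)
    then show ?thesis
      by (intro bexI[of _ e] bexI[of _ k] exI[of _ \<phi>]) (auto simp: hc image_subset_iff)
  qed
  ultimately show ?thesis by (simp add: curve_link_def)
qed

lemma ambient_isotopic_curve_link:
  assumes h: "isotopic_to_id h"
    and hc: "\<And>k u. \<lbrakk>k \<in> I; u \<in> {0..1}\<rbrakk> \<Longrightarrow> h (c k u) = c' k u"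
  shows "ambient_isotopic (curve_link I c) (curve_link I c')"
proof -
  obtain g where g: "homeomorphism UNIV UNIV h g"
    using isotopic_to_id_homeomorphism[OF h] .
  have gh: "\<And>x. g (h x) = x" "\<And>x. h (g x) = x" "continuous_on UNIV g" "continuous_on UNIV h"
    using g by (auto simp: homeomorphism_def simp del: split_paired_All)
  have inj: "inj h" "inj g" using gh(1,2) by (metis injI, metis injI)
  have gc: "g (c' k u) = c k u" if "k \<in> I" "u \<in> {0..1}" for k u
    using hc[OF that] gh(1) by metis
  have "curve_link I c' \<subseteq> (\<lambda>\<gamma>. h \<circ> \<gamma>) ` curve_link I c"
  proof
    fix \<gamma> assume "\<gamma> \<in> curve_link I c'"
    then have "g \<circ> \<gamma> \<in> curve_link I c"
      using curve_link_image_subset[OF gh(3) inj(2) gc] by simp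
    moreover have "\<gamma> = h \<circ> (g \<circ> \<gamma>)" by (simp add: fun_eq_iff gh)
    ultimately show "\<gamma> \<in> (\<lambda>\<gamma>. h \<circ> \<gamma>) ` curve_link I c" by blast
  qed
  moreover have "(\<lambda>\<gamma>. h \<circ> \<gamma>) ` curve_link I c \<subseteq> curve_link I c'"
    by (intro image_subsetI curve_link_image_subset[OF gh(4) inj(1) hc])
  ultimately have "(\<lambda>\<gamma>. h \<circ> \<gamma>) ` curve_link I c = curve_link I c'" by (rule antisym[rotated])
  with h show ?thesis unfolding ambient_isotopic_iff by blast
qed

lemma ambient_isotopic_linear_interpolation:
  fixes c0 c1 :: "nat \<Rightarrow> real \<Rightarrow> space"
  assumes "\<And>t k u k' u'. \<lbrakk>t \<in> {0..1}; k \<in> I; k' \<in> I; u \<in> {0..1}; u' \<in> {0..1}\<rbrakk> \<Longrightarrow>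
      norm ((c1 k u - c0 k u) - (c1 k' u' - c0 k' u'))
        \<le> C * norm (interp t (c0 k u) (c1 k u) - interp t (c0 k' u') (c1 k' u'))"
  shows "ambient_isotopic (curve_link I c0) (curve_link I c1)"
proof -
  obtain h where "isotopic_to_id h"
    "\<And>x. x \<in> I \<times> {0..1} \<Longrightarrow> h (case_prod c0 x) = case_prod c1 x"
    by (rule isotopic_to_id_linear_interpolation[of "I \<times> {0..1}" "case_prod c1" "case_prod c0" C])
      (use assms in auto)
  then show ?thesis
    using ambient_isotopic_curve_link[of h I c0 c1] by auto
qed

text \<open>
  It suffices to express each arc \<open>c k\<close>, near each of its points and in its own direction, as a
  reparametrised piece of some \<open>c' k'\<close>. This compares two decompositions of one link into arcs.
\<close>

lemma curve_link_reparametrise: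
  assumes "\<And>k u. \<lbrakk>k \<in> I; u \<in> {0..<1}\<rbrakk> \<Longrightarrow> follows_arcs I' c' (c k) u"
  shows "curve_link I c \<subseteq> curve_link I' c'"
proof
  fix \<gamma> assume g: "\<gamma> \<in> curve_link I c"
  have "follows_arcs I' c' \<gamma> t" if t: "t \<in> {0..<1}" for t
  proof -
    obtain e k \<phi> where e: "e \<in> {t<..1}" "k \<in> I" "continuous_on {t..e} \<phi>" "strict_mono_on {t..e} \<phi>"
        "\<phi> ` {t..e} \<subseteq> {0..1}" "\<forall>s\<in>{t..e}. \<gamma> s = c k (\<phi> s)"
      using curve_linkD[OF g t] by (elim bexE exE conjE) (rule that)
    have le: "\<phi> t < \<phi> e" using e(1,4) by (auto simp: strict_mono_on_def)
    have bounds: "0 \<le> \<phi> s" "\<phi> s \<le> 1" if "s \<in> {t..e}" for s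
      using subsetD[OF e(5) imageI[OF that]] by auto
    have u: "\<phi> t \<in> {0..<1}"
      using le bounds[of t] bounds[of e] e(1) by auto
    obtain e' k' \<psi> where e': "e' \<in> {\<phi> t<..1}" "k' \<in> I'" "continuous_on {\<phi> t..e'} \<psi>"
      "strict_mono_on {\<phi> t..e'} \<psi>" "\<psi> ` {\<phi> t..e'} \<subseteq> {0..1}" "\<forall>v\<in>{\<phi> t..e'}. c k v = c' k' (\<psi> v)"
      using assms[OF e(2) u] by (elim bexE exE conjE) (rule that)
    obtain e'' where e'': "e'' \<in> {t<..e}" "\<phi> e'' \<le> e'"
    proof (cases "\<phi> e \<le> e'")
      case True
      then show ?thesis using that[of e] e(1) by auto
    next
      case False
      then have "\<exists>x\<ge>t. x \<le> e \<and> \<phi> x = e'"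
        using e(1,3) e'(1) by (intro IVT') auto
      then obtain x where "t \<le> x" "x \<le> e" "\<phi> x = e'" by auto
      then show ?thesis using that[of x] e'(1) by (cases "x = t") auto
    qed
    have sub: "{t..e''} \<subseteq> {t..e}" using e'' by auto
    have mono: "strict_mono_on {t..e''} \<phi>"
      using e(4) sub unfolding strict_mono_on_def by blast
    have img: "\<phi> ` {t..e''} \<subseteq> {\<phi> t..e'}"
    proof
      fix x assume "x \<in> \<phi> ` {t..e''}"
      then obtain s where s: "s \<in> {t..e''}" "x = \<phi> s" by auto
      then have "\<phi> t \<le> \<phi> s" "\<phi> s \<le> \<phi> e''"
        using strict_mono_on_leD[OF mono] e'' by auto
      then show "x \<in> {\<phi> t..e'}" using s e'' by auto
    qed
    show ?thesis
    proof (intro bexI[of _ e''] bexI[of _ k'] exI[of _ "\<psi> \<circ> \<phi>"] conjI ballI)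
      show "continuous_on {t..e''} (\<psi> \<circ> \<phi>)"
        by (intro continuous_on_compose continuous_on_subset[OF e(3) sub]
            continuous_on_subset[OF e'(3) img])
      show "strict_mono_on {t..e''} (\<psi> \<circ> \<phi>)"
        using mono e'(4) img unfolding strict_mono_on_def by (auto simp: image_subset_iff)
      show "(\<psi> \<circ> \<phi>) ` {t..e''} \<subseteq> {0..1}"
        using e'(5) img by (auto simp: image_subset_iff)
      show "\<gamma> s = c' k' ((\<psi> \<circ> \<phi>) s)" if "s \<in> {t..e''}" for s
        using e(6) e'(6) img that sub by (auto simp: image_subset_iff)
    qed (use e e' e'' in auto)
  qed
  then show "\<gamma> \<in> curve_link I' c'" using g by (simp add: curve_link_def)
qed

lemma curve_link_cong:
  assumes "\<And>k u. \<lbrakk>k \<in> I; u \<in> {0..1}\<rbrakk> \<Longrightarrow> c k u = c' k u"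
  shows "curve_link I c = curve_link I c'"
proof -
  have sub: "curve_link I d \<subseteq> curve_link I d'"
    if "\<And>k u. \<lbrakk>k \<in> I; u \<in> {0..1}\<rbrakk> \<Longrightarrow> d k u = d' k u" for d d' :: "nat \<Rightarrow> real \<Rightarrow> space"
  proof (rule curve_link_reparametrise)
    fix k u assume "k \<in> I" "u \<in> {0..<1::real}"
    then show "follows_arcs I d' (d k) u"
      by (intro bexI[of _ 1] bexI[of _ k] exI[of _ "\<lambda>v. v"])
        (auto simp: strict_mono_on_def that)
  qed
  show ?thesis using sub[of c c'] sub[of c' c] assms by auto
qed

section \<open>Lipschitz paths\<close>

text \<open>
  Only the existence of a Lipschitz constant matters, so it is hidden, and Lipschitz continuity of
  an explicit path becomes a routine consequence of the rules \<open>lip_intros\<close>. Paths are written with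
  \<open>min\<close> and \<open>max\<close> instead of case distinctions in order to be covered by them.
\<close>

abbreviation lip :: "(real \<Rightarrow> 'a::metric_space) \<Rightarrow> bool" where
  "lip f \<equiv> \<exists>L. L-lipschitz_on {0..1} f"

named_theorems lip_intros

lemma lip_const [lip_intros]: "lip (\<lambda>u. c)"
  using lipschitz_on_constant by blast

lemma lip_ident [lip_intros]: "lip (\<lambda>u. u)"
  using lipschitz_on_id by blast

lemma lip_add [lip_intros]:
  fixes f g :: "real \<Rightarrow> 'a::real_normed_vector"
  shows "lip f \<Longrightarrow> lip g \<Longrightarrow> lip (\<lambda>u. f u + g u)"
  using lipschitz_on_add by blast

lemma lip_diff [lip_intros]:
  fixes f g :: "real \<Rightarrow> 'a::real_normed_vector"
  shows "lip f \<Longrightarrow> lip g \<Longrightarrow> lip (\<lambda>u. f u - g u)"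
  using lipschitz_on_diff by blast

lemma lip_cmult [lip_intros]:
  fixes f :: "real \<Rightarrow> real"
  shows "lip f \<Longrightarrow> lip (\<lambda>u. c * f u)"
  using lipschitz_on_cmult_real by blast

lemma lip_Pair [lip_intros]: "lip f \<Longrightarrow> lip g \<Longrightarrow> lip (\<lambda>u. (f u, g u))"
  using lipschitz_on_Pair by blast

lemma lip_if_dist_le:
  assumes "lip f" and "\<And>u v. dist (g u) (g v) \<le> dist (f u) (f v)"
  shows "lip g"
  using assms unfolding lipschitz_on_def by (meson order_trans)

lemma lip_fst [lip_intros]: "lip f \<Longrightarrow> lip (\<lambda>u. fst (f u))"
  by (rule lip_if_dist_le[of f]) (auto intro: dist_fst_le)

lemma lip_max_const [lip_intros]: "lip (f :: real \<Rightarrow> real) \<Longrightarrow> lip (\<lambda>u. max c (f u))"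
  by (rule lip_if_dist_le[of f]) (auto simp: dist_real_def)

lemma lip_min_const [lip_intros]: "lip (f :: real \<Rightarrow> real) \<Longrightarrow> lip (\<lambda>u. min c (f u))"
  by (rule lip_if_dist_le[of f]) (auto simp: dist_real_def)

lemma lip_max [lip_intros]:
  fixes f g :: "real \<Rightarrow> real"
  assumes "lip f" "lip g"
  shows "lip (\<lambda>u. max (f u) (g u))"
proof -
  have "max (f u) (g u) = f u + max 0 (g u - f u)" for u by simp
  then show ?thesis using assms by (simp only:) (intro lip_intros)
qed

lemma lip_min [lip_intros]:
  fixes f g :: "real \<Rightarrow> real"
  assumes "lip f" "lip g"
  shows "lip (\<lambda>u. min (f u) (g u))"
proof -
  have "min (f u) (g u) = f u + min 0 (g u - f u)" for u by simp
  then show ?thesis using assms by (simp only:) (intro lip_intros)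
qed

lemma lip_quadratic [lip_intros]: "lip (\<lambda>s. s * (1 - s))"
proof (intro exI lipschitz_onI)
  fix x y :: real assume xy: "x \<in> {0..1}" "y \<in> {0..1}"
  have "x * (1 - x) - y * (1 - y) = (x - y) * (1 - x - y)" by (simp add: algebra_simps)
  then have "\<bar>x * (1 - x) - y * (1 - y)\<bar> = \<bar>x - y\<bar> * \<bar>1 - x - y\<bar>" by (simp add: abs_mult)
  also have "\<dots> \<le> \<bar>x - y\<bar> * 1" using xy by (intro mult_left_mono) auto
  finally show "dist (x * (1 - x)) (y * (1 - y)) \<le> 1 * dist x y" by (simp add: dist_real_def)
qed simp

lemma lip_compose:
  assumes "L-lipschitz_on S g" "lip f" "\<And>u. u \<in> {0..1} \<Longrightarrow> f u \<in> S"
  shows "lip (\<lambda>u. g (f u))"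
proof -
  obtain M where "M-lipschitz_on {0..1} f" using assms(2) by blast
  moreover have "L-lipschitz_on (f ` {0..1}) g"
    by (rule lipschitz_on_subset[OF assms(1)]) (use assms(3) in auto)
  ultimately show ?thesis using lipschitz_on_compose2 by blast
qed

lemma lip_continuous_on: "lip f \<Longrightarrow> continuous_on {0..1} f"
  using lipschitz_on_continuous_on by blast

section \<open>Cylindrical coordinates\<close>

text \<open>
  The point at angle \<open>2 \<pi> u\<close> around the axis with the coordinates (distance, height) in the half
  plane.
\<close>

definition cyl :: "real \<Rightarrow> real \<times> real \<Rightarrow> space" where
  "cyl u x = (of_real (fst x) * cis (2 * pi * u), snd x)"

lemma cyl_diff: "cyl u (x - y) = cyl u x - cyl u y"
  by (simp add: cyl_def algebra_simps)

lemma cyl_add: "cyl u (x + y) = cyl u x + cyl u y"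
  by (simp add: cyl_def algebra_simps)

lemma cyl_scaleR: "cyl u (r *\<^sub>R x) = r *\<^sub>R cyl u x"
  by (simp add: cyl_def scaleR_conv_of_real)

lemma norm_cyl [simp]: "norm (cyl u x) = norm x"
  by (simp add: cyl_def norm_prod_def norm_mult)

lemma cyl_periodic: "cyl (u + 1) x = cyl u x"
  by (simp add: cyl_def cis.ctr ring_distribs sin_add cos_add)

lemma cis_dist_le: "cmod (cis a - cis b) \<le> \<bar>a - b\<bar>"
proof -
  have "cis a - cis b = cis b * (exp (\<i> * of_real (a - b)) - 1)"
    by (simp add: cis_conv_exp algebra_simps flip: exp_add)
  then have "cmod (cis a - cis b) = 2 * \<bar>sin ((a - b) / 2)\<bar>"
    by (simp only: norm_mult dist_exp_i_1 norm_cis)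
  also have "\<dots> \<le> 2 * \<bar>(a - b) / 2\<bar>"
    using abs_sin_x_le_abs_x[of "(a - b) / 2"] by linarith
  also have "\<dots> = \<bar>a - b\<bar>" by simp
  finally show ?thesis .
qed

lemma cyl_dist_le:
  "norm (cyl u x - cyl v y) \<le> norm (x - y) + 2 * pi * norm y * \<bar>u - v\<bar>"
proof -
  have "norm (cyl u y - cyl v y) = \<bar>fst y\<bar> * cmod (cis (2 * pi * u) - cis (2 * pi * v))"
    by (simp add: cyl_def norm_prod_def norm_mult flip: right_diff_distrib)
  also have "\<dots> \<le> norm y * \<bar>2 * pi * u - 2 * pi * v\<bar>"
    using cis_dist_le norm_fst_le[of "fst y" "snd y"] by (intro mult_mono) auto
  also have "\<dots> = 2 * pi * norm y * \<bar>u - v\<bar>"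
    by (simp add: abs_mult flip: right_diff_distrib)
  finally have "norm (cyl u y - cyl v y) \<le> 2 * pi * norm y * \<bar>u - v\<bar>" .
  moreover have "norm (cyl u x - cyl v y) \<le> norm (cyl u (x - y)) + norm (cyl u y - cyl v y)"
    using norm_triangle_ineq[of "cyl u x - cyl u y" "cyl u y - cyl v y"] by (simp add: cyl_diff)
  ultimately show ?thesis by simp
qed

text \<open>
  By the Taylor estimate \<open>\<bar>sin x - x\<bar> \<le> x\<^sup>3 / 6\<close>, and \<open>x\<^sup>2 \<le> 3\<close> in this range.
\<close>

lemma sin_ge_half:
  fixes x :: real
  assumes "0 \<le> x" "x \<le> pi / 2"
  shows "x / 2 \<le> sin x"
proof -
  have x: "x \<le> 1.58" using assms(2) pi_approx by simp
  have "x ^ 2 \<le> 1.58 ^ 2" by (rule power_mono) (use x assms in auto)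
  then have "x * x ^ 2 \<le> x * 3"
    by (intro mult_left_mono) (use assms in \<open>auto simp: power2_eq_square\<close>)
  then have cube: "x ^ 3 \<le> 3 * x" by (simp add: power3_eq_cube power2_eq_square)
  have "\<bar>sin x - (\<Sum>m<3. sin_coeff m * x ^ m)\<bar> \<le> inverse (fact 3) * \<bar>x\<bar> ^ 3"
    by (rule Maclaurin_sin_bound)
  also have "(\<Sum>m<3. sin_coeff m * x ^ m) = x"
    by (simp add: eval_nat_numeral sin_coeff_def)
  finally have "\<bar>sin x - x\<bar> * 6 \<le> x ^ 3" using assms by (simp add: fact_numeral)
  then have "\<bar>sin x - x\<bar> * 6 \<le> 3 * x" using cube by (rule order_trans)
  then show ?thesis by (simp add: abs_if split: if_splits)
qed

lemma cis_dist_ge: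
  assumes "\<bar>d\<bar> \<le> 1 / 2"
  shows "\<bar>d\<bar> \<le> cmod (cis (a + 2 * pi * d) - cis a)"
proof -
  have "cis (a + 2 * pi * d) - cis a = cis a * (exp (\<i> * of_real (2 * pi * d)) - 1)"
    by (simp add: cis_conv_exp algebra_simps flip: exp_add)
  then have "cmod (cis (a + 2 * pi * d) - cis a) = 2 * \<bar>sin (2 * pi * d / 2)\<bar>"
    by (simp only: norm_mult dist_exp_i_1 norm_cis)
  also have "\<bar>sin (2 * pi * d / 2)\<bar> = \<bar>sin (pi * \<bar>d\<bar>)\<bar>"
    by (cases "d \<ge> 0") auto
  also have "2 * \<bar>sin (pi * \<bar>d\<bar>)\<bar> \<ge> pi * \<bar>d\<bar>"
    using sin_ge_half[of "pi * \<bar>d\<bar>"] assms by (simp add: abs_if split: if_splits)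
  finally have "pi * \<bar>d\<bar> \<le> cmod (cis (a + 2 * pi * d) - cis a)" by simp
  moreover have "1 * \<bar>d\<bar> \<le> pi * \<bar>d\<bar>" using pi_gt3 by (intro mult_right_mono) auto
  ultimately show ?thesis by simp
qed

text \<open>
  Moving two points outside the unit disc radially onto the unit circle does not increase their
  distance, as \<open>(r - s)\<^sup>2 + 2 r s (1 - cos (a - b)) \<ge> 2 (1 - cos (a - b))\<close>.
\<close>

lemma cis_scaled_dist_ge:
  assumes "1 \<le> r" "1 \<le> s"
  shows "cmod (cis a - cis b) \<le> cmod (of_real r * cis a - of_real s * cis b)"
proof (rule power2_le_imp_le)
  have eq: "(cmod (of_real r * cis a - of_real s * cis b))\<^sup>2
      = (r - s)\<^sup>2 + 2 * (r * s) * (1 - cos (a - b))" for r s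
  proof -
    have "q * (q * (cos x * cos x)) + q * (q * (sin x * sin x)) = q * q" for q x :: real
      by (metis distrib_left mult.right_neutral sin_cos_squared_add3)
    from this[of r a] this[of s b] show ?thesis
      unfolding cmod_power2 by (simp add: cos_diff power2_eq_square algebra_simps)
  qed
  have "1 * 1 \<le> r * s" using assms by (intro mult_mono) auto
  then have "2 * 1 * (1 - cos (a - b)) \<le> 2 * (r * s) * (1 - cos (a - b))"
    by (intro mult_right_mono) auto
  then show "(cmod (cis a - cis b))\<^sup>2 \<le> (cmod (of_real r * cis a - of_real s * cis b))\<^sup>2"
    using eq[of 1 1] by (simp add: eq) (smt (verit) zero_le_power2)
qed auto

text \<open>
  Away from the axis, the distance of two points controls the difference of their angles.
\<close>

lemma cyl_dist_ge:
  assumes "1 \<le> fst x" "1 \<le> fst y" "\<bar>u - v\<bar> \<le> 1 / 2"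
  shows "\<bar>u - v\<bar> \<le> norm (cyl u x - cyl v y)"
proof -
  have "\<bar>u - v\<bar> \<le> cmod (cis (2 * pi * v + 2 * pi * (u - v)) - cis (2 * pi * v))"
    by (rule cis_dist_ge) (rule assms)
  also have "\<dots> = cmod (cis (2 * pi * u) - cis (2 * pi * v))"
    by (simp add: algebra_simps)
  also have "\<dots> \<le> cmod (fst (cyl u x - cyl v y))"
    using cis_scaled_dist_ge[OF assms(1,2)] by (simp add: cyl_def)
  also have "\<dots> \<le> norm (cyl u x - cyl v y)" by (metis norm_fst_le prod.collapse)
  finally show ?thesis .
qed

section \<open>Geometric braids and their closures\<close>

text \<open>
  Strands \<open>b 1, \<dots>, b n\<close> in cylindrical coordinates over \<open>u \<in> [0, 1]\<close>, with permutation \<open>\<pi>\<close>. The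
  end points may lie anywhere at distance at least \<open>1\<close> from the axis; the strand \<open>k\<close> is continued
  by the strand \<open>\<pi> k\<close> after one turn.
\<close>

definition geometric_braid :: "nat \<Rightarrow> (nat \<Rightarrow> nat) \<Rightarrow> (nat \<Rightarrow> real \<Rightarrow> real \<times> real) \<Rightarrow> bool" where
  "geometric_braid n \<pi> b \<longleftrightarrow>
     (\<forall>k\<in>{1..n}. \<pi> k \<in> {1..n} \<and> b k 1 = b (\<pi> k) 0 \<and> (\<exists>L. L-lipschitz_on {0..1} (b k)) \<and>
        (\<forall>u\<in>{0..1}. 1 \<le> fst (b k u))) \<and>
     (\<forall>k\<in>{1..n}. \<forall>k'\<in>{1..n}. \<forall>u\<in>{0..1}. k \<noteq> k' \<longrightarrow> b k u \<noteq> b k' u)"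

definition braid_closure :: "nat \<Rightarrow> (nat \<Rightarrow> real \<Rightarrow> real \<times> real) \<Rightarrow> (real \<Rightarrow> space) set" where
  "braid_closure n b = curve_link {1..n} (\<lambda>k u. cyl u (b k u))"

lemma braid_closure_cong:
  assumes "\<And>k u. \<lbrakk>k \<in> {1..n}; u \<in> {0..1}\<rbrakk> \<Longrightarrow> b k u = b' k u"
  shows "braid_closure n b = braid_closure n b'"
  unfolding braid_closure_def by (rule curve_link_cong) (simp add: assms)

lemma geometric_braidD:
  assumes "geometric_braid n \<pi> b" "k \<in> {1..n}"
  shows "\<pi> k \<in> {1..n}" "b k 1 = b (\<pi> k) 0" "\<exists>L. L-lipschitz_on {0..1} (b k)"
    "u \<in> {0..1} \<Longrightarrow> 1 \<le> fst (b k u)"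
    "k' \<in> {1..n} \<Longrightarrow> u \<in> {0..1} \<Longrightarrow> k \<noteq> k' \<Longrightarrow> b k u \<noteq> b k' u"
  using assms unfolding geometric_braid_def by blast+

lemma geometric_braid_uniform:
  assumes "geometric_braid n \<pi> b"
  obtains K where "0 \<le> K" "\<And>k u v. \<lbrakk>k \<in> {1..n}; u \<in> {0..1}; v \<in> {0..1}\<rbrakk> \<Longrightarrow>
      norm (b k u - b k v) \<le> K * \<bar>u - v\<bar>"
    "\<And>k u. \<lbrakk>k \<in> {1..n}; u \<in> {0..1}\<rbrakk> \<Longrightarrow> norm (b k u) \<le> K"
proof -
  have "\<forall>k\<in>{1..n}. \<exists>L. L-lipschitz_on {0..1} (b k)"
    using geometric_braidD(3)[OF assms] by blast
  then obtain L where L: "\<forall>k\<in>{1..n}. (L k)-lipschitz_on {0..1} (b k)"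
    by (metis (no_types))
  have L0: "0 \<le> L k" if "k \<in> {1..n}" for k
    using L that lipschitz_on_nonneg by blast
  define K where "K = (\<Sum>k\<in>{1..n}. L k + norm (b k 0))"
  have Kge: "L k + norm (b k 0) \<le> K" if "k \<in> {1..n}" for k
    unfolding K_def by (rule member_le_sum[OF that]) (use L0 in auto)
  have lip: "norm (b k u - b k v) \<le> L k * \<bar>u - v\<bar>"
    if "k \<in> {1..n}" "u \<in> {0..1}" "v \<in> {0..1}" for k u v
    using lipschitz_on_normD[of "L k" "{0..1}" "b k" u v] L that by simp
  show thesis
  proof (rule that)
    show "0 \<le> K" unfolding K_def by (rule sum_nonneg) (use L0 in auto)
    show "norm (b k u - b k v) \<le> K * \<bar>u - v\<bar>"
      if "k \<in> {1..n}" "u \<in> {0..1}" "v \<in> {0..1}" for k u v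
    proof -
      have "L k * \<bar>u - v\<bar> \<le> K * \<bar>u - v\<bar>"
        using Kge[OF that(1)] norm_ge_zero[of "b k 0"] by (intro mult_right_mono) linarith+
      with lip[OF that] show ?thesis by linarith
    qed
    show "norm (b k u) \<le> K" if "k \<in> {1..n}" "u \<in> {0..1}" for k u
    proof -
      have "norm (b k u) \<le> norm (b k 0) + norm (b k u - b k 0)"
        by (rule norm_triangle_sub)
      also have "norm (b k u - b k 0) \<le> L k * \<bar>u\<bar>"
        using lip[of k u 0] that by simp
      also have "L k * \<bar>u\<bar> \<le> L k * 1"
        using that L0[OF that(1)] by (intro mult_left_mono) auto
      finally show ?thesis using Kge[OF that(1)] by linarith
    qed
  qed
qed

text \<open>
  The criterion for linear interpolation holds because of a dichotomy. Follow the strand through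
  the second point until it is at the angle of the first; by \<open>cyl_dist_ge\<close> the angle passed
  through is at most the distance of the two points. If this arrives at the strand of the first
  point, the two displacements differ at most by a multiple of that angle. Otherwise the points on
  the two strands are at least \<open>\<epsilon>\<close> apart, hence the original points are apart by a fixed amount as
  well, and the bounded displacements satisfy the inequality with a large constant.
\<close>

lemma geometric_braid_linear_isotopy:
  assumes b0: "geometric_braid n \<pi> b0" and b1: "geometric_braid n \<pi> b1" and eps: "0 < \<epsilon>"
    and sep: "\<And>t u k k'. \<lbrakk>t \<in> {0..1}; u \<in> {0..1}; k \<in> {1..n}; k' \<in> {1..n}; k \<noteq> k'\<rbrakk> \<Longrightarrow>
      \<epsilon> \<le> norm (interp t (b0 k u) (b1 k u) - interp t (b0 k' u) (b1 k' u))"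
  shows "ambient_isotopic (braid_closure n b0) (braid_closure n b1)"
proof -
  let ?I = "{1..n}"
  obtain K0 where K0: "0 \<le> K0"
    "\<And>k u v. \<lbrakk>k \<in> ?I; u \<in> {0..1}; v \<in> {0..1}\<rbrakk> \<Longrightarrow> norm (b0 k u - b0 k v) \<le> K0 * \<bar>u - v\<bar>"
    "\<And>k u. \<lbrakk>k \<in> ?I; u \<in> {0..1}\<rbrakk> \<Longrightarrow> norm (b0 k u) \<le> K0"
    using geometric_braid_uniform[OF b0] by metis
  obtain K1 where K1: "0 \<le> K1"
    "\<And>k u v. \<lbrakk>k \<in> ?I; u \<in> {0..1}; v \<in> {0..1}\<rbrakk> \<Longrightarrow> norm (b1 k u - b1 k v) \<le> K1 * \<bar>u - v\<bar>"
    "\<And>k u. \<lbrakk>k \<in> ?I; u \<in> {0..1}\<rbrakk> \<Longrightarrow> norm (b1 k u) \<le> K1"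
    using geometric_braid_uniform[OF b1] by metis
  define K where "K = K0 + K1"
  have K: "0 \<le> K" by (simp add: K_def K0 K1)
  define N where "N = K + 2 * pi * K"
  have N: "0 \<le> N" using K pi_ge_zero by (simp add: N_def)
  define C where "C = N + 2 * K * (1 + N) / \<epsilon>"
  define b where "b t k u = interp t (b0 k u) (b1 k u)" for t k u
  define g where "g k u = b1 k u - b0 k u" for k u
  have b_closes: "b t k 1 = b t (\<pi> k) 0" and g_closes: "g k 1 = g (\<pi> k) 0"
    if "k \<in> ?I" for t k
    using geometric_braidD(2)[OF b0 that] geometric_braidD(2)[OF b1 that]
    by (simp_all add: b_def g_def)
  have g_bound: "norm (g k u) \<le> K" if "k \<in> ?I" "u \<in> {0..1}" for k u
    using norm_triangle_ineq4[of "b1 k u" "b0 k u"] K0(3)[OF that] K1(3)[OF that]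
    by (simp add: g_def K_def)
  have g_lip: "norm (g k u - g k v) \<le> K * \<bar>u - v\<bar>"
    if "k \<in> ?I" "u \<in> {0..1}" "v \<in> {0..1}" for k u v
  proof -
    have "g k u - g k v = (b1 k u - b1 k v) - (b0 k u - b0 k v)" by (simp add: g_def)
    then show ?thesis
      using norm_triangle_ineq4[of "b1 k u - b1 k v" "b0 k u - b0 k v"] K0(2)[OF that]
          K1(2)[OF that]
      by (simp add: K_def distrib_right)
  qed
  have convex: "norm (interp t x y) \<le> norm x + norm y" if "t \<in> {0..1}"
    for t and x y :: "real \<times> real"
  proof -
    have "norm (interp t x y) \<le> (1 - t) * norm x + t * norm y"
      using norm_triangle_ineq[of "(1 - t) *\<^sub>R x" "t *\<^sub>R y"] that by simp
    also have "\<dots> \<le> 1 * norm x + 1 * norm y"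
      using that by (intro add_mono mult_right_mono) auto
    finally show ?thesis by simp
  qed
  have b_bound: "norm (b t k u) \<le> K" if "t \<in> {0..1}" "k \<in> ?I" "u \<in> {0..1}" for t k u
    using convex[OF that(1), of "b0 k u" "b1 k u"] K0(3)[OF that(2,3)] K1(3)[OF that(2,3)]
    by (simp add: b_def K_def)
  have b_lip: "norm (b t k u - b t k v) \<le> K * \<bar>u - v\<bar>"
    if "t \<in> {0..1}" "k \<in> ?I" "u \<in> {0..1}" "v \<in> {0..1}" for t k u v
  proof -
    have "b t k u - b t k v = interp t (b0 k u - b0 k v) (b1 k u - b1 k v)"
      by (simp add: b_def algebra_simps)
    then show ?thesis
      using convex[OF that(1), of "b0 k u - b0 k v" "b1 k u - b1 k v"]
        K0(2)[OF that(2-4)] K1(2)[OF that(2-4)]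
      by (simp add: K_def distrib_right)
  qed
  have cyl_lip: "norm (cyl u (f u) - cyl v (f v)) \<le> N * \<bar>u - v\<bar>"
    if "norm (f u - f v) \<le> K * \<bar>u - v\<bar>" "norm (f v) \<le> K" for f u v
  proof -
    have "2 * pi * norm (f v) * \<bar>u - v\<bar> \<le> 2 * pi * K * \<bar>u - v\<bar>"
      using that(2) by (intro mult_right_mono mult_left_mono) auto
    then show ?thesis
      using cyl_dist_le[of u "f u" v "f v"] that(1) unfolding N_def distrib_right by linarith
  qed
  have b_ge: "1 \<le> fst (b t k u)" if "t \<in> {0..1}" "k \<in> ?I" "u \<in> {0..1}" for t k u
  proof -
    have "(1 - t) * 1 + t * 1 \<le> (1 - t) * fst (b0 k u) + t * fst (b1 k u)"
      using geometric_braidD(4)[OF b0 that(2,3)] geometric_braidD(4)[OF b1 that(2,3)] that(1)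
      by (intro add_mono mult_left_mono) auto
    then show ?thesis by (simp add: b_def)
  qed
  define G where "G k u = cyl u (g k u)" for k u
  define F where "F t k u = cyl u (b t k u)" for t k u
  have G_bound: "norm (G k u) \<le> K" if "k \<in> ?I" "u \<in> {0..1}" for k u
    using g_bound[OF that] by (simp add: G_def)
  have G_lip: "norm (G k u - G k v) \<le> N * \<bar>u - v\<bar>" if "k \<in> ?I" "u \<in> {0..1}" "v \<in> {0..1}" for k u v
    unfolding G_def by (intro cyl_lip g_lip g_bound that)
  have F_lip: "norm (F t k u - F t k v) \<le> N * \<bar>u - v\<bar>"
    if "t \<in> {0..1}" "k \<in> ?I" "u \<in> {0..1}" "v \<in> {0..1}" for t k u v
    unfolding F_def by (intro cyl_lip b_lip b_bound that)
  have closes: "G k 1 = G (\<pi> k) 0" "F t k 1 = F t (\<pi> k) 0" if "k \<in> ?I" for t k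
    using cyl_periodic[of 0] by (simp_all add: G_def F_def b_closes[OF that] g_closes[OF that])
  \<comment> \<open>The point \<open>(j, u)\<close> is reached from \<open>(k', u')\<close> by following the strand through an angle \<open>d\<close>.\<close>
  have transport: "norm (G k u - G k' u') \<le> C * norm (F t k u - F t k' u')"
    if t: "t \<in> {0..1}" and k: "k \<in> ?I" "k' \<in> ?I" "j \<in> ?I" and u: "u \<in> {0..1}" "u' \<in> {0..1}"
      and Gd: "norm (G k' u' - G j u) \<le> N * d" and Fd: "norm (F t k' u' - F t j u) \<le> N * d"
      and d: "d \<le> norm (F t k u - F t k' u')" for t k k' j u u' d
  proof -
    let ?D = "norm (F t k u - F t k' u')"
    have ND: "N * d \<le> N * ?D" using d N by (intro mult_left_mono)
    have pos: "0 \<le> 2 * K * (1 + N) / \<epsilon> * ?D" "0 \<le> N * ?D" using K N eps by auto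
    show ?thesis
    proof (cases "j = k")
      case True
      then have "norm (G k u - G k' u') \<le> N * d" using Gd by (simp add: norm_minus_commute)
      then show ?thesis using ND pos by (simp add: C_def distrib_right)
    next
      case False
      have "\<epsilon> \<le> norm (F t k u - F t j u)"
        using sep[OF t u(1) k(1) k(3)] False by (simp add: F_def b_def flip: cyl_diff)
      also have "\<dots> \<le> ?D + norm (F t k' u' - F t j u)"
        using norm_triangle_ineq[of "F t k u - F t k' u'" "F t k' u' - F t j u"] by simp
      also have "\<dots> \<le> (1 + N) * ?D" using Fd ND by (simp add: distrib_right)
      finally have "1 \<le> (1 + N) * ?D / \<epsilon>" using eps by simp
      then have "2 * K * 1 \<le> 2 * K * ((1 + N) * ?D / \<epsilon>)" using K by (intro mult_left_mono) auto
      moreover have "norm (G k u - G k' u') \<le> 2 * K"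
        using norm_triangle_ineq4[of "G k u" "G k' u'"] G_bound[OF k(1) u(1)] G_bound[OF k(2) u(2)]
        by simp
      moreover have "2 * K * ((1 + N) * ?D / \<epsilon>) = 2 * K * (1 + N) / \<epsilon> * ?D" by simp
      ultimately show ?thesis using pos unfolding C_def distrib_right[of N] by linarith
    qed
  qed
  have ordered: "norm (G k u - G k' u') \<le> C * norm (F t k u - F t k' u')"
    if t: "t \<in> {0..1}" and k: "k \<in> ?I" "k' \<in> ?I" and u: "u \<in> {0..1}" "u' \<in> {0..1}" "u \<le> u'"
    for t k k' u u'
  proof (cases "u' - u \<le> 1 / 2")
    case True
    show ?thesis
    proof (rule transport[OF t k k(2) u(1,2)])
      show "norm (G k' u' - G k' u) \<le> N * \<bar>u' - u\<bar>" by (rule G_lip[OF k(2) u(2,1)])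
      show "norm (F t k' u' - F t k' u) \<le> N * \<bar>u' - u\<bar>" by (rule F_lip[OF t k(2) u(2,1)])
      show "\<bar>u' - u\<bar> \<le> norm (F t k u - F t k' u')"
        using cyl_dist_ge[OF b_ge[OF t k(1) u(1)] b_ge[OF t k(2) u(2)], of u u'] True u(3)
        by (simp add: F_def)
    qed
  next
    case False
    have pk: "\<pi> k' \<in> ?I" by (rule geometric_braidD(1)[OF b0 k(2)])
    show ?thesis
    proof (rule transport[OF t k pk u(1,2)])
      show "norm (G k' u' - G (\<pi> k') u) \<le> N * (u + 1 - u')"
        using norm_triangle_ineq[of "G k' u' - G k' 1" "G (\<pi> k') 0 - G (\<pi> k') u"]
          G_lip[OF k(2) u(2), of 1] G_lip[OF pk, of 0 u] u
        by (simp add: closes(1)[OF k(2)] algebra_simps)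
      show "norm (F t k' u' - F t (\<pi> k') u) \<le> N * (u + 1 - u')"
        using norm_triangle_ineq[of "F t k' u' - F t k' 1" "F t (\<pi> k') 0 - F t (\<pi> k') u"]
          F_lip[OF t k(2) u(2), of 1] F_lip[OF t pk, of 0 u] u
        by (simp add: closes(2)[OF k(2)] algebra_simps)
      show "u + 1 - u' \<le> norm (F t k u - F t k' u')"
        using cyl_dist_ge[OF b_ge[OF t k(1) u(1)] b_ge[OF t k(2) u(2)], of "u + 1" u'] False u
        by (simp add: F_def cyl_periodic)
    qed
  qed
  show ?thesis
    unfolding braid_closure_def
  proof (rule ambient_isotopic_linear_interpolation[where C = C])
    fix t u u' :: real and k k' :: nat
    assume a: "t \<in> {0..1}" "k \<in> ?I" "k' \<in> ?I" "u \<in> {0..1}" "u' \<in> {0..1}"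
    have "norm (G k u - G k' u') \<le> C * norm (F t k u - F t k' u')"
    proof (cases "u \<le> u'")
      case True
      then show ?thesis using ordered[OF a] by simp
    next
      case False
      then show ?thesis using ordered[OF a(1,3,2,5,4)] by (simp add: norm_minus_commute)
    qed
    then show "norm ((cyl u (b1 k u) - cyl u (b0 k u)) - (cyl u' (b1 k' u') - cyl u' (b0 k' u')))
        \<le> C * norm (interp t (cyl u (b0 k u)) (cyl u (b1 k u))
            - interp t (cyl u' (b0 k' u')) (cyl u' (b1 k' u')))"
      by (simp add: G_def F_def g_def b_def cyl_diff cyl_add cyl_scaleR)
  qed
qed

lemma common_positive_bound:
  fixes P :: "'a \<Rightarrow> real \<Rightarrow> bool"
  assumes "finite A" "\<And>a. a \<in> A \<Longrightarrow> \<exists>e>0. P a e"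
    and "\<And>a e e'. a \<in> A \<Longrightarrow> P a e \<Longrightarrow> 0 < e' \<Longrightarrow> e' \<le> e \<Longrightarrow> P a e'"
  shows "\<exists>e>0. \<forall>a\<in>A. P a e"
  using assms
proof (induction A rule: finite_induct)
  case (insert a A)
  obtain e where e: "e > 0" "\<forall>a\<in>A. P a e"
    using insert.IH insert.prems by (metis insertCI)
  obtain e' where "e' > 0" "P a e'" using insert.prems(1) by blast
  then show ?case
    using e insert.prems(2)
        by (intro exI[of _ "min e e'"])
          (metis insertE insertI1 insertI2 min.cobounded1 min.cobounded2 min_less_iff_conj)
qed (auto intro: exI[of _ 1])

text \<open>
  By compactness the distance between distinct strands is bounded below by some \<open>e > 0\<close>, and for
  sufficiently close times the braids differ by less than \<open>e / 4\<close>. Interpolating linearly between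
  such times keeps the strands \<open>e / 2\<close> apart.
\<close>

lemma geometric_braid_isotopy:
  fixes b :: "real \<Rightarrow> nat \<Rightarrow> real \<Rightarrow> real \<times> real"
  assumes geom: "\<And>t. t \<in> {0..1} \<Longrightarrow> geometric_braid n \<pi> (b t)"
    and cont: "\<And>k. k \<in> {1..n} \<Longrightarrow> continuous_on ({0..1} \<times> {0..1}) (\<lambda>p. b (fst p) k (snd p))"
  shows "ambient_isotopic (braid_closure n (b 0)) (braid_closure n (b 1))"
proof -
  let ?I = "{1..n}" and ?Q = "{0..1::real} \<times> {0..1::real}"
  have compact: "compact ?Q" by (intro compact_Times compact_Icc)
  have "\<exists>e>0. \<forall>p\<in>?I \<times> ?I - Id. \<forall>q\<in>?Q. e
      \<le> norm (b (fst q) (fst p) (snd q) - b (fst q) (snd p) (snd q))"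
  proof (rule common_positive_bound)
    fix p assume p: "p \<in> ?I \<times> ?I - Id"
    let ?f = "\<lambda>q. norm (b (fst q) (fst p) (snd q) - b (fst q) (snd p) (snd q))"
    have "continuous_on ?Q ?f"
      by (intro continuous_intros cont) (use p in auto)
    then obtain q where q: "q \<in> ?Q" "\<And>q'. q' \<in> ?Q \<Longrightarrow> ?f q \<le> ?f q'"
      using continuous_attains_inf[OF compact, of ?f] by auto
    have "b (fst q) (fst p) (snd q) \<noteq> b (fst q) (snd p) (snd q)"
      by (rule geometric_braidD(5)[OF geom]) (use p q in auto)
    then show "\<exists>e>0. \<forall>q\<in>?Q. e \<le> ?f q"
      using q by (intro exI[of _ "?f q"]) auto
  qed (simp, blast intro: order_trans)
  then obtain e where e1: "e > 0" and e2: "\<forall>p\<in>?I \<times> ?I - Id. \<forall>q\<in>?Q.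
      e \<le> norm (b (fst q) (fst p) (snd q) - b (fst q) (snd p) (snd q))" by blast
  have e: "e > 0" "e \<le> norm (b t k u - b t k' u)"
    if "t \<in> {0..1}" "u \<in> {0..1}" "k \<in> ?I" "k' \<in> ?I" "k \<noteq> k'" for t u k k'
  proof -
    have "(k, k') \<in> ?I \<times> ?I - Id" "(t, u) \<in> ?Q" using that by auto
    from bspec[OF bspec[OF e2 this(1)] this(2)] show "e \<le> norm (b t k u - b t k' u)" by simp
  qed (rule e1)
  have "\<exists>d>0. \<forall>k\<in>?I. \<forall>q\<in>?Q. \<forall>q'\<in>?Q. dist q' q < d \<longrightarrow>
      dist (b (fst q') k (snd q')) (b (fst q) k (snd q)) < e / 4"
  proof (rule common_positive_bound)
    fix k assume "k \<in> ?I"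
    then have "uniformly_continuous_on ?Q (\<lambda>p. b (fst p) k (snd p))"
      by (intro compact_uniformly_continuous cont compact)
    then show "\<exists>d>0. \<forall>q\<in>?Q. \<forall>q'\<in>?Q. dist q' q < d \<longrightarrow>
        dist (b (fst q') k (snd q')) (b (fst q) k (snd q)) < e / 4"
      unfolding uniformly_continuous_on_def using e1
          by (metis zero_less_divide_iff zero_less_numeral)
  qed auto
  then obtain d where d: "d > 0"
    "\<And>k q q'. \<lbrakk>k \<in> ?I; q \<in> ?Q; q' \<in> ?Q; dist q' q < d\<rbrakk> \<Longrightarrow>
      dist (b (fst q') k (snd q')) (b (fst q) k (snd q)) < e / 4"
    by metis
  have close: "norm (b t' k u - b t k u) < e / 4"
    if "t \<in> {0..1}" "t' \<in> {0..1}" "\<bar>t' - t\<bar> < d" "k \<in> ?I" "u \<in> {0..1}" for t t' k u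
    using d(2)[of k "(t, u)" "(t', u)"] that by (simp add: dist_Pair_Pair dist_norm)
  have step: "ambient_isotopic (braid_closure n (b t)) (braid_closure n (b t'))"
    if t: "t \<in> {0..1}" "t' \<in> {0..1}" "\<bar>t' - t\<bar> < d" for t t'
  proof (rule geometric_braid_linear_isotopy[OF geom[OF t(1)] geom[OF t(2)], of "e / 2"])
    fix s u :: real and k k' :: nat
    assume a: "s \<in> {0..1}" "u \<in> {0..1}" "k \<in> ?I" "k' \<in> ?I" "k \<noteq> k'"
    let ?x = "b t k u - b t k' u"
    let ?y = "interp s (b t k u) (b t' k u) - (interp s (b t k' u) (b t' k' u))"
    have "?x - ?y = s *\<^sub>R ((b t' k' u - b t k' u) - (b t' k u - b t k u))"
      by (simp add: algebra_simps)
    then have "norm (?x - ?y) = s * norm ((b t' k' u - b t k' u) - (b t' k u - b t k u))"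
      using a(1) by simp
    also have "\<dots> \<le> 1 * norm ((b t' k' u - b t k' u) - (b t' k u - b t k u))"
      using a(1) by (intro mult_right_mono) auto
    also have "\<dots> \<le> e / 2"
      using norm_triangle_ineq4[of "b t' k' u - b t k' u" "b t' k u - b t k u"]
        close[OF t a(4,2)] close[OF t a(3,2)] by simp
    finally have "norm (?x - ?y) \<le> e / 2" .
    moreover have "e \<le> norm ?x" by (rule e(2)[OF t(1) a(2-5)])
    ultimately show "e / 2 \<le> norm ?y"
      using norm_triangle_sub[of ?x ?y] by linarith
  qed (use e1 in auto)
  obtain N :: nat where N: "1 / d < N" using reals_Archimedean2 by blast
  have Npos: "0 < N" using N d(1) by (cases N) (auto simp: field_simps)
  have "i \<le> N \<Longrightarrow> ambient_isotopic (braid_closure n (b 0)) (braid_closure n (b (i / N)))" for i :: nat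
  proof (induction i)
    case 0
    then show ?case by (simp add: ambient_isotopic_refl)
  next
    case (Suc i)
    then have "ambient_isotopic (braid_closure n (b 0)) (braid_closure n (b (i / N)))" by simp
    also have "ambient_isotopic (braid_closure n (b (i / N))) (braid_closure n (b (Suc i / N)))"
      by (rule step) (use Suc.prems Npos N d(1) in \<open>auto simp: field_simps\<close>)
    finally show ?case .
  qed
  from this[of N] show ?thesis using Npos by simp
qed

lemma geometric_braid_affine_isotopy:
  assumes b0: "geometric_braid n \<pi> b0" and b1: "geometric_braid n \<pi> b1"
    and distinct: "\<And>t u k k'. \<lbrakk>t \<in> {0<..<1}; u \<in> {0..1}; k \<in> {1..n}; k' \<in> {1..n}; k < k'\<rbrakk> \<Longrightarrow>
      interp t (b0 k u) (b1 k u) \<noteq> interp t (b0 k' u) (b1 k' u)"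
  shows "ambient_isotopic (braid_closure n b0) (braid_closure n b1)"
proof -
  define b where "b t k u = interp t (b0 k u) (b1 k u)" for t k u
  have ends: "b 0 = b0" "b 1 = b1" by (simp_all add: b_def fun_eq_iff)
  have "geometric_braid n \<pi> (b t)" if t: "t \<in> {0..1}" for t
    unfolding geometric_braid_def
  proof (intro conjI ballI impI)
    fix k assume k: "k \<in> {1..n}"
    show "\<pi> k \<in> {1..n}" by (rule geometric_braidD(1)[OF b0 k])
    show "b t k 1 = b t (\<pi> k) 0"
      using geometric_braidD(2)[OF b0 k] geometric_braidD(2)[OF b1 k] by (simp add: b_def)
    obtain L0 L1 where "L0-lipschitz_on {0..1} (b0 k)" "L1-lipschitz_on {0..1} (b1 k)"
      using geometric_braidD(3)[OF b0 k] geometric_braidD(3)[OF b1 k] by blast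
    then show "\<exists>L. L-lipschitz_on {0..1} (b t k)"
      unfolding b_def by (intro exI) (rule lipschitz_on_add lipschitz_on_cmult | assumption)+
    show "1 \<le> fst (b t k u)" if u: "u \<in> {0..1}" for u
    proof -
      have "(1 - t) * 1 + t * 1 \<le> (1 - t) * fst (b0 k u) + t * fst (b1 k u)"
        using geometric_braidD(4)[OF b0 k u] geometric_braidD(4)[OF b1 k u] t
        by (intro add_mono mult_left_mono) auto
      then show ?thesis by (simp add: b_def)
    qed
    show "b t k u \<noteq> b t k' u" if k': "k' \<in> {1..n}" and u: "u \<in> {0..1}" and ne: "k \<noteq> k'" for k' u
    proof -
      consider "t = 0" | "t = 1" | "t \<in> {0<..<1}" using t by fastforce
      then show ?thesis
      proof cases
        case 3
        then show ?thesis
          using distinct[OF 3 u k k'] distinct[OF 3 u k' k] ne unfolding b_def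
              by (metis linorder_neqE_nat)
      qed (use geometric_braidD(5)[OF b0 k k' u ne] geometric_braidD(5)[OF b1 k k' u ne] in
          \<open>auto simp: b_def\<close>)
    qed
  qed
  moreover have "continuous_on ({0..1} \<times> {0..1}) (\<lambda>p. b (fst p) k (snd p))" if k: "k \<in> {1..n}" for k
  proof -
    obtain L0 L1 where L: "L0-lipschitz_on {0..1} (b0 k)" "L1-lipschitz_on {0..1} (b1 k)"
      using geometric_braidD(3)[OF b0 k] geometric_braidD(3)[OF b1 k] by blast
    show ?thesis
      unfolding b_def
      by (intro continuous_intros continuous_on_compose2[OF lipschitz_on_continuous_on[OF L(1)]]
          continuous_on_compose2[OF lipschitz_on_continuous_on[OF L(2)]]) auto
  qed
  ultimately have "ambient_isotopic (braid_closure n (b 0)) (braid_closure n (b 1))"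
    by (rule geometric_braid_isotopy)
  then show ?thesis by (simp only: ends)
qed

text \<open>
  On \<open>[a, b]\<close> the maximum of \<open>\<theta>\<close> cannot be attained at a point before \<open>b\<close>.
\<close>

lemma strict_mono_on_if_increasing_to_the_right:
  fixes \<theta> :: "real \<Rightarrow> real"
  assumes cont: "continuous_on {0..1} \<theta>"
    and right: "\<And>t. t \<in> {0..<1} \<Longrightarrow> \<exists>e>t. \<forall>s\<in>{t<..e}. \<theta> t < \<theta> s"
  shows "strict_mono_on {0..1} \<theta>"
proof (rule strict_mono_onI)
  fix a b :: real assume ab: "a \<in> {0..1}" "b \<in> {0..1}" "a < b"
  have "continuous_on {a..b} \<theta>" by (rule continuous_on_subset[OF cont]) (use ab in auto)
  then obtain c where c: "c \<in> {a..b}" "\<And>x. x \<in> {a..b} \<Longrightarrow> \<theta> x \<le> \<theta> c"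
    using continuous_attains_sup[of "{a..b}" \<theta>] ab by auto
  have last: "x = b" if x: "x \<in> {a..b}" "\<theta> x = \<theta> c" for x
  proof (rule ccontr)
    assume "x \<noteq> b"
    then obtain e where e: "x < e" "\<forall>s\<in>{x<..e}. \<theta> x < \<theta> s"
      using right[of x] x ab by auto
    then have "\<theta> x < \<theta> (min e b)" using x \<open>x \<noteq> b\<close> by auto
    moreover have "\<theta> (min e b) \<le> \<theta> c" using e x \<open>x \<noteq> b\<close> by (intro c(2)) auto
    ultimately show False using x(2) by simp
  qed
  have "c = b" using last[of c] c(1) by simp
  moreover have "\<theta> a \<noteq> \<theta> c" using last[of a] ab by auto
  ultimately show "\<theta> a < \<theta> b" using c(2)[of a] ab by force
qed

lemma cis_eq_cisE:
  assumes "cis x = cis y"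
  obtains n :: int where "x = y + 2 * pi * of_int n"
proof -
  have "sin x = sin y \<and> cos x = cos y" using assms by (simp add: cis.ctr)
  then obtain n :: int where "x = y + 2 * pi * of_int n" by (auto simp: sin_cos_eq_iff)
  then show thesis by (rule that)
qed

lemma cis_eq_imp_constant_difference:
  fixes \<theta> \<phi> :: "real \<Rightarrow> real"
  assumes "connected S" "continuous_on S \<theta>" "continuous_on S \<phi>"
    and eq: "\<And>s. s \<in> S \<Longrightarrow> cis (\<theta> s) = cis (\<phi> s)"
  shows "\<exists>c. \<forall>s\<in>S. \<theta> s = \<phi> s + c"
proof -
  let ?f = "\<lambda>s. (\<theta> s - \<phi> s) / (2 * pi)"
  have int: "?f s \<in> \<int>" if "s \<in> S" for s
    using eq[OF that] by (elim cis_eq_cisE) simp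
  have "?f constant_on S"
  proof (rule continuous_discrete_range_constant[OF assms(1)])
    show "continuous_on S ?f" by (intro continuous_intros assms(2,3)) auto
    show "\<exists>e>0. \<forall>y. y \<in> S \<and> ?f y \<noteq> ?f x \<longrightarrow> e \<le> norm (?f y - ?f x)" if "x \<in> S" for x
    proof (intro exI[of _ 1] conjI allI impI)
      fix y assume y: "y \<in> S \<and> ?f y \<noteq> ?f x"
      then have "?f y - ?f x \<in> \<int>" "?f y - ?f x \<noteq> 0"
        using int that by (blast intro: Ints_diff, simp)
      then show "1 \<le> norm (?f y - ?f x)"
        unfolding real_norm_def by (rule Ints_nonzero_abs_ge1)
    qed simp
  qed
  then obtain c where "\<And>s. s \<in> S \<Longrightarrow> ?f s = c" unfolding constant_on_def by blast
  then have "\<forall>s\<in>S. \<theta> s = \<phi> s + c * (2 * pi)" by (auto simp: field_simps)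
  then show ?thesis by blast
qed

lemma cyl_polar:
  assumes "1 \<le> fst x"
  shows "cmod (fst (cyl u x)) = fst x" "fst (cyl u x) = of_real (cmod (fst (cyl u x))) * cis \<theta> \<Longrightarrow>
    cis (2 * pi * u) = cis \<theta>"
  using assms by (auto simp: cyl_def norm_mult)

text \<open>
  A curve of increasing angle in the closed braid stays on the same strand for a short time, as
  the finitely many other strands at the same angle are at a positive distance. The angle is then
  the required parameter of the strand.
\<close>

lemma angular_curve_follows_strands:
  assumes b: "geometric_braid n \<pi> b" and simple: "simple_path \<gamma>" "pathfinish \<gamma> = pathstart \<gamma>"
    and img: "path_image \<gamma> \<subseteq> {cyl u (b k u) | k u. k \<in> {1..n} \<and> u \<in> {0..1}}"
    and \<theta>: "continuous_on {0..1} \<theta>" "strict_mono_on {0..1} \<theta>"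
      "\<And>t. t \<in> {0..1} \<Longrightarrow> fst (\<gamma> t) = of_real (cmod (fst (\<gamma> t))) * cis (\<theta> t)"
  shows "\<gamma> \<in> braid_closure n b"
  unfolding braid_closure_def curve_link_def
proof (intro CollectI conjI ballI simple)
  let ?I = "{1..n}"
  fix t :: real assume t: "t \<in> {0..<1}"
  \<comment> \<open>The number of turns, normalised so that \<open>\<phi> t\<close> lies in \<open>[0, 1)\<close>.\<close>
  define \<phi> where "\<phi> s = \<theta> s / (2 * pi) - of_int \<lfloor>\<theta> t / (2 * pi)\<rfloor>" for s
  have cis_\<phi>: "cis (\<theta> s) = cis (2 * pi * \<phi> s)" for s
  proof -
    have "2 * pi * \<phi> s = \<theta> s - 2 * pi * of_int \<lfloor>\<theta> t / (2 * pi)\<rfloor>"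
      by (simp add: \<phi>_def algebra_simps)
    then show ?thesis by (simp add: cis_divide[symmetric] cis_multiple_2pi)
  qed
  have \<phi>t: "0 \<le> \<phi> t" "\<phi> t < 1"
    unfolding \<phi>_def by linarith+
  have \<phi>_cont: "continuous_on {0..1} \<phi>"
    unfolding \<phi>_def by (intro continuous_intros \<theta>(1)) auto
  have \<phi>_mono: "strict_mono_on {0..1} \<phi>"
    using \<theta>(2) by (auto simp: strict_mono_on_def \<phi>_def divide_strict_right_mono)
  have on_strand: "\<exists>k\<in>?I. \<gamma> s = cyl (\<phi> s) (b k (\<phi> s))"
    if s: "s \<in> {0..1}" and range: "0 \<le> \<phi> s" "\<phi> s < 1" for s
  proof -
    have "\<gamma> s \<in> path_image \<gamma>" using s by (auto simp: path_image_def)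
    then obtain k u where k: "k \<in> ?I" "u \<in> {0..1}" "\<gamma> s = cyl u (b k u)" using img by blast
    have "cis (2 * pi * u) = cis (\<theta> s)"
      by (rule cyl_polar(2)[OF geometric_braidD(4)[OF b k(1,2)]]) (use \<theta>(3)[OF s] k(3) in simp)
    then obtain m :: int where "2 * pi * u = 2 * pi * \<phi> s + 2 * pi * of_int m"
      unfolding cis_\<phi> by (rule cis_eq_cisE)
    then have "2 * pi * u = 2 * pi * (\<phi> s + of_int m)" by (simp only: distrib_left)
    then have m: "u = \<phi> s + of_int m" by simp
    then have "-1 < real_of_int m" "real_of_int m \<le> 1" using k(2) range by auto
    then consider "m = 0" | "m = 1" by linarith
    then show ?thesis
    proof cases
      case 1
      then show ?thesis using k m by auto
    next
      case 2
      then have "u = 1" "\<phi> s = 0" using m k(2) range by auto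
      then show ?thesis
        using k geometric_braidD(1,2)[OF b k(1)] cyl_periodic[of 0] by (intro bexI[of _ "\<pi> k"]) auto
    qed
  qed
  obtain k0 where k0: "k0 \<in> ?I" "\<gamma> t = cyl (\<phi> t) (b k0 (\<phi> t))"
    using on_strand[of t] t \<phi>t by auto
  have tend: "(\<phi> \<longlongrightarrow> \<phi> t) (at t within {0..1})"
    using \<phi>_cont t by (auto simp: continuous_on_def)
  obtain d where d: "d > 0" "\<And>s. \<lbrakk>s \<in> {0..1}; s \<noteq> t; dist s t < d\<rbrakk> \<Longrightarrow> \<phi> s < 1"
    using order_tendstoD(2)[OF tend \<phi>t(2)] unfolding eventually_at by metis
  define e1 where "e1 = min 1 (t + d / 2)"
  have e1: "t < e1" "e1 \<le> 1" using t d(1) by (auto simp: e1_def)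
  have sub: "{t..e1} \<subseteq> {0..1}" using t e1 by auto
  have range: "0 \<le> \<phi> s \<and> \<phi> s < 1" if s: "s \<in> {t..e1}" for s
  proof (cases "s = t")
    case False
    then have "\<phi> t < \<phi> s" using s sub t by (intro strict_mono_onD[OF \<phi>_mono]) auto
    moreover have "\<phi> s < 1"
      using s sub False d(1) by (intro d(2)) (auto simp: e1_def dist_real_def)
    ultimately show ?thesis using \<phi>t by simp
  qed (use \<phi>t in auto)
  let ?f = "\<lambda>k s. \<gamma> s - cyl (\<phi> s) (b k (\<phi> s))"
  have "eventually (\<lambda>s. \<forall>k\<in>?I - {k0}. ?f k s \<noteq> 0) (at t within {t..e1})"
  proof (rule eventually_ball_finite)
    show "\<forall>k\<in>?I - {k0}. eventually (\<lambda>s. ?f k s \<noteq> 0) (at t within {t..e1})"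
    proof
      fix k assume k: "k \<in> ?I - {k0}"
      obtain L where "L-lipschitz_on {0..1} (b k)" using geometric_braidD(3)[OF b] k by blast
      then have "continuous_on {0..1} (b k)" by (rule lipschitz_on_continuous_on)
      moreover have \<phi>': "continuous_on {t..e1} \<phi>" using \<phi>_cont sub by (rule continuous_on_subset)
      ultimately have bk: "continuous_on {t..e1} (\<lambda>s. b k (\<phi> s))"
        by (rule continuous_on_compose2) (use range in force)
      have "continuous_on {t..e1} \<gamma>"
        using simple(1) sub by (auto simp: simple_path_def path_def intro: continuous_on_subset)
      then have "continuous_on {t..e1} (?f k)"
        unfolding cyl_def by (intro continuous_intros bk \<phi>')
      then have "(?f k \<longlongrightarrow> ?f k t) (at t within {t..e1})"
        using e1 by (auto simp: continuous_on_def)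
      moreover have "?f k t \<noteq> 0"
      proof -
        have "b k0 (\<phi> t) - b k (\<phi> t) \<noteq> 0"
          using geometric_braidD(5)[OF b k0(1), of k "\<phi> t"] k \<phi>t by auto
        then have "norm (cyl (\<phi> t) (b k0 (\<phi> t) - b k (\<phi> t))) \<noteq> 0" unfolding norm_cyl by simp
        then show ?thesis unfolding k0(2) cyl_diff by simp
      qed
      ultimately show "eventually (\<lambda>s. ?f k s \<noteq> 0) (at t within {t..e1})"
        by (rule tendsto_imp_eventually_ne)
    qed
  qed simp
  then obtain d' where d': "d' > 0"
    "\<And>s k. \<lbrakk>s \<in> {t..e1}; s \<noteq> t; dist s t < d'; k \<in> ?I - {k0}\<rbrakk> \<Longrightarrow> ?f k s \<noteq> 0"
    unfolding eventually_at by metis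
  define e where "e = min e1 (t + d' / 2)"
  have e: "t < e" "e \<le> e1" using e1 d'(1) by (auto simp: e_def)
  have follow: "\<gamma> s = cyl (\<phi> s) (b k0 (\<phi> s))" if s: "s \<in> {t..e}" for s
  proof (cases "s = t")
    case False
    have s1: "s \<in> {t..e1}" using s e by auto
    obtain k where k: "k \<in> ?I" "\<gamma> s = cyl (\<phi> s) (b k (\<phi> s))"
      using on_strand[of s] range[OF s1] sub s1 by auto
    have "k = k0"
    proof (rule ccontr)
      assume "k \<noteq> k0"
      then have "?f k s \<noteq> 0"
        using s s1 k(1) False d'(1) by (intro d'(2)) (auto simp: e_def dist_real_def)
      then show False using k(2) by simp
    qed
    then show ?thesis using k(2) by simp
  qed (use k0 in simp)
  have sub': "{t..e} \<subseteq> {0..1}" "{t..e} \<subseteq> {t..e1}" using sub e by auto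
  show "follows_arcs ?I (\<lambda>k u. cyl u (b k u)) \<gamma> t"
  proof (intro bexI[of _ e] bexI[of _ k0] exI[of _ \<phi>] conjI ballI follow)
    show "continuous_on {t..e} \<phi>" using \<phi>_cont sub'(1) by (rule continuous_on_subset)
    show "strict_mono_on {t..e} \<phi>"
      using \<phi>_mono sub'(1) unfolding strict_mono_on_def by blast
    show "\<phi> ` {t..e} \<subseteq> {0..1}" using range sub'(2) by force
  qed (use e e1 k0 in auto)
qed

text \<open>
  A closed curve avoiding the axis has a continuous angle. It agrees locally, up to an additive
  constant, with the parameter of the strand that the curve follows, and therefore increases
  everywhere by \<open>strict_mono_on_if_increasing_to_the_right\<close>.
\<close>

lemma braid_closure_imp_angular:
  assumes b: "geometric_braid n \<pi> b" and \<gamma>: "\<gamma> \<in> braid_closure n b"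
  shows "path_image \<gamma> \<subseteq> {cyl u (b k u) | k u. k \<in> {1..n} \<and> u \<in> {0..1}}"
    and "\<exists>\<theta> :: real \<Rightarrow> real. continuous_on {0..1} \<theta> \<and> strict_mono_on {0..1} \<theta> \<and>
        (\<forall>t\<in>{0..1}. fst (\<gamma> t) = of_real (cmod (fst (\<gamma> t))) * cis (\<theta> t))"
proof -
  let ?K = "{cyl u (b k u) | k u. k \<in> {1..n} \<and> u \<in> {0..1}}"
  have simple: "simple_path \<gamma>" "\<gamma> 1 = \<gamma> 0"
    using \<gamma> by (auto simp: braid_closure_def curve_link_def pathfinish_def pathstart_def)
  have loc: "follows_arcs {1..n} (\<lambda>k u. cyl u (b k u)) \<gamma> t" if "t \<in> {0..<1}" for t
    using curve_linkD[OF \<gamma>[unfolded braid_closure_def] that] .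
  have mem: "\<gamma> t \<in> ?K" if t: "t \<in> {0..<1}" for t
  proof -
    obtain e k \<phi> where e: "e \<in> {t<..1}" "k \<in> {1..n}" "\<phi> ` {t..e} \<subseteq> {0..1}"
      "\<forall>s\<in>{t..e}. \<gamma> s = cyl (\<phi> s) (b k (\<phi> s))"
      using loc[OF t] by (elim bexE exE conjE) (rule that)
    then have "t \<in> {t..e}" by auto
    then have "\<gamma> t = cyl (\<phi> t) (b k (\<phi> t))" "\<phi> t \<in> {0..1}" using e(3,4) by blast+
    then show ?thesis using e(2) by blast
  qed
  have mem': "\<gamma> t \<in> ?K" if "t \<in> {0..1}" for t
    using mem[of t] mem[of 0] simple(2) that by (cases "t = 1") auto
  then show "path_image \<gamma> \<subseteq> ?K" by (auto simp: path_image_def)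
  have nz: "fst (\<gamma> t) \<noteq> 0" if t: "t \<in> {0..1}" for t
  proof -
    obtain k u where k: "k \<in> {1..n}" "u \<in> {0..1}" "\<gamma> t = cyl u (b k u)" using mem'[OF t] by blast
    then show ?thesis using geometric_braidD(4)[OF b k(1,2)] by (auto simp: cyl_def)
  qed
  have cont: "continuous_on {0..1} (\<lambda>t. fst (\<gamma> t))"
    using simple(1) by (auto simp: simple_path_def path_def intro!: continuous_intros)
  obtain g where g: "continuous_on {0..1} g" "\<And>t. t \<in> {0..1} \<Longrightarrow> fst (\<gamma> t) = exp (g t)"
    using continuous_logarithm_on_contractible[OF cont] nz convex_imp_contractible
        convex_closed_interval
    by metis
  define \<theta> where "\<theta> t = Im (g t)" for t
  have \<theta>: "continuous_on {0..1} \<theta>" unfolding \<theta>_def by (intro continuous_intros g(1))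
  have polar: "fst (\<gamma> t) = of_real (cmod (fst (\<gamma> t))) * cis (\<theta> t)" if "t \<in> {0..1}" for t
    using g(2)[OF that] by (simp add: \<theta>_def exp_eq_polar norm_mult)
  have "strict_mono_on {0..1} \<theta>"
  proof (rule strict_mono_on_if_increasing_to_the_right[OF \<theta>])
    fix t :: real assume t: "t \<in> {0..<1}"
    obtain e k \<phi> where e: "e \<in> {t<..1}" "k \<in> {1..n}" "continuous_on {t..e} \<phi>"
      "strict_mono_on {t..e} \<phi>" "\<phi> ` {t..e} \<subseteq> {0..1}"
      "\<forall>s\<in>{t..e}. \<gamma> s = cyl (\<phi> s) (b k (\<phi> s))"
      using loc[OF t] by (elim bexE exE conjE) (rule that)
    have "\<exists>c. \<forall>s\<in>{t..e}. \<theta> s = 2 * pi * \<phi> s + c"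
    proof (rule cis_eq_imp_constant_difference)
      show "continuous_on {t..e} \<theta>" by (rule continuous_on_subset[OF \<theta>]) (use t e in auto)
      show "cis (\<theta> s) = cis (2 * pi * \<phi> s)" if s: "s \<in> {t..e}" for s
      proof -
        have u: "\<phi> s \<in> {0..1}" using s by (intro subsetD[OF e(5)]) auto
        have "s \<in> {0..1}" using s t e(1) by auto
        then show ?thesis
          using cyl_polar(2)[OF geometric_braidD(4)[OF b e(2) u]] polar[of s] e(6) s by metis
      qed
    qed (auto intro!: continuous_intros e(3))
    then obtain c where c: "\<forall>s\<in>{t..e}. \<theta> s = 2 * pi * \<phi> s + c" by blast
    have "\<theta> t < \<theta> s" if "s \<in> {t<..e}" for s
      using strict_mono_onD[OF e(4), of t s] c that by auto
    then show "\<exists>e>t. \<forall>s\<in>{t<..e}. \<theta> t < \<theta> s" using e(1) by auto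
  qed
  then show "\<exists>\<theta> :: real \<Rightarrow> real. continuous_on {0..1} \<theta> \<and> strict_mono_on {0..1} \<theta> \<and>
        (\<forall>t\<in>{0..1}. fst (\<gamma> t) = of_real (cmod (fst (\<gamma> t))) * cis (\<theta> t))"
    using \<theta> polar by blast
qed

theorem braid_closure_eq_angular:
  assumes b: "geometric_braid n \<pi> b"
  shows "braid_closure n b = {\<gamma>. simple_path \<gamma> \<and> pathfinish \<gamma> = pathstart \<gamma> \<and>
     path_image \<gamma> \<subseteq> {cyl u (b k u) | k u. k \<in> {1..n} \<and> u \<in> {0..1}} \<and>
     (\<exists>\<theta> :: real \<Rightarrow> real. continuous_on {0..1} \<theta> \<and> strict_mono_on {0..1} \<theta> \<and>
        (\<forall>t\<in>{0..1}. fst (\<gamma> t) = of_real (cmod (fst (\<gamma> t))) * cis (\<theta> t)))}"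
    (is "_ = {\<gamma>. ?P \<gamma>}")
proof (intro equalityI subsetI CollectI)
  fix \<gamma> assume "\<gamma> \<in> braid_closure n b"
  then show "?P \<gamma>"
    using braid_closure_imp_angular[OF b] by (simp add: braid_closure_def curve_link_def)
next
  fix \<gamma> assume "\<gamma> \<in> {\<gamma>. ?P \<gamma>}"
  then show "\<gamma> \<in> braid_closure n b"
    using angular_curve_follows_strands[OF b] by (elim CollectE conjE exE) blast
qed

section \<open>Braid words as geometric braids\<close>

definition crossing_strand :: "nat \<Rightarrow> nat \<Rightarrow> real \<Rightarrow> real \<times> real" where
  "crossing_strand i a s =
     (if a = i then (real i + s, s * (1 - s))
      else if a = Suc i then (real i + 1 - s, - (s * (1 - s)))
      else (real a, 0))"

text \<open>
  The position at time \<open>T\<close> of the strand that begins at \<open>a\<close>, each letter taking one unit of time.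
\<close>

fun strand_path :: "nat list \<Rightarrow> nat \<Rightarrow> real \<Rightarrow> real \<times> real" where
  "strand_path [] a T = (real a, 0)"
| "strand_path (i # w) a T = (if T \<le> 1 then crossing_strand i a T
     else strand_path w (Transposition.transpose i (Suc i) a) (T - 1))"

lemma position_Nil [simp]: "position [] a = a"
  by (simp add: position_def)

lemma position_Cons [simp]: "position (i # w) a = position w (Transposition.transpose i (Suc i) a)"
  by (simp add: position_def)

lemma position_append [simp]: "position (v @ w) a = position w (position v a)"
  by (simp add: position_def)

lemma braid_word_Nil [simp]: "braid_word n []"
  by (simp add: braid_word_def)

lemma braid_word_Cons [simp]: "braid_word n (i # w) \<longleftrightarrow> 1 \<le> i \<and> i < n \<and> braid_word n w"
  by (auto simp: braid_word_def)

lemma braid_word_append [simp]: "braid_word n (v @ w) \<longleftrightarrow> braid_word n v \<and> braid_word n w"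
  by (auto simp: braid_word_def)

lemma transpose_in_range:
  "\<lbrakk>1 \<le> i; i < n; a \<in> {1..n}\<rbrakk> \<Longrightarrow> Transposition.transpose i (Suc i) a \<in> {1..n}"
  by (auto simp: Transposition.transpose_def)

lemma position_in_range: "\<lbrakk>braid_word n w; a \<in> {1..n}\<rbrakk> \<Longrightarrow> position w a \<in> {1..n}"
proof (induction w arbitrary: a)
  case (Cons i w)
  then have "Transposition.transpose i (Suc i) a \<in> {1..n}" by (intro transpose_in_range) auto
  then show ?case using Cons by simp
qed simp

lemma inj_position: "inj (position w)"
proof (induction w)
  case (Cons i w)
  then show ?case by (simp add: inj_def) (metis transpose_eq_iff)
qed (simp add: inj_def)

lemma position_image: "braid_word n w \<Longrightarrow> position w ` {1..n} = {1..n}"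
  by (rule endo_inj_surj)
    (use position_in_range[of n w] in
      \<open>auto simp del: atLeastAtMost_iff intro: inj_on_subset[OF inj_position]\<close>)

lemma strand_path_0 [simp]: "strand_path w a 0 = (real a, 0)"
  by (cases w) (auto simp: crossing_strand_def)

lemma crossing_strand_1: "crossing_strand i a 1 = (real (Transposition.transpose i (Suc i) a), 0)"
  by (auto simp: crossing_strand_def Transposition.transpose_def)

lemma strand_path_append:
  assumes "0 \<le> T"
  shows "strand_path (v @ w) a T =
    (if T \<le> real (length v) then strand_path v a T else strand_path w (position v a) (T - real
        (length v)))"
  using assms
proof (induction v arbitrary: a T)
  case Nil
  then show ?case by (cases "T = 0") auto
next
  case (Cons i v)
  show ?case
  proof (cases "T \<le> 1")
    case False
    then show ?thesis using Cons.IH[of "T - 1"] by (auto simp: algebra_simps)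
  qed auto
qed

lemma strand_path_end: "strand_path w a (length w) = (real (position w a), 0)"
proof (induction w arbitrary: a)
  case (Cons i w)
  then show ?case by (cases w) (auto simp: crossing_strand_1)
qed simp

lemma strand_path_sector:
  assumes "j < length w" "s \<in> {0..1}"
  shows "strand_path w a (real j + s) = crossing_strand (w ! j) (position (take j w) a) s"
  using assms
proof (induction w arbitrary: j a)
  case (Cons i w)
  show ?case
  proof (cases j)
    case 0
    then show ?thesis using Cons.prems by simp
  next
    case (Suc k)
    show ?thesis
    proof (cases "real j + s \<le> 1")
      case True
      then have "s = 0" "k = 0" using Suc Cons.prems by auto
      moreover have "strand_path w b 0 = crossing_strand (w ! 0) b 0" for b
        by (auto simp: crossing_strand_def)
      ultimately show ?thesis using Suc by (simp add: crossing_strand_1)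
    next
      case False
      then show ?thesis using Suc Cons.IH[of k] Cons.prems by (simp add: algebra_simps)
    qed
  qed
qed simp

lemma strand_path_in_sector:
  fixes T :: real
  assumes "0 \<le> T" "T \<le> real (length w)" "w \<noteq> []"
  obtains j s where "j < length w" "s \<in> {0..1}" "T = real j + s"
proof (cases "T = length w")
  case True
  then show thesis using assms by (intro that[of "length w - 1" 1]) (auto simp: of_nat_diff Suc_leI)
next
  case False
  have "real (nat \<lfloor>T\<rfloor>) = of_int \<lfloor>T\<rfloor>" using assms by simp
  moreover have "of_int \<lfloor>T\<rfloor> \<le> T" "T < of_int \<lfloor>T\<rfloor> + 1" by linarith+
  ultimately have "real (nat \<lfloor>T\<rfloor>) < length w" "0 \<le> T - real (nat \<lfloor>T\<rfloor>)" "T - real (nat \<lfloor>T\<rfloor>) \<le> 1"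
    using False assms by linarith+
  then show thesis
    unfolding of_nat_less_iff by (intro that[of "nat \<lfloor>T\<rfloor>" "T - real (nat \<lfloor>T\<rfloor>)"]) auto
qed

lemma strand_path_distinct:
  assumes "0 \<le> T" "T \<le> real (length w)" "a \<noteq> b"
  shows "strand_path w a T \<noteq> strand_path w b T"
proof (cases "w = []")
  case False
  obtain j s where js: "j < length w" "s \<in> {0..1}" "T = real j + s"
    by (rule strand_path_in_sector[OF assms(1,2) False])
  have ne: "position (take j w) a \<noteq> position (take j w) b"
    using inj_position assms(3) by (auto dest: injD)
  have cross: "crossing_strand i p s \<noteq> crossing_strand i q s" if "p \<noteq> q" for i p q
  proof
    assume eq: "crossing_strand i p s = crossing_strand i q s"
    have s0: "0 \<le> s" "s \<le> 1" using js by auto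
    have half: "s = 1 / 2 \<Longrightarrow> s * (1 - s) > 0" by simp
    show False
      using eq that s0 half
      by (auto simp: crossing_strand_def split: if_splits; linarith?)
  qed
  show ?thesis using cross[OF ne] strand_path_sector[OF js(1,2)] js(3) by simp
qed (use assms in auto)

lemma strand_path_ge:
  assumes "braid_word n w" "a \<in> {1..n}" "0 \<le> T" "T \<le> real (length w)"
  shows "1 \<le> fst (strand_path w a T)"
proof (cases "w = []")
  case False
  obtain j s where js: "j < length w" "s \<in> {0..1}" "T = real j + s"
    by (rule strand_path_in_sector[OF assms(3,4) False])
  have "braid_word n (take j w)" using assms(1) set_take_subset[of j w]
    by (auto simp: braid_word_def)
  then have "position (take j w) a \<in> {1..n}" using assms(2) by (rule position_in_range)
  moreover have "1 \<le> w ! j" using assms(1) js(1) nth_mem[of j w]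
    by (auto simp: braid_word_def subset_iff)
  ultimately show ?thesis
    using js by (auto simp: strand_path_sector crossing_strand_def)
qed (use assms in auto)

lemma strand_path_lipschitz: "\<exists>L. L-lipschitz_on {0..real (length w)} (strand_path w a)"
proof (induction w arbitrary: a)
  case Nil
  then show ?case using lipschitz_on_constant[of _ "(real a, 0::real)"] by auto
next
  case (Cons i w)
  let ?g = "\<lambda>T. strand_path w (Transposition.transpose i (Suc i) a) (T - 1)"
  have "lip (crossing_strand i a)"
  proof -
    consider "a = i" | "a = Suc i" | "a \<noteq> i" "a \<noteq> Suc i" by blast
    then show ?thesis
    proof cases
      case 1
      then show ?thesis unfolding crossing_strand_def by simp (intro lip_intros)
    next
      case 2
      have "lip (\<lambda>s. (real i + 1 - s, 0 - s * (1 - s)))" by (intro lip_intros)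
      then show ?thesis using 2 unfolding crossing_strand_def by simp
    next
      case 3
      then show ?thesis unfolding crossing_strand_def by simp (intro lip_intros)
    qed
  qed
  then obtain L where L: "L-lipschitz_on {0..1} (crossing_strand i a)" by blast
  obtain M where M: "M-lipschitz_on {0..real (length w)}
      (strand_path w (Transposition.transpose i (Suc i) a))"
    using Cons.IH by blast
  have M': "M-lipschitz_on {1..real (length (i # w))} ?g"
    unfolding lipschitz_on_def
  proof (intro conjI ballI)
    show "0 \<le> M" using M by (rule lipschitz_on_nonneg)
    fix x y assume "x \<in> {1..real (length (i # w))}" "y \<in> {1..real (length (i # w))}"
    then have "x - 1 \<in> {0..real (length w)}" "y - 1 \<in> {0..real (length w)}" by auto
    from lipschitz_onD[OF M this] show "dist (?g x) (?g y) \<le> M * dist x y"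
      by (simp add: dist_real_def)
  qed
  have "(max L M)-lipschitz_on {0..real (length (i # w))} (\<lambda>T. if T \<le> 1 then crossing_strand i a T
      else ?g T)"
    by (rule lipschitz_on_concat_max[OF L M']) (simp add: crossing_strand_1)
  then show ?case by auto
qed

lemma geometric_braid_strand_path:
  fixes \<phi> :: "real \<Rightarrow> real"
  assumes w: "braid_word n w" and \<phi>: "lip \<phi>" "\<phi> 0 = 0" "\<phi> 1 = length w"
    and range: "\<And>u. u \<in> {0..1} \<Longrightarrow> \<phi> u \<in> {0..real (length w)}"
  shows "geometric_braid n (position w) (\<lambda>k u. strand_path w k (\<phi> u))"
  unfolding geometric_braid_def
proof (intro conjI ballI impI)
  fix k assume k: "k \<in> {1..n}"
  show "position w k \<in> {1..n}" by (rule position_in_range[OF w k])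
  show "strand_path w k (\<phi> 1) = strand_path w (position w k) (\<phi> 0)"
    by (simp add: \<phi> strand_path_end)
  obtain L where "L-lipschitz_on {0..real (length w)} (strand_path w k)"
    using strand_path_lipschitz by blast
  then show "lip (\<lambda>u. strand_path w k (\<phi> u))" by (rule lip_compose[OF _ \<phi>(1) range])
  show "1 \<le> fst (strand_path w k (\<phi> u))" if "u \<in> {0..1}" for u
    using strand_path_ge[OF w k] range[OF that] by simp
  show "strand_path w k (\<phi> u) \<noteq> strand_path w k' (\<phi> u)" if "u \<in> {0..1}" "k \<noteq> k'" for k' u
    using strand_path_distinct range[OF that(1)] that(2) by simp
qed

definition word_strand :: "nat list \<Rightarrow> nat \<Rightarrow> real \<Rightarrow> real \<times> real" where
  "word_strand w k u = strand_path w k (real (length w) * u)"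

lemma mult_unit_range: "u \<in> {0..1} \<Longrightarrow> real m * u \<in> {0..real m}"
  using mult_left_le[of u "real m"] by auto

lemma geometric_braid_word_strand:
  assumes "braid_word n w"
  shows "geometric_braid n (position w) (word_strand w)"
  unfolding word_strand_def
  by (rule geometric_braid_strand_path[OF assms]) (auto intro: mult_left_le intro!: lip_intros)

text \<open>
  The times at which the crossings happen are irrelevant: \<open>\<phi>\<close> and the linear clock are joined by a
  segment of clocks.
\<close>

lemma reparametrised_braid_isotopy:
  fixes \<phi> :: "real \<Rightarrow> real"
  assumes w: "braid_word n w" and \<phi>: "lip \<phi>" "\<phi> 0 = 0" "\<phi> 1 = length w"
    and range: "\<And>u. u \<in> {0..1} \<Longrightarrow> \<phi> u \<in> {0..real (length w)}"
  shows "ambient_isotopic (braid_closure n (word_strand w))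
      (braid_closure n (\<lambda>k u. strand_path w k (\<phi> u)))"
proof -
  define b where "b t k u = strand_path w k ((1 - t) * (real (length w) * u) + t * \<phi> u)" for t k u
  have range': "(1 - t) * (real (length w) * u) + t * \<phi> u \<in> {0..real (length w)}"
    if "t \<in> {0..1}" "u \<in> {0..1}" for t u
    using convexD[OF convex_closed_interval mult_unit_range[OF that(2)] range[OF that(2)], of
        "1 - t" t] that(1)
    by simp
  have "ambient_isotopic (braid_closure n (b 0)) (braid_closure n (b 1))"
  proof (rule geometric_braid_isotopy)
    show "geometric_braid n (position w) (b t)" if t: "t \<in> {0..1}" for t
      unfolding b_def
    proof (rule geometric_braid_strand_path[OF w])
      show "lip (\<lambda>u. (1 - t) * (real (length w) * u) + t * \<phi> u)" by (intro lip_intros \<phi>)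
    qed (use \<phi> range'[OF t] in \<open>auto simp: algebra_simps\<close>)
    show "continuous_on ({0..1} \<times> {0..1}) (\<lambda>p. b (fst p) k (snd p))" for k
    proof -
      obtain L where L: "L-lipschitz_on {0..real (length w)} (strand_path w k)"
        using strand_path_lipschitz by blast
      have "continuous_on ({0..1::real} \<times> {0..1}) (\<lambda>p. \<phi> (snd p))"
        by (rule continuous_on_compose2[OF lip_continuous_on[OF \<phi>(1)]])
          (auto intro: continuous_intros)
      then have "continuous_on ({0..1} \<times> {0..1})
          (\<lambda>p. (1 - fst p) * (real (length w) * snd p) + fst p * \<phi> (snd p))"
        by (intro continuous_intros)
      then show ?thesis
        unfolding b_def
        by (rule continuous_on_compose2[OF lipschitz_on_continuous_on[OF L]]) (use range' in auto)
    qed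
  qed
  moreover have "b 0 = word_strand w" "b 1 = (\<lambda>k u. strand_path w k (\<phi> u))"
    by (auto simp: b_def word_strand_def fun_eq_iff)
  ultimately show ?thesis by simp
qed

lemma crossing_slice_eq:
  assumes "1 \<le> i" "i < n"
  shows "crossing_slice n i s = (\<lambda>a. crossing_strand i a s) ` {1..n}"
proof -
  let ?B = "{1..n} - {i, Suc i}" and ?f = "\<lambda>a. crossing_strand i a s"
  have "{1..n} = {i, Suc i} \<union> ?B" using assms by auto
  then have "?f ` {1..n} = ?f ` ({i, Suc i} \<union> ?B)" by (rule arg_cong)
  also have "\<dots> = ?f ` {i, Suc i} \<union> ?f ` ?B" by (rule image_Un)
  also have "?f ` ?B = (\<lambda>k. (real k, 0)) ` ?B"
    by (rule image_cong) (auto simp: crossing_strand_def)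
  also have "\<dots> = {(real k, 0) | k. k \<in> ?B}" by blast
  also have "?f ` {i, Suc i} = {(real i + s, s * (1 - s)), (real i + 1 - s, - (s * (1 - s)))}"
    by (simp add: crossing_strand_def insert_commute)
  finally show ?thesis unfolding crossing_slice_def by (rule sym)
qed

text \<open>
  The strands occupy all positions at the beginning of the \<open>j\<close>-th sector, because \<open>position\<close>
  permutes the positions.
\<close>

lemma crossing_slice_strands:
  assumes "braid_word n w" "j < length w" "s \<in> {0..1}"
  shows "crossing_slice n (w ! j) s = (\<lambda>k. strand_path w k (real j + s)) ` {1..n}"
proof -
  have j: "1 \<le> w ! j" "w ! j < n" using assms nth_mem[of j w]
    by (auto simp: braid_word_def subset_iff)
  have "braid_word n (take j w)"
    using assms(1) set_take_subset[of j w] by (auto simp: braid_word_def)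
  then have "position (take j w) ` {1..n} = {1..n}" by (rule position_image)
  then have "(\<lambda>k. crossing_strand (w ! j) (position (take j w) k) s) ` {1..n}
      = (\<lambda>a. crossing_strand (w ! j) a s) ` {1..n}"
    using image_image[of "\<lambda>a. crossing_strand (w ! j) a s" "position (take j w)" "{1..n}"]
    by (simp only:)
  then show ?thesis
    by (simp add: crossing_slice_eq[OF j] strand_path_sector[OF assms(2,3)])
qed

lemma closed_braid_set_strands:
  assumes w: "braid_word n w" "w \<noteq> []"
  shows "closed_braid_set n w = {cyl u (word_strand w k u) | k u. k \<in> {1..n} \<and> u \<in> {0..1}}"
proof -
  have len: "0 < real (length w)" using w by simp
  have cyl_eq: "cyl ((real j + s) / length w) x
      = (of_real (fst x) * cis (2 * pi * (real j + s) / real (length w)), snd x)"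
    for j s x by (simp add: cyl_def)
  show ?thesis
  proof (intro equalityI subsetI)
    fix p assume "p \<in> closed_braid_set n w"
    then obtain \<rho> z j s where p:
        "p = (of_real \<rho> * cis (2 * pi * (real j + s) / real (length w)), z)"
      "j < length w" "s \<in> {0..1}" "(\<rho>, z) \<in> crossing_slice n (w ! j) s"
      using w(2) by (auto simp: closed_braid_set_def)
    then obtain k where k: "k \<in> {1..n}" "(\<rho>, z) = strand_path w k (real j + s)"
      using crossing_slice_strands[OF w(1) p(2,3)] by auto
    define u where "u = (real j + s) / length w"
    have "real j + 1 \<le> length w" using p(2) by linarith
    then have "u \<in> {0..1}" using p(3) len by (auto simp: u_def)
    moreover have "word_strand w k u = (\<rho>, z)" using len k by (simp add: word_strand_def u_def)
    moreover have "p = cyl u (\<rho>, z)" using p(1) cyl_eq[of j s "(\<rho>, z)"] by (simp add: u_def)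
    ultimately show "p \<in> {cyl u (word_strand w k u) | k u. k \<in> {1..n} \<and> u \<in> {0..1}}"
      using k(1) by force
  next
    fix p assume "p \<in> {cyl u (word_strand w k u) | k u. k \<in> {1..n} \<and> u \<in> {0..1}}"
    then obtain k u where p: "p = cyl u (word_strand w k u)" "k \<in> {1..n}" "u \<in> {0..1}" by blast
    obtain j s where js: "j < length w" "s \<in> {0..1}" "real (length w) * u = real j + s"
      using mult_unit_range[OF p(3), of "length w"] w(2)
      by (elim strand_path_in_sector[of "real (length w) * u" w, rotated 3]) auto
    have u: "u = (real j + s) / length w" using js(3) len by (simp add: field_simps)
    obtain \<rho> z where \<rho>z: "strand_path w k (real j + s) = (\<rho>, z)" by fastforce
    have "(\<rho>, z) \<in> crossing_slice n (w ! j) s"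
      using crossing_slice_strands[OF w(1) js(1,2)] p(2) \<rho>z by (metis image_eqI)
    moreover have "p = (of_real \<rho> * cis (2 * pi * (real j + s) / real (length w)), z)"
      using p(1) cyl_eq[of j s "(\<rho>, z)"] \<rho>z js(3) by (simp add: word_strand_def u)
    ultimately show "p \<in> closed_braid_set n w"
      using js w(2) by (auto simp: closed_braid_set_def)
  qed
qed

lemma closed_braid_eq_braid_closure:
  assumes "braid_word n w" "w \<noteq> []"
  shows "closed_braid n w = braid_closure n (word_strand w)"
  unfolding closed_braid_def closed_braid_set_strands[OF assms]
    braid_closure_eq_angular[OF geometric_braid_word_strand[OF assms(1)]] ..

section \<open>Conjugation\<close>

definition rotation :: "real \<Rightarrow> space \<Rightarrow> space" where
  "rotation \<alpha> p = (fst p * cis \<alpha>, snd p)"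

lemma isotopic_to_id_rotation: "isotopic_to_id (rotation \<alpha>)"
proof (rule isotopic_to_idI[of "\<lambda>t. rotation (t * \<alpha>)"])
  show "continuous_on ({0..1} \<times> UNIV) (\<lambda>(t, x). rotation (t * \<alpha>) x)"
    unfolding rotation_def case_prod_unfold by (intro continuous_intros)
  have "homeomorphism UNIV UNIV (rotation \<beta>) (rotation (- \<beta>))" for \<beta>
    by (rule homeomorphismI) (auto simp: rotation_def cis_mult mult.assoc intro!: continuous_intros)
  then show "\<exists>g. homeomorphism UNIV UNIV (rotation (t * \<alpha>)) g" for t by blast
qed (auto simp: rotation_def)

lemma rotation_closed_braid:
  assumes "rotation \<alpha> ` closed_braid_set n w \<subseteq> closed_braid_set n w'" "\<gamma> \<in> closed_braid n w"
  shows "rotation \<alpha> \<circ> \<gamma> \<in> closed_braid n w'"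
proof -
  obtain \<theta> :: "real \<Rightarrow> real" where \<theta>: "continuous_on {0..1} \<theta>" "strict_mono_on {0..1} \<theta>"
    "\<And>t. t \<in> {0..1} \<Longrightarrow> fst (\<gamma> t) = of_real (cmod (fst (\<gamma> t))) * cis (\<theta> t)"
    and \<gamma>: "simple_path \<gamma>" "pathfinish \<gamma> = pathstart \<gamma>" "path_image \<gamma> \<subseteq> closed_braid_set n w"
    using assms(2) by (auto simp: closed_braid_def)
  have inj: "inj (rotation \<alpha>)" by (auto simp: inj_def rotation_def prod_eq_iff)
  have cont: "continuous_on UNIV (rotation \<alpha>)"
    unfolding rotation_def by (intro continuous_intros)
  have "fst ((rotation \<alpha> \<circ> \<gamma>) t)
      = of_real (cmod (fst ((rotation \<alpha> \<circ> \<gamma>) t))) * cis (\<theta> t + \<alpha>)" if "t \<in> {0..1}" for t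
    using \<theta>(3)[OF that] by (simp add: rotation_def norm_mult mult.assoc flip: cis_mult)
  moreover have "continuous_on {0..1} (\<lambda>t. \<theta> t + \<alpha>)" "strict_mono_on {0..1} (\<lambda>t. \<theta> t + \<alpha>)"
    using \<theta>(1,2) by (auto intro!: continuous_intros simp: strict_mono_on_def)
  moreover have "simple_path (rotation \<alpha> \<circ> \<gamma>)"
    by (intro simple_path_continuous_image \<gamma> continuous_on_subset[OF cont] inj_on_subset[OF inj])
        auto
  moreover have "path_image (rotation \<alpha> \<circ> \<gamma>) \<subseteq> closed_braid_set n w'"
    using \<gamma>(3) assms(1) by (auto simp: path_image_compose)
  ultimately show ?thesis
    using \<gamma>(2) unfolding closed_braid_def by (auto simp: pathfinish_compose pathstart_compose)
qed

text \<open>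
  Rotating the closed braid by one sector puts the first letter last.
\<close>

lemma closed_braid_rotate1: "ambient_isotopic (closed_braid n (i # w)) (closed_braid n (w @ [i]))"
proof -
  let ?m = "length (i # w)" and ?\<alpha> = "2 * pi / length (i # w)"
  have m: "real ?m > 0" by simp
  have shift: "cis (2 * pi * (real (Suc j) + s) / ?m) = cis (2 * pi * (real j + s) / ?m) * cis ?\<alpha>"
    for j s
    by (simp add: cis_mult add_divide_distrib distrib_left add_ac)
  have wrap: "cis (2 * pi * (real (length w) + s) / ?m) * cis ?\<alpha> = cis (2 * pi * s / ?m)" for s
  proof -
    have "2 * pi * (real (length w) + s) / ?m + ?\<alpha> = 2 * pi * s / ?m + 2 * pi"
    proof -
      have "2 * pi * (M - 1 + s) / M + 2 * pi / M = 2 * pi * s / M + 2 * pi" if "M > 0"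
        for M :: real
        using that by (simp add: field_simps)
      from this[OF m] show ?thesis by simp
    qed
    then show ?thesis unfolding cis_mult by (simp add: cis.ctr)
  qed
  have undo: "cis ?\<alpha> * cis (- ?\<alpha>) = 1" by (simp add: cis_mult)
  have cancel: "x * cis (- ?\<alpha>) = y" if "y * cis ?\<alpha> = x" for x y
    unfolding that[symmetric] mult.assoc undo by simp
  have fwd: "rotation (- ?\<alpha>) ` closed_braid_set n (i # w) \<subseteq> closed_braid_set n (w @ [i])"
  proof
    fix p assume "p \<in> rotation (- ?\<alpha>) ` closed_braid_set n (i # w)"
    then obtain \<rho> z j s where p:
        "p = rotation (- ?\<alpha>) (of_real \<rho> * cis (2 * pi * (real j + s) / ?m), z)"
      "j < ?m" "s \<in> {0..1}" "(\<rho>, z) \<in> crossing_slice n ((i # w) ! j) s"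
      by (auto simp: closed_braid_set_def)
    have "\<exists>j'<?m. p = (of_real \<rho> * cis (2 * pi * (real j' + s) / ?m), z) \<and> (w @ [i]) ! j'
        = (i # w) ! j"
    proof (cases j)
      case 0
      have "cis (2 * pi * s / ?m) * cis (- ?\<alpha>) = cis (2 * pi * (real (length w) + s) / ?m)"
        by (rule cancel[OF wrap])
      then show ?thesis using 0 p(1)
        by (intro exI[of _ "length w"]) (simp add: rotation_def mult.assoc)
    next
      case (Suc j')
      have "cis (2 * pi * (real (Suc j') + s) / ?m) * cis (- ?\<alpha>)
          = cis (2 * pi * (real j' + s) / ?m)"
        by (rule cancel[OF shift[symmetric]])
      then show ?thesis using Suc p(1,2)
        by (intro exI[of _ j']) (simp add: rotation_def mult.assoc nth_append)
    qed
    then show "p \<in> closed_braid_set n (w @ [i])"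
      using p(3,4) by (auto simp: closed_braid_set_def) metis
  qed
  have bwd: "rotation ?\<alpha> ` closed_braid_set n (w @ [i]) \<subseteq> closed_braid_set n (i # w)"
  proof
    fix p assume "p \<in> rotation ?\<alpha> ` closed_braid_set n (w @ [i])"
    then obtain \<rho> z j s where p: "p = rotation ?\<alpha> (of_real \<rho> * cis (2 * pi * (real j + s) / ?m), z)"
      "j < ?m" "s \<in> {0..1}" "(\<rho>, z) \<in> crossing_slice n ((w @ [i]) ! j) s"
      by (auto simp: closed_braid_set_def)
    have "\<exists>j'<?m. p = (of_real \<rho> * cis (2 * pi * (real j' + s) / ?m), z) \<and> (i # w) ! j'
        = (w @ [i]) ! j"
    proof (cases "j = length w")
      case True
      then show ?thesis using p(1) wrap[of s]
        by (intro exI[of _ 0]) (simp add: rotation_def mult.assoc)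
    next
      case False
      then show ?thesis using p(1,2) shift[of j s]
        by (intro exI[of _ "Suc j"]) (simp add: rotation_def mult.assoc nth_append)
    qed
    then show "p \<in> closed_braid_set n (i # w)"
      using p(3,4) by (auto simp: closed_braid_set_def) metis
  qed
  have inv: "rotation (- ?\<alpha>) \<circ> (rotation ?\<alpha> \<circ> \<gamma>) = \<gamma>" for \<gamma> :: "real \<Rightarrow> space"
  proof
    show "(rotation (- ?\<alpha>) \<circ> (rotation ?\<alpha> \<circ> \<gamma>)) t = \<gamma> t" for t
      unfolding rotation_def o_def fst_conv snd_conv mult.assoc undo by simp
  qed
  have "(\<lambda>\<gamma>. rotation (- ?\<alpha>) \<circ> \<gamma>) ` closed_braid n (i # w) = closed_braid n (w @ [i])"
  proof (intro equalityI subsetI)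
    fix \<gamma> assume "\<gamma> \<in> closed_braid n (w @ [i])"
    then have "rotation ?\<alpha> \<circ> \<gamma> \<in> closed_braid n (i # w)" by (rule rotation_closed_braid[OF bwd])
    then show "\<gamma> \<in> (\<lambda>\<gamma>. rotation (- ?\<alpha>) \<circ> \<gamma>) ` closed_braid n (i # w)"
      using inv[of \<gamma>] by (metis image_eqI)
  qed (use rotation_closed_braid[OF fwd] in auto)
  then show ?thesis
    using isotopic_to_id_rotation unfolding ambient_isotopic_iff by blast
qed

lemma closed_braid_conjugation: "ambient_isotopic (closed_braid n (v @ w)) (closed_braid n (w @ v))"
proof (induction v arbitrary: w)
  case Nil
  then show ?case by (simp add: ambient_isotopic_refl)
next
  case (Cons i v)
  have "ambient_isotopic (closed_braid n ((i # v) @ w)) (closed_braid n (v @ (w @ [i])))"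
    using closed_braid_rotate1[of n i "v @ w"] by simp
  also have "ambient_isotopic (closed_braid n (v @ (w @ [i]))) (closed_braid n ((w @ [i]) @ v))"
    by (rule Cons.IH)
  finally show ?case by simp
qed

section \<open>Replacing the first part of a closed braid\<close>

text \<open>
  A piece of a braid that begins and ends at the standard positions, so that the geometric braid
  of a word can follow it. In \<open>graft\<close>, the tangle \<open>P\<close> takes the first half turn and the word \<open>v\<close>
  the second; subtracting the common end point lets the two be added without a case distinction.
\<close>

definition tangle :: "nat \<Rightarrow> (nat \<Rightarrow> nat) \<Rightarrow> (nat \<Rightarrow> real \<Rightarrow> real \<times> real) \<Rightarrow> bool" where
  "tangle n \<pi> P \<longleftrightarrow>
     (\<forall>k\<in>{1..n}. \<pi> k \<in> {1..n} \<and> P k 0 = (real k, 0) \<and> P k 1 = (real (\<pi> k), 0) \<and> lip (P k) \<and>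
        (\<forall>s\<in>{0..1}. 1 \<le> fst (P k s))) \<and>
     (\<forall>k\<in>{1..n}. \<forall>k'\<in>{1..n}. \<forall>s\<in>{0..1}. k \<noteq> k' \<longrightarrow> P k s \<noteq> P k' s)"

lemma tangleD:
  assumes "tangle n \<pi> P" "k \<in> {1..n}"
  shows "\<pi> k \<in> {1..n}" "P k 0 = (real k, 0)" "P k 1 = (real (\<pi> k), 0)" "lip (P k)"
    "s \<in> {0..1} \<Longrightarrow> 1 \<le> fst (P k s)"
    "k' \<in> {1..n} \<Longrightarrow> s \<in> {0..1} \<Longrightarrow> k \<noteq> k' \<Longrightarrow> P k s \<noteq> P k' s"
  using assms unfolding tangle_def by blast+

definition graft :: "(nat \<Rightarrow> real \<Rightarrow> real \<times> real) \<Rightarrow> (nat \<Rightarrow> nat) \<Rightarrow> nat list \<Rightarrow> nat \<Rightarrow> real \<Rightarrow> real \<times>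
    real" where
  "graft P \<pi> v k u = P k (min 1 (2 * u)) +
     (strand_path v (\<pi> k) (real (length v) * max 0 (2 * u - 1)) - (real (\<pi> k), 0))"

lemma graft_first_half: "u \<le> 1 / 2 \<Longrightarrow> graft P \<pi> v k u = P k (2 * u)"
  by (simp add: graft_def zero_prod_def)

lemma graft_second_half:
  "\<lbrakk>tangle n \<pi> P; k \<in> {1..n}; 1 / 2 \<le> u\<rbrakk> \<Longrightarrow>
    graft P \<pi> v k u = strand_path v (\<pi> k) (real (length v) * (2 * u - 1))"
  by (simp add: graft_def tangleD(3))

lemma geometric_braid_graft:
  assumes P: "tangle n \<pi> P" and v: "braid_word n v"
  shows "geometric_braid n (position v \<circ> \<pi>) (graft P \<pi> v)"
  unfolding geometric_braid_def
proof (intro conjI ballI impI)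
  fix k assume k: "k \<in> {1..n}"
  note \<pi>k = tangleD(1)[OF P k]
  have range: "real (length v) * (2 * u - 1) \<in> {0..real (length v)}" if "u \<in> {0..1}" "\<not> u \<le> 1 / 2"
    for u :: real
    using that by (intro mult_unit_range) auto
  show "(position v \<circ> \<pi>) k \<in> {1..n}" using position_in_range[OF v \<pi>k] by simp
  then show "graft P \<pi> v k 1 = graft P \<pi> v ((position v \<circ> \<pi>) k) 0"
    using graft_second_half[OF P k, of 1]
        by (simp add: graft_first_half tangleD(2)[OF P] strand_path_end)
  obtain L where L: "L-lipschitz_on {0..real (length v)} (strand_path v (\<pi> k))"
    using strand_path_lipschitz by blast
  obtain M where M: "M-lipschitz_on {0..1} (P k)" using tangleD(4)[OF P k] by blast
  have "lip (\<lambda>u. P k (min 1 (2 * u)))"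
    by (rule lip_compose[OF M]) (auto intro!: lip_intros)
  moreover have "lip (\<lambda>u. strand_path v (\<pi> k) (real (length v) * max 0 (2 * u - 1)))"
    by (rule lip_compose[OF L], intro lip_intros, rule mult_unit_range) auto
  ultimately show "lip (graft P \<pi> v k)"
    unfolding graft_def by (intro lip_intros)
  show "1 \<le> fst (graft P \<pi> v k u)" if u: "u \<in> {0..1}" for u
  proof (cases "u \<le> 1 / 2")
    case True
    then show ?thesis using tangleD(5)[OF P k, of "2 * u"] u by (simp add: graft_first_half)
  next
    case False
    then show ?thesis
      using strand_path_ge[OF v \<pi>k] range[OF u False] graft_second_half[OF P k] by simp
  qed
  show "graft P \<pi> v k u \<noteq> graft P \<pi> v k' u" if k': "k' \<in> {1..n}" and u: "u \<in> {0..1}"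
      and ne: "k \<noteq> k'" for k' u
  proof (cases "u \<le> 1 / 2")
    case True
    then show ?thesis using tangleD(6)[OF P k k', of "2 * u"] u ne by (simp add: graft_first_half)
  next
    case False
    have "\<pi> k \<noteq> \<pi> k'"
      using tangleD(6)[OF P k k', of 1] ne tangleD(3)[OF P k] tangleD(3)[OF P k'] by auto
    then show ?thesis
      using strand_path_distinct range[OF u False] graft_second_half[OF P k]
          graft_second_half[OF P k'] False
      by simp
  qed
qed

text \<open>
  In the second half the two braids coincide, so only the tangles have to be kept disjoint.
\<close>

lemma tangle_isotopy:
  assumes P: "tangle n \<pi> P" and Q: "tangle n \<pi> Q" and v: "braid_word n v"
    and distinct: "\<And>t s k k'. \<lbrakk>t \<in> {0<..<1}; s \<in> {0..1}; k \<in> {1..n}; k' \<in> {1..n}; k < k'\<rbrakk> \<Longrightarrow>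
      interp t (P k s) (Q k s) \<noteq> interp t (P k' s) (Q k' s)"
  shows "ambient_isotopic (braid_closure n (graft P \<pi> v)) (braid_closure n (graft Q \<pi> v))"
proof (rule geometric_braid_affine_isotopy)
  show GP: "geometric_braid n (position v \<circ> \<pi>) (graft P \<pi> v)"
    by (rule geometric_braid_graft[OF P v])
  show "geometric_braid n (position v \<circ> \<pi>) (graft Q \<pi> v)" by (rule geometric_braid_graft[OF Q v])
  fix t u :: real and k k' :: nat
  assume a: "t \<in> {0<..<1}" "u \<in> {0..1}" "k \<in> {1..n}" "k' \<in> {1..n}" "k < k'"
  show "(1 - t) *\<^sub>R graft P \<pi> v k u + t *\<^sub>R graft Q \<pi> v k u
      \<noteq> (1 - t) *\<^sub>R graft P \<pi> v k' u + t *\<^sub>R graft Q \<pi> v k' u"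
  proof (cases "u \<le> 1 / 2")
    case True
    then show ?thesis using distinct[OF a(1) _ a(3-5), of "2 * u"] a(2)
      by (simp add: graft_first_half)
  next
    case False
    then have "graft Q \<pi> v j u = graft P \<pi> v j u" if "j \<in> {1..n}" for j
      using that by (simp add: graft_second_half[OF P] graft_second_half[OF Q])
    moreover have "graft P \<pi> v k u \<noteq> graft P \<pi> v k' u"
      using geometric_braidD(5)[OF GP a(3,4,2)] a(5) by simp
    ultimately show ?thesis using a(3,4) by (simp flip: scaleR_left_distrib)
  qed
qed

lemma tangle_word_strand:
  assumes "braid_word n w"
  shows "tangle n (position w) (word_strand w)"
  using geometric_braid_word_strand[OF assms]
  unfolding tangle_def geometric_braid_def by (simp add: word_strand_def strand_path_end)

lemma tangle_cong:
  assumes "tangle n \<pi> P" "\<And>k. k \<in> {1..n} \<Longrightarrow> \<pi>' k = \<pi> k"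
  shows "tangle n \<pi>' P"
  using assms unfolding tangle_def by simp

lemma closed_braid_graft:
  assumes w: "braid_word n w" and v: "braid_word n v" and ne: "w \<noteq> []"
  shows "ambient_isotopic (closed_braid n (w @ v))
      (braid_closure n (graft (word_strand w) (position w) v))"
proof -
  define \<phi> where "\<phi> u = real (length w) * min 1 (2 * u) + real (length v) * max 0 (2 * u - 1)"
    for u :: real
  have range: "\<phi> u \<in> {0..real (length (w @ v))}" if "u \<in> {0..1}" for u
    using mult_unit_range[of "min 1 (2 * u)" "length w"]
        mult_unit_range[of "max 0 (2 * u - 1)" "length v"] that
    by (simp add: \<phi>_def)
  have "ambient_isotopic (braid_closure n (word_strand (w @ v)))
      (braid_closure n (\<lambda>k u. strand_path (w @ v) k (\<phi> u)))"
  proof (rule reparametrised_braid_isotopy[OF _ _ _ _ range])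
    show "lip \<phi>" unfolding \<phi>_def by (intro lip_intros)
  qed (use w v in \<open>auto simp: \<phi>_def\<close>)
  moreover have "strand_path (w @ v) k (\<phi> u) = graft (word_strand w) (position w) v k u"
    if "0 \<le> u" for k u
  proof (cases "u \<le> 1 / 2")
    case True
    have "\<phi> u \<le> length w" using mult_unit_range[of "2 * u" "length w"] True that
      by (simp add: \<phi>_def)
    then show ?thesis
      using True that by (simp add: graft_first_half word_strand_def strand_path_append \<phi>_def)
  next
    case False
    then show ?thesis
      by (auto simp: graft_def word_strand_def strand_path_append \<phi>_def strand_path_end
          mult_le_0_iff)
  qed
  then have "braid_closure n (\<lambda>k u. strand_path (w @ v) k (\<phi> u))
      = braid_closure n (graft (word_strand w) (position w) v)"
    by (intro braid_closure_cong) auto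
  moreover have "closed_braid n (w @ v) = braid_closure n (word_strand (w @ v))"
    by (rule closed_braid_eq_braid_closure) (use w v ne in auto)
  ultimately show ?thesis by simp
qed

section \<open>Words in which strands cross over strands to their right\<close>

text \<open>
  The strand on top starts further to the left. In particular two strands cross at most once
  (\<open>descending_imp_cross_once\<close>).
\<close>

definition descending :: "nat list \<Rightarrow> bool" where
  "descending w \<longleftrightarrow> (\<forall>j<length w. \<forall>a b. passes_over w j a b \<longrightarrow> a < b)"

text \<open>
  Two strands are at the same distance from the axis only in the middle of a crossing between
  them.
\<close>

lemma descending_height:
  assumes desc: "descending w" and "a < b" "s \<in> {0..1}"
    and meet: "fst (word_strand w a s) = fst (word_strand w b s)"
  shows "snd (word_strand w b s) < snd (word_strand w a s)"
proof (cases "w = []")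
  case False
  obtain j r where js: "j < length w" "r \<in> {0..1}" "real (length w) * s = real j + r"
    using mult_unit_range[OF assms(3), of "length w"] False
    by (elim strand_path_in_sector[of "real (length w) * s" w, rotated 3]) auto
  let ?i = "w ! j" and ?p = "position (take j w)"
  have ne: "?p a \<noteq> ?p b" using inj_position assms(2) by (metis injD less_irrefl)
  have strand: "word_strand w c s = crossing_strand ?i (?p c) r" for c
    using js by (simp add: word_strand_def strand_path_sector)
  have not_ba: "\<not> (?p b = ?i \<and> ?p a = Suc ?i)"
    using desc js(1) assms(2) unfolding descending_def passes_over_def by (meson less_asym)
  have r: "0 \<le> r" "r \<le> 1" using js(2) by auto
  have "?p a = ?i \<and> ?p b = Suc ?i \<and> r = 1 / 2"
    using meet ne not_ba r unfolding strand crossing_strand_def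
    by (auto split: if_splits)
  then show ?thesis unfolding strand crossing_strand_def by auto
qed (use meet assms in \<open>auto simp: word_strand_def\<close>)

text \<open>
  The strands of \<open>w\<close> seen from above, but with heights that are determined by the starting
  positions alone.
\<close>

definition layered_strand :: "nat list \<Rightarrow> nat \<Rightarrow> real \<Rightarrow> real \<times> real" where
  "layered_strand w k s = (fst (word_strand w k s), - real k * (s * (1 - s)))"

lemma tangle_layered_strand:
  assumes w: "braid_word n w"
  shows "tangle n (position w) (layered_strand w)"
  unfolding tangle_def
proof (intro conjI ballI impI)
  note W = tangle_word_strand[OF w]
  fix k assume k: "k \<in> {1..n}"
  show "position w k \<in> {1..n}" "layered_strand w k 0 = (real k, 0)"
      "layered_strand w k 1 = (real (position w k), 0)"
    using tangleD(1-3)[OF W k] by (simp_all add: layered_strand_def)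
  show "lip (layered_strand w k)"
    unfolding layered_strand_def by (intro lip_intros tangleD(4)[OF W k])
  show "1 \<le> fst (layered_strand w k s)" if "s \<in> {0..1}" for s
    using tangleD(5)[OF W k that] by (simp add: layered_strand_def)
  show "layered_strand w k s \<noteq> layered_strand w k' s"
    if k': "k' \<in> {1..n}" and s: "s \<in> {0..1}" and ne: "k \<noteq> k'" for k' s
  proof (cases "s = 0 \<or> s = 1")
    case True
    then show ?thesis
      using tangleD(2,3)[OF W k] tangleD(2,3)[OF W k'] ne tangleD(6)[OF W k k' s ne]
      by (auto simp: layered_strand_def)
  next
    case False
    then show ?thesis using ne s by (auto simp: layered_strand_def)
  qed
qed

text \<open>
  Wherever two strands meet in the projection, the order of their heights is the same in both
  tangles, so it is preserved by interpolation.
\<close>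

lemma word_strand_isotopic_layered:
  assumes w: "braid_word n w" "descending w" and v: "braid_word n v"
  shows "ambient_isotopic (braid_closure n (graft (word_strand w) (position w) v))
    (braid_closure n (graft (layered_strand w) (position w) v))"
proof (rule tangle_isotopy[OF tangle_word_strand[OF w(1)] tangle_layered_strand[OF w(1)] v])
  fix t s :: real and k k' :: nat
  assume a: "t \<in> {0<..<1}" "s \<in> {0..1}" "k < k'"
  show "interp t (word_strand w k s) (layered_strand w k s)
      \<noteq> interp t (word_strand w k' s) (layered_strand w k' s)"
  proof
    let ?W = "word_strand w"
    assume eq: "interp t (?W k s) (layered_strand w k s)
      = interp t (?W k' s) (layered_strand w k' s)"
    have "fst (?W k s) = fst (?W k' s)"
      using arg_cong[OF eq, of fst] by (simp add: layered_strand_def flip: distrib_right)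
    then have "snd (?W k' s) < snd (?W k s)" by (rule descending_height[OF w(2) a(3,2)])
    then have "(1 - t) * snd (?W k' s) < (1 - t) * snd (?W k s)" using a(1) by simp
    moreover have "real k * (s * (1 - s)) \<le> real k' * (s * (1 - s))"
      using a by (intro mult_right_mono) auto
    then have "t * (real k * (s * (1 - s))) \<le> t * (real k' * (s * (1 - s)))"
      using a(1) by (intro mult_left_mono) auto
    ultimately show False
      using arg_cong[OF eq, of snd] by (simp add: layered_strand_def)
  qed
qed

text \<open>
  During the motion distinct strands are at distinct heights, except at the two ends, where
  nothing moves.
\<close>

lemma layered_strands_isotopic:
  assumes w: "braid_word n w" and w': "braid_word n w'" and v: "braid_word n v"
    and eq: "\<And>k. k \<in> {1..n} \<Longrightarrow> position w k = position w' k"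
  shows "ambient_isotopic (braid_closure n (graft (layered_strand w) (position w) v))
    (braid_closure n (graft (layered_strand w') (position w) v))"
proof (rule tangle_isotopy[OF tangle_layered_strand[OF w] _ v])
  note W = tangle_layered_strand[OF w] 
  show W': "tangle n (position w) (layered_strand w')"
    by (rule tangle_cong[OF tangle_layered_strand[OF w'] eq])
  fix t s :: real and k k' :: nat
  assume a: "t \<in> {0<..<1}" "s \<in> {0..1}" "k \<in> {1..n}" "k' \<in> {1..n}" "k < k'"
  show "interp t (layered_strand w k s) (layered_strand w' k s)
      \<noteq> interp t (layered_strand w k' s) (layered_strand w' k' s)"
  proof (cases "s = 0 \<or> s = 1")
    case True
    then have "layered_strand w' j s = layered_strand w j s" if "j \<in> {1..n}" for j
      using tangleD(2,3)[OF W that] tangleD(2,3)[OF W' that] by auto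
    then show ?thesis
      using tangleD(6)[OF W a(3,4,2)] a by (simp flip: scaleR_left_distrib)
  next
    case False
    have height: "snd (interp t (layered_strand w j s) (layered_strand w' j s))
        = - real j * (s * (1 - s))" for j
      by (simp add: layered_strand_def algebra_simps)
    show ?thesis
    proof
      assume "interp t (layered_strand w k s) (layered_strand w' k s)
        = interp t (layered_strand w k' s) (layered_strand w' k' s)"
      then have "- real k * (s * (1 - s)) = - real k' * (s * (1 - s))" unfolding height[symmetric]
        by simp
      then show False using False a by auto
    qed
  qed
qed

lemma graft_cong:
  assumes "\<And>k. k \<in> {1..n} \<Longrightarrow> \<pi> k = \<pi>' k"
  shows "braid_closure n (graft P \<pi> v) = braid_closure n (graft P \<pi>' v)"
  by (rule braid_closure_cong) (simp add: graft_def assms)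

theorem descending_words_isotopic_left:
  assumes w: "braid_word n w" "descending w" "w \<noteq> []"
      and w': "braid_word n w'" "descending w'" "w' \<noteq> []"
    and v: "braid_word n v" and eq: "\<And>k. k \<in> {1..n} \<Longrightarrow> position w k = position w' k"
  shows "ambient_isotopic (closed_braid n (w @ v)) (closed_braid n (w' @ v))"
proof -
  have "ambient_isotopic (closed_braid n (w @ v))
      (braid_closure n (graft (word_strand w) (position w) v))"
    by (rule closed_braid_graft[OF w(1) v w(3)])
  also have "ambient_isotopic \<dots> (braid_closure n (graft (layered_strand w) (position w) v))"
    by (rule word_strand_isotopic_layered[OF w(1,2) v])
  also have "ambient_isotopic \<dots> (braid_closure n (graft (layered_strand w') (position w) v))"
    by (rule layered_strands_isotopic[OF w(1) w'(1) v eq])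
  also have "\<dots> = braid_closure n (graft (layered_strand w') (position w') v)"
    by (rule graft_cong[OF eq])
  also have "ambient_isotopic \<dots> (braid_closure n (graft (word_strand w') (position w') v))"
    by (rule ambient_isotopic_sym[OF word_strand_isotopic_layered[OF w'(1,2) v]])
  also have "ambient_isotopic \<dots> (closed_braid n (w' @ v))"
    by (rule ambient_isotopic_sym[OF closed_braid_graft[OF w'(1) v w'(3)]])
  finally show ?thesis .
qed

theorem descending_words_isotopic:
  assumes w: "braid_word n w" "descending w" "w \<noteq> []"
      and w': "braid_word n w'" "descending w'" "w' \<noteq> []"
    and uv: "braid_word n u" "braid_word n v"
        and eq: "\<And>k. k \<in> {1..n} \<Longrightarrow> position w k = position w' k"
  shows "ambient_isotopic (closed_braid n (u @ w @ v)) (closed_braid n (u @ w' @ v))"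
proof -
  have "ambient_isotopic (closed_braid n (u @ w @ v)) (closed_braid n (w @ v @ u))"
    using closed_braid_conjugation[of n u "w @ v"] by simp
  also have "ambient_isotopic \<dots> (closed_braid n (w' @ v @ u))"
    by (rule descending_words_isotopic_left[OF w w' _ eq]) (use uv in auto)
  also have "ambient_isotopic \<dots> (closed_braid n (u @ w' @ v))"
    using closed_braid_conjugation[of n "w' @ v" u] by simp
  finally show ?thesis .
qed

section \<open>Destabilisation at the axis\<close>

lemma crossing_strand_Suc: "crossing_strand (Suc i) (Suc a) s = crossing_strand i a s + (1, 0)"
  by (simp add: crossing_strand_def)

lemma transpose_Suc:
  "Transposition.transpose (Suc i) (Suc j) (Suc a) = Suc (Transposition.transpose i j a)"
  by (simp add: Transposition.transpose_def)

lemma position_map_Suc: "position (map Suc w) (Suc a) = Suc (position w a)"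
  by (induction w arbitrary: a) (auto simp: transpose_Suc)

lemma position_map_Suc_1:
  assumes "braid_word n w"
  shows "position (map Suc w) (Suc 0) = Suc 0"
  using assms by (induction w) (auto simp: Transposition.transpose_def)

lemma strand_path_map_Suc: "strand_path (map Suc w) (Suc a) T = strand_path w a T + (1, 0)"
  by (induction w arbitrary: a T) (auto simp: crossing_strand_Suc transpose_Suc)

lemma strand_path_map_Suc_1:
  assumes "braid_word n w"
  shows "strand_path (map Suc w) (Suc 0) T = (1, 0)"
  using assms
proof (induction w arbitrary: T)
  case (Cons i w)
  have "Transposition.transpose (Suc i) (Suc (Suc i)) (Suc 0) = Suc 0"
    using Cons.prems by (simp add: Transposition.transpose_def)
  then show ?case using Cons by (simp add: crossing_strand_def)
qed simp

lemma braid_word_map_Suc: "braid_word n w \<Longrightarrow> braid_word (Suc n) (map Suc w)"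
  by (auto simp: braid_word_def)

text \<open>
  The word \<open>w\<close>, shifted away from the axis by one position, is followed by \<open>\<sigma>\<^sub>1\<close>. The strand that
  starts at \<open>Suc a\<close> arrives at position \<open>2\<close>, passes under to position \<open>1\<close>, continues as strand \<open>1\<close>
  once around the axis, and returns to position \<open>2\<close> by passing over itself. This loop is removed
  in four stages, each a family of strands over \<open>u \<in> [0, 1]\<close> in which \<open>w\<close> takes the first half:

  \<^item> \<open>crossed\<close> is the braid of the word itself.

  \<^item> In \<open>looped\<close> the loop has become a helix. In the plane of distance \<open>\<rho>\<close> and height \<open>z\<close>, the
    strand \<open>Suc a\<close> runs straight from \<open>(2, 0)\<close> to \<open>(1, -1)\<close> for \<open>1/2 \<le> u \<le> 5/8\<close>. The helix on the
    cylinder \<open>\<rho> = 1\<close> has height \<open>8 v / 5 - 2\<close> after \<open>v\<close> turns, where \<open>v\<close> runs from \<open>5/8\<close> through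
    \<open>1\<close>, where strand \<open>1\<close> takes over, to \<open>15/8\<close>; thus it rises from \<open>-1\<close> to \<open>1\<close>. The strand \<open>1\<close>
    then returns straight from \<open>(1, 1)\<close> to \<open>(2, 0)\<close>.

  \<^item> In \<open>unwound\<close> the helix is replaced by an arc with the same heights and end points whose angle
    only increases from \<open>5/8\<close> to \<open>7/8\<close> of a turn, namely \<open>v / 5 + 1 / 2\<close>. This is no braid over
    the parameter \<open>u\<close> any more.

  \<^item> \<open>excursion\<close> parametrises the same link by the angle, as a braid on \<open>n\<close> strands. Its strand \<open>a\<close>
    leaves position \<open>2\<close> for a while, and pulling it back and shifting everything towards the axis
    gives \<open>rest\<close>, the braid of \<open>w\<close> with the second half turn empty.
\<close>

locale loop =
  fixes n :: nat and w :: "nat list" and a :: nat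
  assumes w: "braid_word n w" and nonempty: "w \<noteq> []"
    and a: "a \<in> {1..n}" and arrives: "position w a = 1"
begin

definition rest :: "nat \<Rightarrow> real \<Rightarrow> real \<times> real" where
  "rest k u = strand_path w k (real (length w) * min 1 (2 * u))"

definition crossed :: "nat \<Rightarrow> real \<Rightarrow> real \<times> real" where
  "crossed = graft (word_strand (map Suc w)) (position (map Suc w)) [1]"

definition looped :: "nat \<Rightarrow> real \<Rightarrow> real \<times> real" where
  "looped k u =
     (if k = 1 then (max 1 (8 * u - 6), min (8 / 5 * u - 2 / 5) (8 - 8 * u))
      else if k = Suc a then rest a u +
        (max 1 (min 2 (6 - 8 * u)) - 1, min 0 (max (4 - 8 * u) (8 / 5 * u - 2)))
      else rest (k - 1) u + (1, 0))"

definition excursion :: "nat \<Rightarrow> real \<Rightarrow> real \<times> real" where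
  "excursion k u = rest k u +
     (if k = a then (max 1 (min 2 (max (6 - 8 * u) (8 * u - 6))) - 1,
        max (min 0 (4 - 8 * u)) (min (8 * u - 6) (8 - 8 * u)))
      else (1, 0))"

definition unwound :: "nat \<Rightarrow> real \<Rightarrow> space" where
  "unwound k u =
     (if k = 1 \<and> u \<le> 7 / 8 then cyl (u / 5 + 7 / 10) (1, 8 / 5 * u - 2 / 5)
      else if k = Suc a \<and> 5 / 8 \<le> u then cyl (u / 5 + 1 / 2) (1, 8 / 5 * u - 2)
      else cyl u (looped k u))"

lemma geometric_braid_rest: "geometric_braid n (position w) rest"
  unfolding rest_def
  by (rule geometric_braid_strand_path[OF w], intro lip_intros, simp, simp, rule mult_unit_range)
      auto

lemma rest_ge: "\<lbrakk>k \<in> {1..n}; u \<in> {0..1}\<rbrakk> \<Longrightarrow> 1 \<le> fst (rest k u)"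
  using geometric_braidD(4)[OF geometric_braid_rest] .

lemma rest_distinct: "\<lbrakk>k \<in> {1..n}; k' \<in> {1..n}; u \<in> {0..1}; k \<noteq> k'\<rbrakk> \<Longrightarrow> rest k u \<noteq> rest k' u"
  using geometric_braidD(5)[OF geometric_braid_rest] .

lemma lip_rest: "k \<in> {1..n} \<Longrightarrow> lip (rest k)"
  using geometric_braidD(3)[OF geometric_braid_rest] .

lemma rest_0: "rest k 0 = (real k, 0)"
  by (simp add: rest_def)

lemma rest_half: "1 / 2 \<le> u \<Longrightarrow> rest k u = (real (position w k), 0)"
  by (simp add: rest_def strand_path_end)

lemma rest_a: "1 / 2 \<le> u \<Longrightarrow> rest a u = (1, 0)"
  by (simp add: rest_half arrives)

lemma rest_far:
  assumes "k \<in> {1..n}" "k \<noteq> a" "1 / 2 \<le> u"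
  shows "2 \<le> fst (rest k u)"
proof -
  have "position w k \<noteq> position w a" using inj_position assms(2) by (metis injD)
  then have "2 \<le> position w k" using position_in_range[OF w assms(1)] arrives by auto
  then show ?thesis using assms(3) by (simp add: rest_half)
qed

lemma crossed_1: "u \<le> 1 / 2 \<Longrightarrow> crossed 1 u = (1, 0)"
  "1 / 2 \<le> u \<Longrightarrow> u \<le> 1 \<Longrightarrow> crossed 1 u = (2 * u, (2 * u - 1) * (2 - 2 * u))"
  using strand_path_map_Suc_1[OF w] position_map_Suc_1[OF w]
  by (simp_all add: crossed_def graft_def word_strand_def crossing_strand_def zero_prod_def)

lemma crossed_a: "1 / 2 \<le> u \<Longrightarrow> u \<le> 1 \<Longrightarrow> crossed (Suc a) u
    = (3 - 2 * u, - ((2 * u - 1) * (2 - 2 * u)))"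
  "u \<le> 1 / 2 \<Longrightarrow> crossed (Suc a) u = rest a u + (1, 0)"
  using arrives
  by (simp_all add: crossed_def graft_def word_strand_def crossing_strand_def zero_prod_def
      position_map_Suc strand_path_map_Suc rest_def strand_path_end)

lemma crossed_rest:
  assumes "k \<in> {1..n}" "k \<noteq> a" "u \<le> 1"
  shows "crossed (Suc k) u = rest k u + (1, 0)"
proof -
  have "position w k \<noteq> position w a" using inj_position assms(2) by (metis injD)
  then have "position w k \<noteq> 0" "position w k \<noteq> 1"
    using position_in_range[OF w assms(1)] arrives by auto
  then show ?thesis using assms(3)
    by (simp add: crossed_def graft_def word_strand_def crossing_strand_def zero_prod_def
        position_map_Suc strand_path_map_Suc rest_def)
qed

lemma looped_rest: "k \<in> {1..n} \<Longrightarrow> k \<noteq> a \<Longrightarrow> looped (Suc k) u = rest k u + (1, 0)"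
  by (auto simp: looped_def)

lemma looped_a: "u \<le> 1 / 2 \<Longrightarrow> looped (Suc a) u = rest a u + (1, 0)"
  "1 / 2 \<le> u \<Longrightarrow> u \<le> 1 \<Longrightarrow> looped (Suc a) u = (max 1 (6 - 8 * u), max (4 - 8 * u) (8 / 5 * u - 2))"
  using a by (auto simp: looped_def rest_a)

lemma looped_1: "looped (Suc 0) u = (max 1 (8 * u - 6), min (8 / 5 * u - 2 / 5) (8 - 8 * u))"
  by (simp add: looped_def)

lemma strand_cases:
  assumes "k \<in> {1..Suc n}"
  obtains "k = 1" | "k = Suc a" | j where "j \<in> {1..n}" "j \<noteq> a" "k = Suc j"
  using assms by (cases "k = 1"; cases "k = Suc a"; cases k) auto

text \<open>
  In the first half strand \<open>1\<close> is nearest to the axis and the others form the braid of \<open>w\<close>. In the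
  second half the strands \<open>1\<close> and \<open>Suc a\<close> stay at distance at most \<open>2\<close>, the others at distance at
  least \<open>3\<close>, so that only these two could meet. Both \<open>looped\<close> and the motion leading to it fit
  this scheme.
\<close>

lemma loop_strands_distinct:
  assumes u: "u \<in> {0..1}"
    and others: "\<And>j. \<lbrakk>j \<in> {1..n}; j \<noteq> a\<rbrakk> \<Longrightarrow> X (Suc j) = rest j u + (1, 0)"
    and early: "u < 1 / 2 \<Longrightarrow> fst (X 1) = 1" "u < 1 / 2 \<Longrightarrow> X (Suc a) = rest a u + (1, 0)"
    and late: "1 / 2 \<le> u \<Longrightarrow> fst (X 1) \<le> 2" "1 / 2 \<le> u \<Longrightarrow> fst (X (Suc a)) \<le> 2"
      "1 / 2 \<le> u \<Longrightarrow> X 1 \<noteq> X (Suc a)"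
    and k: "k \<in> {1..Suc n}" "k' \<in> {1..Suc n}" "k < k'"
  shows "X k \<noteq> X k'"
proof (cases "u < 1 / 2")
  case True
  have X: "X (Suc j) = rest j u + (1, 0)" if "j \<in> {1..n}" for j
    using others[OF that] early(2)[OF True] by (cases "j = a") auto
  obtain j' where j': "j' \<in> {1..n}" "k' = Suc j'" using k by (cases k') auto
  show ?thesis
  proof (cases "k = 1")
    case True': True
    have "2 \<le> fst (X k')" using rest_ge[OF j'(1) u] by (simp add: j'(2) X[OF j'(1)])
    then show ?thesis using early(1)[OF True] True' by auto
  next
    case False
    then obtain j where j: "j \<in> {1..n}" "k = Suc j" using k by (cases k) auto
    have "rest j u \<noteq> rest j' u" by (rule rest_distinct[OF j(1) j'(1) u]) (use k(3) j j' in auto)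
    then show ?thesis by (simp add: X[OF j(1)] X[OF j'(1)] j(2) j'(2))
  qed
next
  case False
  then have half: "1 / 2 \<le> u" by simp
  have far: "3 \<le> fst (X (Suc j))" if "j \<in> {1..n}" "j \<noteq> a" for j
    using rest_far[OF that half] by (simp add: others[OF that])
  have near: "fst (X i) \<le> 2" if "i = 1 \<or> i = Suc a" for i using late(1,2)[OF half] that by auto
  show ?thesis
    using k(1)
  proof (cases rule: strand_cases)
    case 1
    show ?thesis using k(2)
    proof (cases rule: strand_cases)
      case 2
      then show ?thesis using late(3)[OF half] 1 by simp
    next
      case (3 j)
      then show ?thesis using far[of j] near[of k] 1 by auto
    qed (use 1 k in auto)
  next
    case 2
    show ?thesis using k(2)
    proof (cases rule: strand_cases)
      case (3 j)
      then show ?thesis using far[of j] near[of k] 2 by auto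
    qed (use 2 k a in auto)
  next
    case (3 j)
    show ?thesis using k(2)
    proof (cases rule: strand_cases)
      case 2
      then show ?thesis using far[OF 3(1,2)] near[of k'] 3 by auto
    next
      case (3 j')
      have "rest j u \<noteq> rest j' u"
        by (rule rest_distinct[OF \<open>j \<in> {1..n}\<close> 3(1) u]) (use k(3) 3 \<open>k = Suc j\<close> in auto)
      then show ?thesis using 3 others[OF \<open>j \<in> {1..n}\<close> \<open>j \<noteq> a\<close>] others[OF 3(1,2)] \<open>k = Suc j\<close>
        by simp
    qed (use 3 k in auto)
  qed
qed

lemma looped_height:
  assumes "1 / 2 \<le> u" "u \<le> 1"
  shows "snd (looped (Suc a) u) < snd (looped 1 u)"
  using assms by (simp add: looped_a(2) looped_1)

lemma looped_near:
  assumes "1 / 2 \<le> u" "u \<le> 1"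
  shows "fst (looped 1 u) \<le> 2" "fst (looped (Suc a) u) \<le> 2"
  using assms by (simp_all add: looped_a(2) looped_1)

lemma geometric_braid_crossed:
    "geometric_braid (Suc n) (position [1] \<circ> position (map Suc w)) crossed"
  unfolding crossed_def
  by (rule geometric_braid_graft[OF tangle_word_strand[OF braid_word_map_Suc[OF w]]])
    (use a in \<open>auto simp: braid_word_def\<close>)

lemma looped_distinct:
  assumes "u \<in> {0..1}" "k \<in> {1..Suc n}" "k' \<in> {1..Suc n}" "k < k'"
  shows "looped k u \<noteq> looped k' u"
proof (rule loop_strands_distinct[where X = "\<lambda>k. looped k u", OF assms(1)])
  show "looped 1 u \<noteq> looped (Suc a) u" if "1 / 2 \<le> u"
    using looped_height[OF that] assms(1) by auto
qed (use looped_near looped_rest looped_a(1) assms in \<open>auto simp: looped_1\<close>)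

lemma geometric_braid_looped: "geometric_braid (Suc n) (position [1] \<circ> position (map Suc w)) looped"
    (is "geometric_braid _ ?\<pi> _")
  unfolding geometric_braid_def
proof (intro conjI ballI impI)
  have at_0: "looped (Suc k) 0 = (real (Suc k), 0)" if "k \<in> {1..n}" for k
    using looped_rest[OF that, of 0] looped_a(1)[of 0] by (cases "k = a") (auto simp: rest_0)
  fix k assume k: "k \<in> {1..Suc n}"
  show "?\<pi> k \<in> {1..Suc n}" by (rule geometric_braidD(1)[OF geometric_braid_crossed k])
  show "looped k 1 = looped (?\<pi> k) 0"
    using k
  proof (cases rule: strand_cases)
    case 1
    have "?\<pi> k = Suc 1" using position_map_Suc_1[OF w] by (simp add: 1)
    moreover have "looped (Suc 1) 0 = (2, 0)" using at_0[of 1] a by simp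
    ultimately show ?thesis by (simp add: 1 looped_1)
  next
    case 2
    have "?\<pi> k = 1" using arrives by (simp add: 2 position_map_Suc)
    then show ?thesis using looped_a(2)[of 1] by (simp add: 2 looped_1)
  next
    case (3 j)
    have "position w j \<noteq> position w a" using inj_position 3(2) by (metis injD)
    then have p: "position w j \<in> {1..n}" "position w j \<noteq> 1"
      using position_in_range[OF w 3(1)] arrives by auto
    then have "?\<pi> k = Suc (position w j)"
      by (auto simp: 3 position_map_Suc Transposition.transpose_def)
    then show ?thesis using at_0[OF p(1)] by (simp add: 3 looped_rest[OF 3(1,2)] rest_half)
  qed
  show "lip (looped k)"
    using k
  proof (cases rule: strand_cases)
    case 1
    have "lip (\<lambda>u. (max 1 (8 * u - 6), min (8 / 5 * u - 2 / 5) (8 - 8 * u)))" by (intro lip_intros)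
    then show ?thesis by (simp add: 1 looped_def)
  next
    case 2
    have "lip (\<lambda>u. rest a u +
        (max 1 (min 2 (6 - 8 * u)) - 1, min 0 (max (4 - 8 * u) (8 / 5 * u - 2))))"
      by (intro lip_intros lip_rest[OF a])
    then show ?thesis using a by (simp add: 2 looped_def)
  next
    case (3 j)
    have "lip (\<lambda>u. rest j u + (1, 0))" by (intro lip_intros lip_rest[OF 3(1)])
    then show ?thesis using 3 by (simp add: looped_def)
  qed
  show "1 \<le> fst (looped k u)" if u: "u \<in> {0..1}" for u
    using k
  proof (cases rule: strand_cases)
    case 2
    then show ?thesis using rest_ge[OF a u] a by (simp add: looped_def)
  next
    case (3 j)
    then show ?thesis using rest_ge[OF 3(1) u] by (simp add: looped_rest)
  qed (simp add: looped_def)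
  show "looped k u \<noteq> looped k' u" if "k' \<in> {1..Suc n}" "u \<in> {0..1}" "k \<noteq> k'" for k' u
    using looped_distinct[OF that(2) k that(1)] looped_distinct[OF that(2,1) k] that(3)
        by (metis linorder_neqE_nat)
qed

text \<open>
  In the second half, strand \<open>1\<close> is nowhere below strand \<open>Suc a\<close> in \<open>crossed\<close>, and strictly above
  it in \<open>looped\<close>.
\<close>

lemma crossed_isotopic_looped:
  "ambient_isotopic (braid_closure (Suc n) crossed) (braid_closure (Suc n) looped)"
proof (rule geometric_braid_affine_isotopy[OF geometric_braid_crossed geometric_braid_looped])
  fix t u :: real and k k' :: nat
  assume h: "t \<in> {0<..<1}" "u \<in> {0..1}" "k \<in> {1..Suc n}" "k' \<in> {1..Suc n}" "k < k'"
  have u: "0 \<le> u" "u \<le> 1" using h(2) by auto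
  have convex: "interp t x x = x" for x :: "real \<times> real"
    by (simp flip: scaleR_left_distrib)
  have mix: "(1 - t) * x + t * y \<le> 2" if "x \<le> 2" "y \<le> 2" for x y :: real
  proof -
    have "(1 - t) * x + t * y \<le> (1 - t) * 2 + t * 2" using that h(1)
      by (intro add_mono mult_left_mono) auto
    then show ?thesis by simp
  qed
  show "interp t (crossed k u) (looped k u) \<noteq> interp t (crossed k' u) (looped k' u)"
  proof (rule loop_strands_distinct[where X = "\<lambda>k. interp t (crossed k u) (looped k u)",
        OF h(2) _ _ _ _ _ _ h(3-5)])
    show "interp t (crossed (Suc j) u) (looped (Suc j) u) = rest j u + (1, 0)"
      if "j \<in> {1..n}" "j \<noteq> a" for j
      by (simp only: crossed_rest[OF that u(2)] looped_rest[OF that] convex)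
    show "fst (interp t (crossed 1 u) (looped 1 u)) = 1" if "u < 1 / 2"
      using that crossed_1(1)[of u] by (simp add: looped_1)
    show "interp t (crossed (Suc a) u) (looped (Suc a) u) = rest a u + (1, 0)" if "u < 1 / 2"
      using that crossed_a(2)[of u] looped_a(1)[of u] convex by simp
    assume half: "1 / 2 \<le> u"
    show "fst (interp t (crossed 1 u) (looped 1 u)) \<le> 2"
      using mix[of "fst (crossed 1 u)", OF _ looped_near(1)[OF half u(2)]]
          crossed_1(2)[OF half u(2)] u by simp
    show "fst (interp t (crossed (Suc a) u) (looped (Suc a) u)) \<le> 2"
      using mix[of "fst (crossed (Suc a) u)", OF _ looped_near(2)[OF half u(2)]]
          crossed_a(1)[OF half u(2)] half
      by simp
    have "0 \<le> (2 * u - 1) * (2 - 2 * u)" using half u by (intro mult_nonneg_nonneg) auto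
    then have "snd (crossed (Suc a) u) \<le> snd (crossed 1 u)"
      by (simp add: crossed_1(2)[OF half u(2), unfolded One_nat_def] crossed_a(1)[OF half u(2)])
    then have "(1 - t) * snd (crossed (Suc a) u) + t * snd (looped (Suc a) u)
        < (1 - t) * snd (crossed 1 u) + t * snd (looped 1 u)"
      using looped_height[OF half u(2)] h(1)
          by (intro add_le_less_mono mult_left_mono mult_strict_left_mono) auto
    then show "interp t (crossed 1 u) (looped 1 u)
        \<noteq> interp t (crossed (Suc a) u) (looped (Suc a) u)"
      by (auto simp: prod_eq_iff)
  qed
qed

text \<open>
  Here the criterion for linear interpolation is applied to a motion that is not fibred over the
  angle. Two points of the helix keep their heights, and hence a distance proportional to the
  difference of their parameters. The points outside the helix are fixed and satisfy \<open>\<rho> + \<bar>z\<bar> \<ge>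
  2\<close>, whereas a moving point has \<open>\<rho> \<le> 1\<close>, since the disc is convex, and a constant height \<open>z\<close> with
  \<open>\<bar>z\<bar> \<le> 1\<close>. Their distance is therefore at least \<open>(1 - \<bar>z\<bar>) / 2\<close>, which is proportional to the
  distance of the parameter from the ends of the helix and so bounds the displacement.
\<close>

lemma looped_isotopic_unwound:
  "ambient_isotopic (braid_closure (Suc n) looped) (curve_link {1..Suc n} unwound)"
proof -
  define arc where "arc v = (cis (2 * pi * v), 8 / 5 * v - 2)" for v :: real
  define arc' where "arc' v = (cis (2 * pi * (v / 5 + 1 / 2)), 8 / 5 * v - 2)" for v :: real
  define c where "c k u = cyl u (looped k u)" for k u
  define G where "G v = norm (arc' v - arc v)" for v
  have cases: "(\<exists>v\<in>{5 / 8..15 / 8}. c k u = arc v \<and> unwound k u = arc' v) \<or>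
      (unwound k u = c k u \<and> 2 \<le> norm (fst (c k u)) + \<bar>snd (c k u)\<bar>)"
    if k: "k \<in> {1..Suc n}" and u: "u \<in> {0..1}" for k u
  proof -
    have polar: "norm (fst (c k u)) + \<bar>snd (c k u)\<bar> = fst (looped k u) + \<bar>snd (looped k u)\<bar>"
      using cyl_polar(1)[OF geometric_braidD(4)[OF geometric_braid_looped k u]]
          by (simp add: c_def cyl_def)
    show ?thesis
      using k
    proof (cases rule: strand_cases)
      case 1
      show ?thesis
      proof (cases "u \<le> 7 / 8")
        case True
        have "c k u = cyl (u + 1) (1, 8 / 5 * u - 2 / 5)"
          using True u unfolding cyl_periodic by (simp add: c_def 1 looped_1)
        then have "c k u = arc (u + 1)" by (simp add: arc_def cyl_def add_divide_distrib)
        moreover have "unwound k u = arc' (u + 1)"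
          using True by (simp add: 1 unwound_def arc'_def cyl_def algebra_simps add_divide_distrib)
        ultimately show ?thesis using True u by (intro disjI1 bexI[of _ "u + 1"]) auto
      next
        case False
        then show ?thesis
          unfolding polar by (intro disjI2) (use u a in \<open>auto simp: 1 unwound_def c_def looped_1\<close>)
      qed
    next
      case 2
      show ?thesis
      proof (cases "5 / 8 \<le> u")
        case True
        have "c k u = cyl u (1, 8 / 5 * u - 2)"
          using True u by (simp add: c_def 2 looped_a(2))
        then have "c k u = arc u" by (simp add: arc_def cyl_def)
        moreover have "unwound k u = arc' u"
          using True a by (simp add: 2 unwound_def arc'_def cyl_def)
        ultimately show ?thesis using True u by (intro disjI1 bexI[of _ u]) auto
      next
        case False
        have "2 \<le> fst (looped k u) + \<bar>snd (looped k u)\<bar>"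
        proof (cases "u \<le> 1 / 2")
          case True
          then show ?thesis using rest_ge[OF a u] by (simp add: 2 looped_a(1))
        next
          case False
          then show ?thesis using \<open>\<not> 5 / 8 \<le> u\<close> by (simp add: 2 looped_a(2))
        qed
        then show ?thesis
          unfolding polar using False a by (intro disjI2) (auto simp: 2 unwound_def c_def)
      qed
    next
      case (3 j)
      have "2 \<le> fst (looped k u)" using rest_ge[OF 3(1) u] looped_rest[OF 3(1,2)] by (simp add: 3)
      then show ?thesis unfolding polar using 3 by (intro disjI2) (auto simp: unwound_def c_def)
    qed
  qed
  have G_lip: "norm ((arc' v - arc v) - (arc' v' - arc v')) \<le> 4 * pi * \<bar>v - v'\<bar>" for v v'
  proof -
    have "norm ((arc' v - arc v) - (arc' v' - arc v'))
        = cmod ((cis (2 * pi * (v / 5 + 1 / 2)) - cis (2 * pi * (v' / 5 + 1 / 2))) - (cis (2 * pi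
            * v) - cis (2 * pi * v')))"
      by (simp add: arc_def arc'_def norm_prod_def) (rule arg_cong[of _ _ cmod], simp)
    also have "\<dots> \<le> \<bar>2 * pi * (v / 5 + 1 / 2) - 2 * pi * (v' / 5 + 1 / 2)\<bar> + \<bar>2 * pi * v - 2 * pi *
        v'\<bar>"
      by (rule order_trans[OF norm_triangle_ineq4 add_mono[OF cis_dist_le cis_dist_le]])
    also have "\<dots> = 2 * pi / 5 * \<bar>v - v'\<bar> + 2 * pi * \<bar>v - v'\<bar>"
    proof -
      have diffs: "2 * pi * (v / 5 + 1 / 2) - 2 * pi * (v' / 5 + 1 / 2) = 2 * pi / 5 * (v - v')"
        "2 * pi * v - 2 * pi * v' = 2 * pi * (v - v')" by (simp_all add: algebra_simps)
      show ?thesis unfolding diffs by (simp add: abs_mult)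
    qed
    also have "\<dots> \<le> 4 * pi * \<bar>v - v'\<bar>"
    proof -
      have "2 * pi / 5 + 2 * pi \<le> 4 * pi" by simp
      from mult_right_mono[OF this, of "\<bar>v - v'\<bar>"] show ?thesis by (simp add: distrib_right)
    qed
    finally show ?thesis .
  qed
  have ends: "arc' (5 / 8) - arc (5 / 8) = 0" "arc' (15 / 8) - arc (15 / 8) = 0"
  proof -
    have "2 * pi * (15 / 8) = 2 * pi * (7 / 8) + 2 * pi" by simp
    then have "cis (2 * pi * (15 / 8)) = cis (2 * pi * (7 / 8))"
      by (simp only: cis.ctr sin_periodic cos_periodic)
    then show "arc' (15 / 8) - arc (15 / 8) = 0" by (simp add: arc_def arc'_def zero_prod_def)
  qed (simp add: arc_def arc'_def zero_prod_def)
  have arc_height: "snd (arc v) = 8 / 5 * v - 2" for v by (simp add: arc_def)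
  have G_bound: "norm (arc' v - arc v) \<le> 5 / 2 * pi * (1 - \<bar>snd (arc v)\<bar>)"
    if "v \<in> {5 / 8..15 / 8}" for v
  proof -
    have "norm (arc' v - arc v) \<le> 4 * pi * \<bar>v - 5 / 8\<bar>"
        "norm (arc' v - arc v) \<le> 4 * pi * \<bar>v - 15 / 8\<bar>"
      using G_lip[of v "5 / 8"] G_lip[of v "15 / 8"] by (simp_all add: ends)
    moreover have "4 * pi * \<bar>v - 5 / 8\<bar> = 5 / 2 * pi * (1 + snd (arc v))"
        "4 * pi * \<bar>v - 15 / 8\<bar> = 5 / 2 * pi * (1 - snd (arc v))"
      using that by (simp_all add: arc_height algebra_simps)
    ultimately show ?thesis by (cases "0 \<le> snd (arc v)") auto
  qed
  have conv: "(1 - t) * x + t * x = x" for t x :: real by (simp add: algebra_simps)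
  have snd_le: "\<bar>snd p\<bar> \<le> norm p" and fst_le: "cmod (fst p) \<le> norm p" for p :: space
    using norm_snd_le[of "snd p" "fst p"] norm_fst_le[of "fst p" "snd p"] by simp_all
  have snd_dist: "\<bar>snd q\<bar> - \<bar>snd p\<bar> \<le> norm (p - q)"
    and fst_dist: "cmod (fst q) - cmod (fst p) \<le> norm (p - q)" for p q :: space
    using snd_le[of "p - q"] fst_le[of "p - q"] norm_triangle_ineq2[of "fst q" "fst p"]
    by (auto simp: norm_minus_commute)
  have arc_arc: "norm ((arc' v - arc v) - (arc' v' - arc v'))
      \<le> 5 * pi * norm (interp t (arc v) (arc' v) - interp t (arc v') (arc' v'))" for t v v'
  proof -
    let ?d = "interp t (arc v) (arc' v) - interp t (arc v') (arc' v')"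
    have "snd ?d = 8 / 5 * (v - v')"
      unfolding arc_def arc'_def snd_diff snd_add snd_scaleR snd_conv real_scaleR_def conv
      by (simp add: right_diff_distrib)
    then have "\<bar>8 / 5 * (v - v')\<bar> \<le> norm ?d" using snd_le[of ?d] by (simp only:)
    moreover have "\<bar>8 / 5 * (v - v')\<bar> = 8 / 5 * \<bar>v - v'\<bar>" unfolding abs_mult by simp
    ultimately have "8 / 5 * \<bar>v - v'\<bar> \<le> norm ?d" by (simp only:)
    then have "5 * pi * (8 / 5 * \<bar>v - v'\<bar>) \<le> 5 * pi * norm ?d" by (intro mult_left_mono) auto
    moreover have "4 * pi * \<bar>v - v'\<bar> \<le> 5 * pi * (8 / 5 * \<bar>v - v'\<bar>)" by simp
    ultimately show ?thesis using G_lip[of v v'] by linarith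
  qed
  have arc_rest: "norm (arc' v - arc v) \<le> 5 * pi * norm ((interp t (arc v) (arc' v)) - y)"
    if t: "t \<in> {0..1}" and v: "v \<in> {5 / 8..15 / 8}" and y: "2 \<le> norm (fst y) + \<bar>snd y\<bar>" for t v y
  proof -
    let ?x = "interp t (arc v) (arc' v)"
    have "norm (fst ?x) \<le> (1 - t) * 1 + t * 1"
      using norm_triangle_ineq[of "(1 - t) *\<^sub>R fst (arc v)" "t *\<^sub>R fst (arc' v)"] t
      by (simp add: arc_def arc'_def)
    then have "norm (fst ?x) \<le> 1" by simp
    moreover note fst_dist[of y ?x] snd_dist[of y ?x]
    moreover have "snd ?x = snd (arc v)" by (simp add: arc_def arc'_def conv)
    ultimately have "1 - \<bar>snd (arc v)\<bar> \<le> 2 * norm (?x - y)" using y by linarith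
    then have "5 / 2 * pi * (1 - \<bar>snd (arc v)\<bar>) \<le> 5 / 2 * pi * (2 * norm (?x - y))"
      by (intro mult_left_mono) auto
    moreover have "5 / 2 * pi * (2 * norm (?x - y)) = 5 * pi * norm (?x - y)" by simp
    ultimately show ?thesis using G_bound[OF v] by (simp only:)
  qed
  show ?thesis
    unfolding braid_closure_def c_def[symmetric]
  proof (rule ambient_isotopic_linear_interpolation[where C = "5 * pi"])
    fix t u u' :: real and k k' :: nat
    assume h: "t \<in> {0..1}" "k \<in> {1..Suc n}" "k' \<in> {1..Suc n}" "u \<in> {0..1}" "u' \<in> {0..1}"
    have fixed: "interp t x x = x" for x :: space by (simp flip: scaleR_left_distrib)
    let ?goal = "norm ((unwound k u - c k u) - (unwound k' u' - c k' u'))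
        \<le> 5 * pi * norm (interp t (c k u) (unwound k u) - interp t (c k' u') (unwound k' u'))"
    from cases[OF h(2,4)] show ?goal
    proof (elim disjE bexE conjE)
      fix v assume v: "v \<in> {5 / 8..15 / 8}" "c k u = arc v" "unwound k u = arc' v"
      from cases[OF h(3,5)] show ?goal
      proof (elim disjE bexE conjE)
        fix v' assume "c k' u' = arc v'" "unwound k' u' = arc' v'"
        then show ?goal using arc_arc[of v v' t] by (simp add: v)
      next
        assume "unwound k' u' = c k' u'" "2 \<le> norm (fst (c k' u')) + \<bar>snd (c k' u')\<bar>"
        then show ?goal using arc_rest[OF h(1) v(1)] by (simp add: v fixed)
      qed
    next
      assume r: "unwound k u = c k u" "2 \<le> norm (fst (c k u)) + \<bar>snd (c k u)\<bar>"
      from cases[OF h(3,5)] show ?goal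
      proof (elim disjE bexE conjE)
        fix v' assume "v' \<in> {5 / 8..15 / 8}" "c k' u' = arc v'" "unwound k' u' = arc' v'"
        then show ?goal using arc_rest[OF h(1), of v' "c k u"] r
          by (simp add: fixed norm_minus_commute)
      next
        assume "unwound k' u' = c k' u'"
        then show ?goal using r by simp
      qed
    qed
  qed
qed

lemma excursion_a:
  "u \<le> 5 / 8 \<Longrightarrow> excursion a u = looped (Suc a) u"
  "5 / 8 \<le> u \<Longrightarrow> u \<le> 7 / 8 \<Longrightarrow> excursion a u = (1, 8 * u - 6)"
  "7 / 8 \<le> u \<Longrightarrow> u \<le> 1 \<Longrightarrow> excursion a u = looped 1 u"
  using a by (auto simp: excursion_def looped_def rest_a min_def max_def)

lemma excursion_rest: "k \<in> {1..n} \<Longrightarrow> k \<noteq> a \<Longrightarrow> excursion k u = looped (Suc k) u"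
  by (auto simp: excursion_def looped_def)

lemma unwound_eq_excursion:
  "0 \<le> u \<Longrightarrow> u \<le> 1 \<Longrightarrow> unwound (Suc a) u
      = cyl (min u (u / 5 + 1 / 2)) (excursion a (min u (u / 5 + 1 / 2)))"
  "0 \<le> u \<Longrightarrow> u \<le> 1 \<Longrightarrow> unwound 1 u
      = cyl (max u (u / 5 + 7 / 10)) (excursion a (max u (u / 5 + 7 / 10)))"
  "k \<in> {1..n} \<Longrightarrow> k \<noteq> a \<Longrightarrow> unwound (Suc k) u = cyl u (excursion k u)"
proof -
  assume u: "0 \<le> u" "u \<le> 1"
  show "unwound (Suc a) u = cyl (min u (u / 5 + 1 / 2)) (excursion a (min u (u / 5 + 1 / 2)))"
  proof (cases "5 / 8 \<le> u")
    case True
    then have "min u (u / 5 + 1 / 2) = u / 5 + 1 / 2" by simp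
    then show ?thesis using True u a by (simp add: unwound_def excursion_a(2))
  next
    case False
    then have "min u (u / 5 + 1 / 2) = u" by simp
    then show ?thesis using False a by (simp add: unwound_def excursion_a(1))
  qed
  show "unwound 1 u = cyl (max u (u / 5 + 7 / 10)) (excursion a (max u (u / 5 + 7 / 10)))"
  proof (cases "u \<le> 7 / 8")
    case True
    then have "max u (u / 5 + 7 / 10) = u / 5 + 7 / 10" by simp
    then show ?thesis using True u by (simp add: unwound_def excursion_a(2))
  next
    case False
    then have "max u (u / 5 + 7 / 10) = u" by simp
    then show ?thesis using False u a by (simp add: unwound_def excursion_a(3))
  qed
next
  assume "k \<in> {1..n}" "k \<noteq> a"
  then show "unwound (Suc k) u = cyl u (excursion k u)" by (simp add: unwound_def excursion_rest)
qed

text \<open>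
  Strand \<open>a\<close> of \<open>excursion\<close> is covered by strand \<open>Suc a\<close> of \<open>unwound\<close> up to the angle \<open>7 / 10\<close>,
  the value of \<open>v / 5 + 1 / 2\<close> at \<open>v = 1\<close>, and by strand \<open>1\<close> from there on.
\<close>

lemma curve_link_unwound: "curve_link {1..Suc n} unwound = braid_closure n excursion"
proof (rule antisym)
  show "curve_link {1..Suc n} unwound \<subseteq> braid_closure n excursion"
    unfolding braid_closure_def
  proof (rule curve_link_reparametrise)
    fix k u assume k: "k \<in> {1..Suc n}" and u: "u \<in> {0..<1::real}"
    have "\<exists>k'\<in>{1..n}. \<exists>\<psi>. continuous_on {u..1} \<psi> \<and> strict_mono_on {u..1} \<psi> \<and> \<psi> ` {u..1} \<subseteq> {0..1} \<and>
        (\<forall>v\<in>{u..1}. unwound k v = cyl (\<psi> v) (excursion k' (\<psi> v)))"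
      using k
    proof (cases rule: strand_cases)
      case 1
      show ?thesis
        by (rule bexI[OF _ a], rule exI[of _ "\<lambda>v. max v (v / 5 + 7 / 10)"])
          (use u unwound_eq_excursion(2) in \<open>auto simp: 1 strict_mono_on_def intro!:
              continuous_intros\<close>)
    next
      case 2
      show ?thesis
        by (rule bexI[OF _ a], rule exI[of _ "\<lambda>v. min v (v / 5 + 1 / 2)"])
          (use u unwound_eq_excursion(1) in \<open>auto simp: 2 strict_mono_on_def intro!:
              continuous_intros\<close>)
    next
      case (3 j)
      show ?thesis
        by (rule bexI[OF _ 3(1)], rule exI[of _ "\<lambda>v. v"])
          (use u unwound_eq_excursion(3)[OF 3(1,2)] in \<open>auto simp: 3 strict_mono_on_def\<close>)
    qed
    then show "follows_arcs {1..n} (\<lambda>k u. cyl u (excursion k u)) (unwound k) u"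
      by (rule bexI) (use u in auto)
  qed
  show "braid_closure n excursion \<subseteq> curve_link {1..Suc n} unwound"
    unfolding braid_closure_def
  proof (rule curve_link_reparametrise)
    fix k u assume k: "k \<in> {1..n}" and u: "u \<in> {0..<1::real}"
    let ?P = "\<lambda>e k' \<psi>. continuous_on {u..e} \<psi> \<and> strict_mono_on {u..e} \<psi> \<and>
        \<psi> ` {u..e} \<subseteq> {0..1} \<and> (\<forall>v\<in>{u..e}. cyl v (excursion k v) = unwound k' (\<psi> v))"
    consider "k \<noteq> a" | "k = a" "u < 7 / 10" | "k = a" "7 / 10 \<le> u" by linarith
    then show "follows_arcs {1..Suc n} unwound (\<lambda>v. cyl v (excursion k v)) u"
    proof cases
      case 1
      have P: "?P 1 (Suc k) (\<lambda>v. v)"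
        using u unwound_eq_excursion(3)[OF k 1] by (auto simp: strict_mono_on_def)
      have m2: "Suc k \<in> {1..Suc n}" using k by simp
      have m1: "1 \<in> {u<..1}" using u by simp
      show ?thesis
        by (rule bexI[of _ "1::real"], rule bexI[of _ "Suc k"], rule exI[of _ "\<lambda>v. v"], rule P,
            rule m2, rule m1)
    next
      case 2
      have inv: "min (max v (5 * v - 5 / 2)) (max v (5 * v - 5 / 2) / 5 + 1 / 2) = v" for v :: real
        by (auto simp: min_def max_def diff_divide_distrib)
      have eq: "cyl v (excursion k v) = unwound (Suc a) (max v (5 * v - 5 / 2))"
        if "v \<in> {u..7 / 10}" for v
        using unwound_eq_excursion(1)[of "max v (5 * v - 5 / 2)"] that u unfolding inv
            by (simp add: 2 le_max_iff_disj)
      have P: "?P (7 / 10) (Suc a) (\<lambda>v. max v (5 * v - 5 / 2))"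
        using u eq by (auto simp: strict_mono_on_def intro!: continuous_intros)
      have m2: "Suc a \<in> {1..Suc n}" using a by simp
      have m1: "7 / 10 \<in> {u<..1}" using 2 by simp
      show ?thesis
        by (rule bexI[of _ "7 / 10"], rule bexI[of _ "Suc a"], rule exI[of _
            "\<lambda>v. max v (5 * v - 5 / 2)"], rule P, rule m2, rule m1)
    next
      case 3
      have inv: "max (min v (5 * v - 7 / 2)) (min v (5 * v - 7 / 2) / 5 + 7 / 10) = v" for v :: real
        by (auto simp: min_def max_def diff_divide_distrib)
      have eq: "cyl v (excursion k v) = unwound 1 (min v (5 * v - 7 / 2))" if "v \<in> {u..1}" for v
        using unwound_eq_excursion(2)[of "min v (5 * v - 7 / 2)"] that 3(2) unfolding inv
            by (simp add: 3(1) min_le_iff_disj)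
      have P: "?P 1 1 (\<lambda>v. min v (5 * v - 7 / 2))"
        using 3(2) eq by (auto simp: strict_mono_on_def intro!: continuous_intros)
      have m2: "(1::nat) \<in> {1..Suc n}" by simp
      have m1: "(1::real) \<in> {u<..1}" using u by simp
      show ?thesis
        by (rule bexI[of _ "1::real"], rule bexI[of _ "1"], rule exI[of _
            "\<lambda>v. min v (5 * v - 7 / 2)"], rule P, rule m2, rule m1)
    qed
  qed
qed

lemma excursion_rest_distinct:
  assumes "t \<in> {0..1}" "u \<in> {0..1}" "k \<in> {1..n}" "k' \<in> {1..n}" "k \<noteq> k'"
  shows "interp t (excursion k u) (rest k u) \<noteq> interp t (excursion k' u) (rest k' u)"
proof -
  let ?X = "\<lambda>k. interp t (excursion k u) (rest k u)"
  have X: "?X j = rest j u + (1 - t) *\<^sub>R (excursion j u - rest j u)" for j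
    by (simp add: algebra_simps)
  have shift: "?X j = rest j u + (1 - t, 0)" if "j \<noteq> a \<or> u \<le> 1 / 2" for j
    unfolding X using that by (auto simp: excursion_def)
  show ?thesis
  proof (cases "u \<le> 1 / 2")
    case True
    then have "?X k = rest k u + (1 - t, 0)" "?X k' = rest k' u + (1 - t, 0)" using shift by blast+
    then show ?thesis using rest_distinct[OF assms(3,4,2,5)] by (metis add_right_cancel)
  next
    case False
    have near: "fst (?X a) \<le> 2 - t"
    proof -
      have "fst (excursion a u - rest a u) \<le> 1" using False by (simp add: excursion_def)
      then have "(1 - t) * fst (excursion a u - rest a u) \<le> (1 - t) * 1"
        using assms(1) by (intro mult_left_mono) auto
      then show ?thesis unfolding X using False by (simp add: rest_a)
    qed
    have far: "3 - t \<le> fst (?X j)" if "j \<in> {1..n}" "j \<noteq> a" for j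
      using rest_far[OF that, of u] False shift[of j] that by simp
    show ?thesis
    proof (cases "k = a \<or> k' = a")
      case True
      then show ?thesis using near far[OF assms(3)] far[OF assms(4)] assms(5) by fastforce
    next
      case False
      then have "?X k = rest k u + (1 - t, 0)" "?X k' = rest k' u + (1 - t, 0)" using shift
        by blast+
      then show ?thesis using rest_distinct[OF assms(3,4,2,5)] by (metis add_right_cancel)
    qed
  qed
qed

lemma geometric_braid_excursion: "geometric_braid n (position w) excursion"
  unfolding geometric_braid_def
proof (intro conjI ballI impI)
  fix k assume k: "k \<in> {1..n}"
  show "position w k \<in> {1..n}" by (rule position_in_range[OF w k])
  show "excursion k 1 = excursion (position w k) 0"
    by (simp add: excursion_def rest_0 rest_half)
  show "lip (excursion k)"
  proof (cases "k = a")
    case True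
    have "lip (\<lambda>u. rest k u + (max 1 (min 2 (max (6 - 8 * u) (8 * u - 6))) - 1,
        max (min 0 (4 - 8 * u)) (min (8 * u - 6) (8 - 8 * u))))"
      by (intro lip_intros lip_rest[OF k])
    then show ?thesis using True by (simp add: excursion_def)
  next
    case False
    have "lip (\<lambda>u. rest k u + (1, 0))" by (intro lip_intros lip_rest[OF k])
    then show ?thesis using False by (simp add: excursion_def)
  qed
  show "1 \<le> fst (excursion k u)" if u: "u \<in> {0..1}" for u
    using rest_ge[OF k u] by (auto simp: excursion_def)
  show "excursion k u \<noteq> excursion k' u" if "k' \<in> {1..n}" "u \<in> {0..1}" "k \<noteq> k'" for k' u
    using excursion_rest_distinct[of 0 u k k'] that k by simp
qed

lemma excursion_isotopic_rest: "ambient_isotopic (braid_closure n excursion) (braid_closure n rest)"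
  by (rule geometric_braid_affine_isotopy[OF geometric_braid_excursion geometric_braid_rest],
      rule excursion_rest_distinct) auto

lemma destabilisation:
    "ambient_isotopic (closed_braid (Suc n) (map Suc w @ [1])) (closed_braid n w)"
proof -
  have "ambient_isotopic (closed_braid (Suc n) (map Suc w @ [1])) (braid_closure (Suc n) crossed)"
    unfolding crossed_def
    by (rule closed_braid_graft[OF braid_word_map_Suc[OF w]])
      (use nonempty a in \<open>auto simp: braid_word_def\<close>)
  also have "ambient_isotopic \<dots> (braid_closure (Suc n) looped)" by (rule crossed_isotopic_looped)
  also have "ambient_isotopic \<dots> (curve_link {1..Suc n} unwound)" by (rule looped_isotopic_unwound)
  also have "\<dots> = braid_closure n excursion" by (rule curve_link_unwound)
  also have "ambient_isotopic \<dots> (braid_closure n rest)" by (rule excursion_isotopic_rest)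
  also have "ambient_isotopic \<dots> (braid_closure n (word_strand w))"
    unfolding rest_def
    by (rule ambient_isotopic_sym[OF reparametrised_braid_isotopy[OF w]], intro lip_intros, simp,
        simp,
        rule mult_unit_range) auto
  also have "\<dots> = closed_braid n w"
    by (rule closed_braid_eq_braid_closure[OF w nonempty, symmetric])
  finally show ?thesis .
qed

end

theorem closed_braid_destabilisation:
  assumes "braid_word n w" "w \<noteq> []"
  shows "ambient_isotopic (closed_braid (Suc n) (map Suc w @ [1])) (closed_braid n w)"
proof -
  have "1 \<in> {1..n}" using assms by (cases w) auto
  then have "1 \<in> position w ` {1..n}" by (simp only: position_image[OF assms(1)])
  then obtain a where "a \<in> {1..n}" "position w a = 1" by auto
  then interpret loop n w a using assms by unfold_locales auto
  show ?thesis by (rule destabilisation)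
qed

section \<open>Positions of strands in words\<close>

lemma position_upt:
  "position [1..<Suc d] k = (if k = 1 then Suc d else if 2 \<le> k \<and> k \<le> Suc d then k - 1 else k)"
proof (induction d)
  case (Suc d)
  have "[1..<Suc (Suc d)] = [1..<Suc d] @ [Suc d]" by simp
  then show ?case
    by (simp only: position_append Suc.IH) (auto simp: Transposition.transpose_def)
qed simp

lemma passes_over_append:
  assumes "j < length (v @ w)"
  shows "passes_over (v @ w) j a b \<longleftrightarrow>
    (if j < length v then passes_over v j a b else passes_over w (j - length v) (position v a)
        (position v b))"
  using assms by (auto simp: passes_over_def nth_append)

lemma passes_over_upt:
  assumes "j < d"
  shows "passes_over [1..<Suc d] j a b \<longleftrightarrow> a = 1 \<and> b = j + 2"
proof -
  have "take j [1..<Suc d] = [1..<Suc j]" using assms by (simp add: take_upt del: upt_Suc)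
  moreover have "[1..<Suc d] ! j = Suc j" using assms by (simp del: upt_Suc)
  ultimately show ?thesis
    unfolding passes_over_def by (simp only: position_upt) auto
qed

lemma position_map_Suc_0: "position (map Suc w) 0 = 0"
  by (induction w) (auto simp: Transposition.transpose_def)

lemma passes_over_map_Suc:
  assumes "braid_word n w" "j < length w"
  shows "passes_over (map Suc w) j a b \<longleftrightarrow> (\<exists>a' b'. a = Suc a' \<and> b = Suc b' \<and> passes_over w j a' b')"
proof -
  have "braid_word n (take j w)" using assms(1) set_take_subset[of j w]
    by (auto simp: braid_word_def)
  have "w ! j \<in> {1..<n}"
    using assms(1) nth_mem[OF assms(2)] unfolding braid_word_def by (rule subsetD)
  then have pos: "w ! j \<noteq> 0" by auto
  show ?thesis
    using pos assms(2) position_map_Suc_0[of "take j w"]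
    by (cases a; cases b) (auto simp: passes_over_def take_map position_map_Suc)
qed

text \<open>
  After the crossing of \<open>a < b\<close> the strand \<open>a\<close> is on the right of \<open>b\<close>. To change this again, \<open>b\<close>
  would have to pass over \<open>a\<close>.
\<close>

lemma descending_imp_cross_once:
  assumes desc: "descending w" and jj': "j < length w" "j' < length w"
    and cross: "passes_over w j a b \<or> passes_over w j b a"
        "passes_over w j' a b \<or> passes_over w j' b a"
  shows "j = j'"
proof -
  have never: False
    if jj': "j < j'" "j' < length w" and ab: "a < b"
      and cross: "passes_over w j a b \<or> passes_over w j b a"
          "passes_over w j' a b \<or> passes_over w j' b a"
    for j j' a b
  proof -
    have not_ba: "\<not> passes_over w k b a" if "k < length w" for k
      using desc that ab unfolding descending_def by (meson less_asym)
    have step: "position (take (Suc k) w) c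
        = Transposition.transpose (w ! k) (Suc (w ! k)) (position (take k w) c)"
      if "k < length w" for k c
      using that by (simp add: take_Suc_conv_app_nth)
    have "position (take k w) b < position (take k w) a" if "Suc j \<le> k" "k \<le> length w" for k
      using that
    proof (induction k rule: dec_induct)
      case base
      then have "passes_over w j a b" using cross(1) not_ba[of j] by auto
      then show ?case using base step[of j]
        by (simp add: passes_over_def Transposition.transpose_def)
    next
      case (step k)
      then have k: "k < length w" "position (take k w) b < position (take k w) a" by auto
      then show ?case
        using not_ba[OF k(1)] \<open>\<And>k c. k < length w \<Longrightarrow> position (take (Suc k) w) c = _ k c\<close>
        by (auto simp: passes_over_def Transposition.transpose_def)
    qed
    from this[of j'] have "position (take j' w) b < position (take j' w) a" using jj' by simp
    then show False using cross(2) not_ba[of j'] jj' by (auto simp: passes_over_def)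
  qed
  have ne: "a \<noteq> b" using cross(1) by (auto simp: passes_over_def)
  show ?thesis
    using never[of j j' a b] never[of j j' b a] never[of j' j a b] never[of j' j b a] ne cross jj'
    by (metis linorder_neqE_nat)
qed

section \<open>Words of Lorenz braids\<close>

text \<open>
  The first overcrossing strand moves last: the block \<open>\<sigma>\<^sub>1 \<dots> \<sigma>\<^sub>d\<close> takes it from position \<open>1\<close> to \<open>1
  + d\<close>, and the preceding letters present the Lorenz braid without it, one position further out.
\<close>

fun lorenz_word :: "nat list \<Rightarrow> nat list" where
  "lorenz_word [] = []"
| "lorenz_word (d # ds) = map Suc (lorenz_word ds) @ [1..<Suc d]"

lemma braid_word_upt: "d \<le> n \<Longrightarrow> braid_word n [Suc 0..<d]"
  by (auto simp: braid_word_def)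

lemma braid_word_mono: "braid_word n w \<Longrightarrow> n \<le> m \<Longrightarrow> braid_word m w"
  by (auto simp: braid_word_def)

lemma braid_word_lorenz_word:
  "\<forall>x\<in>set ds. x \<le> N \<Longrightarrow> braid_word (length ds + N) (lorenz_word ds)"
  by (induction ds) (auto simp: braid_word_map_Suc braid_word_upt simp del: upt_Suc)

text \<open>
  The overcrossing strands of the shorter braid end beyond position \<open>d\<close>, since the vector is
  sorted; after the shift they are out of reach of the last block, in which strand \<open>1\<close> therefore
  meets undercrossing strands only. For the induction the number \<open>N\<close> of these must be independent
  of the vector.
\<close>

lemma lorenz_word_positions:
  assumes "sorted ds" "\<forall>x\<in>set ds. x \<le> N"
  shows "(\<forall>i\<in>{1..length ds}. position (lorenz_word ds) i = i + ds ! (i - 1)) \<and>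
    strict_mono_on {length ds + 1..length ds + N} (position (lorenz_word ds)) \<and>
    (\<forall>j<length (lorenz_word ds). \<forall>a b. passes_over (lorenz_word ds) j a b \<longrightarrow>
      a \<in> {1..length ds} \<and> b \<in> {length ds + 1..length ds + N})"
  using assms
proof (induction ds)
  case Nil
  then show ?case by (auto simp: strict_mono_on_def)
next
  case (Cons d ds)
  let ?w = "lorenz_word ds" and ?p = "length ds" and ?w' = "lorenz_word (d # ds)"
  let ?f = "position [1..<Suc d]"
  have IH: "\<And>i. i \<in> {1..?p} \<Longrightarrow> position ?w i = i + ds ! (i - 1)"
    "strict_mono_on {?p + 1..?p + N} (position ?w)"
    "\<And>j a b. j < length ?w \<Longrightarrow> passes_over ?w j a b \<Longrightarrow> a \<in> {1..?p} \<and> b \<in> {?p + 1..?p + N}"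
    using Cons by auto
  have w: "braid_word (?p + N) ?w" by (rule braid_word_lorenz_word) (use Cons.prems in auto)
  have Suc: "position ?w' (Suc k) = ?f (Suc (position ?w k))" for k
    by (simp only: lorenz_word.simps position_append position_map_Suc)
  have one: "position ?w' 1 = Suc d"
    unfolding lorenz_word.simps position_append position_upt
    using position_map_Suc_1[OF w] by simp
  have pos: "position ?w k \<in> {1..?p + N}" if "k \<in> {1..?p + N}" for k
    by (rule position_in_range[OF w that])
  have big: "d < position ?w i" if "i \<in> {1..?p}" for i
  proof -
    have "d \<le> ds ! (i - 1)" using Cons.prems(1) that by auto
    then show ?thesis using IH(1)[OF that] that by simp
  qed
  have A: "position ?w' i = i + (d # ds) ! (i - 1)" if i: "i \<in> {1..length (d # ds)}" for i
  proof (cases "i = 1")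
    case True
    then show ?thesis using one by simp
  next
    case False
    then obtain k where k: "i = Suc k" "k \<in> {1..?p}" using i by (cases i) auto
    then show ?thesis
      unfolding k(1) Suc position_upt using IH(1)[OF k(2)] big[OF k(2)] k(2)
      by (auto simp: nth_Cons')
  qed
  have B: "strict_mono_on {length (d # ds) + 1..length (d # ds) + N} (position ?w')"
  proof (rule strict_mono_onI)
    fix r s assume r: "r \<in> {length (d # ds) + 1..length (d # ds) + N}"
      and s: "s \<in> {length (d # ds) + 1..length (d # ds) + N}" and "r < s"
    then obtain r' s' where rs: "r = Suc r'" "s = Suc s'" by (cases r; cases s) auto
    have "position ?w r' < position ?w s'"
      by (rule strict_mono_onD[OF IH(2)]) (use r s \<open>r < s\<close> rs in auto)
    moreover have "1 \<le> position ?w r'" "1 \<le> position ?w s'"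
      using pos[of r'] pos[of s'] r s rs by auto
    ultimately show "position ?w' r < position ?w' s"
      unfolding rs Suc position_upt by auto
  qed
  have C: "a \<in> {1..length (d # ds)} \<and> b \<in> {length (d # ds) + 1..length (d # ds) + N}"
    if j: "j < length ?w'" and over: "passes_over ?w' j a b" for j a b
  proof (cases "j < length ?w")
    case True
    then have "passes_over (map Suc ?w) j a b"
      using over j by (simp add: passes_over_append del: upt_Suc)
    then obtain a' b' where "a = Suc a'" "b = Suc b'" "passes_over ?w j a' b'"
      using passes_over_map_Suc[OF w True] by blast
    then show ?thesis using IH(3)[OF True] by fastforce
  next
    case False
    let ?j = "j - length ?w"
    have len: "?j < d" using j False by (simp del: upt_Suc)
    have "passes_over [1..<Suc d] ?j (position (map Suc ?w) a) (position (map Suc ?w) b)"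
      using over j False by (simp add: passes_over_append del: upt_Suc)
    then have ab: "position (map Suc ?w) a = 1" "position (map Suc ?w) b = ?j + 2"
      using passes_over_upt[OF len] by auto
    have fix1: "position (map Suc ?w) 1 = 1" using position_map_Suc_1[OF w] by simp
    have a: "a = 1" using ab(1) fix1 inj_position by (metis injD)
    have "b \<noteq> 0" using ab(2) position_map_Suc_0[of ?w] by (intro notI) simp
    moreover have "b \<noteq> 1" using ab(2) fix1 by (intro notI) simp
    ultimately obtain b' where b: "b = Suc b'" "b' \<noteq> 0" by (cases b) auto
    have pb: "position ?w b' = ?j + 1" using ab(2) by (simp add: b position_map_Suc)
    have "?j + 1 \<in> position ?w ` {1..?p + N}"
      unfolding position_image[OF w] using len Cons.prems(2) by auto
    then have "b' \<in> {1..?p + N}" using pb inj_position by (metis imageE injD)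
    moreover have "b' \<notin> {1..?p}" using big[of b'] pb len by auto
    ultimately show ?thesis using a b by auto
  qed
  show ?case using A B C by blast
qed

lemma sorted_le_last: "sorted d \<Longrightarrow> x \<in> set d \<Longrightarrow> x \<le> last d"
  by (induction d) auto

lemma lorenz_braid_lorenz_word:
  assumes "lorenz_vector d"
  shows "lorenz_braid d (lorenz_word d)"
proof -
  have s: "sorted d" "\<forall>x\<in>set d. x \<le> last d" using assms sorted_le_last
    by (auto simp: lorenz_vector_def)
  note L = lorenz_word_positions[OF s]
  have "descending (lorenz_word d)"
    unfolding descending_def using L by fastforce
  then show ?thesis
    unfolding lorenz_braid_def Let_def
    using assms braid_word_lorenz_word[OF s(2)] L descending_imp_cross_once by blast
qed

lemma lorenz_braid_descending: "lorenz_braid d w \<Longrightarrow> descending w"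
  unfolding lorenz_braid_def descending_def Let_def by fastforce

text \<open>
  Both functions enumerate the same set in increasing order.
\<close>

lemma strict_mono_on_unique:
  fixes f g :: "nat \<Rightarrow> nat"
  assumes "finite A" "strict_mono_on A f" "strict_mono_on A g" "f ` A = g ` A" "x \<in> A"
  shows "f x = g x"
proof -
  have enum: "map h (sorted_list_of_set A) = sorted_list_of_set (h ` A)" if "strict_mono_on A h"
    for h :: "nat \<Rightarrow> nat"
  proof (rule sym, rule sorted_distinct_set_unique)
    have "sorted_wrt (<) (map h (sorted_list_of_set A))"
      unfolding sorted_wrt_map
      by (rule sorted_wrt_mono_rel[OF _ strict_sorted_list_of_set[of A]])
        (use that assms(1) in \<open>auto simp: strict_mono_on_def\<close>)
    then show "sorted (map h (sorted_list_of_set A))" "distinct (map h (sorted_list_of_set A))"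
      by (simp_all add: strict_sorted_iff)
  qed (use assms(1) in auto)
  have "map f (sorted_list_of_set A) = map g (sorted_list_of_set A)"
    using enum assms by simp
  then show ?thesis using assms(1,5) by simp
qed

text \<open>
  The undercrossing strands fill the positions left free by the overcrossing ones in the only
  order-preserving way.
\<close>

lemma lorenz_braid_position_unique:
  assumes "lorenz_braid d w" "lorenz_braid d w'" "k \<in> {1..length d + last d}"
  shows "position w k = position w' k"
proof -
  let ?p = "length d" and ?n = "length d + last d"
  let ?U = "{?p + 1..?n}"
  have facts: "braid_word ?n v" "\<And>i. i \<in> {1..?p} \<Longrightarrow> position v i = i + d ! (i - 1)"
    "strict_mono_on ?U (position v)" if "lorenz_braid d v" for v
    using that by (auto simp: lorenz_braid_def Let_def)
  have over: "position w i = position w' i" if "i \<in> {1..?p}" for i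
    using facts(2)[OF assms(1) that] facts(2)[OF assms(2) that] by simp
  have split: "{1..?n} = {1..?p} \<union> ?U" "{1..?p} \<inter> ?U = {}" by auto
  have img: "position v ` ?U = {1..?n} - position v ` {1..?p}" if "lorenz_braid d v" for v
  proof -
    have "?U = {1..?n} - {1..?p}" using split by auto
    then show ?thesis using position_image[OF facts(1)[OF that]] image_set_diff[OF inj_position]
      by metis
  qed
  have "position w ` {1..?p} = position w' ` {1..?p}" using over by (rule image_cong[OF refl])
  then have "position w ` ?U = position w' ` ?U" by (simp only: img[OF assms(1)] img[OF assms(2)])
  then have "position w i = position w' i" if "i \<in> ?U" for i
    using strict_mono_on_unique[OF _ facts(3)[OF assms(1)] facts(3)[OF assms(2)] _ that] by simp
  then show ?thesis using over assms(3) split(1) by blast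
qed

lemma lorenz_braid_nonempty:
  assumes "lorenz_braid d w"
  shows "w \<noteq> []"
proof
  assume "w = []"
  moreover have "position w 1 = 1 + d ! 0" "d \<noteq> []" "1 \<le> d ! 0"
    using assms by (auto simp: lorenz_braid_def lorenz_vector_def Let_def Suc_le_eq)
  ultimately show False by simp
qed

theorem lorenz_braids_isotopic:
  assumes w: "lorenz_braid d w" "lorenz_braid d w'"
  shows "ambient_isotopic (closed_braid (length d + last d) w) (closed_braid (length d + last d)
      w')"
proof -
  have "braid_word (length d + last d) w" "braid_word (length d + last d) w'"
    using w by (auto simp: lorenz_braid_def Let_def)
  from descending_words_isotopic_left[OF this(1) lorenz_braid_descending[OF w(1)]
      lorenz_braid_nonempty[OF w(1)]
      this(2) lorenz_braid_descending[OF w(2)] lorenz_braid_nonempty[OF w(2)] braid_word_Nil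
      lorenz_braid_position_unique[OF w]]
  show ?thesis by simp
qed

section \<open>Removing the overcrossing strands\<close>

text \<open>
  In \<open>\<sigma>\<^sub>1 \<dots> \<sigma>\<^sub>d \<sigma>\<^sub>j = \<sigma>\<^bsub>j+1\<^esub> \<sigma>\<^sub>1 \<dots> \<sigma>\<^sub>d\<close> both sides let strand \<open>1\<close> pass over the next \<open>d\<close> strands
  and \<open>j + 1\<close> over \<open>j + 2\<close>, so they are descending words with the same permutation.
\<close>

lemma slide_letter:
  assumes j: "1 \<le> j" "j < d" and d: "d < n" and uv: "braid_word n u" "braid_word n v"
  shows "ambient_isotopic (closed_braid n (u @ ([1..<Suc d] @ [j]) @ v))
      (closed_braid n (u @ ([Suc j] @ [1..<Suc d]) @ v))"
proof (rule descending_words_isotopic)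
  show "braid_word n ([1..<Suc d] @ [j])" "braid_word n ([Suc j] @ [1..<Suc d])"
    using j d by (auto simp: braid_word_upt simp del: upt_Suc)
  show "descending ([1..<Suc d] @ [j])"
    unfolding descending_def
  proof (intro allI impI)
    fix i a b assume i: "i < length ([1..<Suc d] @ [j])"
        and over: "passes_over ([1..<Suc d] @ [j]) i a b"
    show "a < b"
    proof (cases "i < d")
      case True
      then have "passes_over [1..<Suc d] i a b"
        using over i by (simp add: passes_over_append del: upt_Suc)
      then show ?thesis by (simp only: passes_over_upt[OF True])
    next
      case False
      then have "i = d" using i by (simp del: upt_Suc)
      then have "position [1..<Suc d] a = j" "position [1..<Suc d] b = Suc j"
        using over by (auto simp: passes_over_def nth_append simp del: upt_Suc)
      then show ?thesis unfolding position_upt using j by (auto split: if_splits)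
    qed
  qed
  show "descending ([Suc j] @ [1..<Suc d])"
    unfolding descending_def
  proof (intro allI impI)
    fix i a b assume i: "i < length ([Suc j] @ [1..<Suc d])"
        and over: "passes_over ([Suc j] @ [1..<Suc d]) i a b"
    show "a < b"
    proof (cases i)
      case 0
      then show ?thesis using over by (simp add: passes_over_def)
    next
      case (Suc k)
      then have k: "k < d" using i by (simp del: upt_Suc)
      have "passes_over [1..<Suc d] k (position [Suc j] a) (position [Suc j] b)"
        using over i Suc by (simp add: passes_over_append del: upt_Suc append_Cons append_Nil)
      then have "position [Suc j] a = 1" "position [Suc j] b = k + 2"
        by (simp_all only: passes_over_upt[OF k])
      then show ?thesis using j by (auto simp: Transposition.transpose_def split: if_splits)
    qed
  qed
  show "position ([1..<Suc d] @ [j]) k = position ([Suc j] @ [1..<Suc d]) k" for k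
    unfolding position_append position_upt using j by (auto simp: Transposition.transpose_def)
qed (use uv in auto)

lemma slide_word:
  assumes "set T \<subseteq> {1..<d}" "d < n" "braid_word n u" "braid_word n v"
  shows "ambient_isotopic (closed_braid n (u @ [1..<Suc d] @ T @ v))
      (closed_braid n (u @ map Suc T @ [1..<Suc d] @ v))"
  using assms
proof (induction T arbitrary: u)
  case Nil
  then show ?case by (simp add: ambient_isotopic_refl del: upt_Suc)
next
  case (Cons j T)
  have j: "1 \<le> j" "j < d" using Cons.prems by auto
  have "braid_word n (T @ v)" using Cons.prems by (auto simp: braid_word_def)
  from slide_letter[OF j Cons.prems(2,3) this]
  have "ambient_isotopic (closed_braid n (u @ [1..<Suc d] @ (j # T) @ v))
      (closed_braid n ((u @ [Suc j]) @ [1..<Suc d] @ T @ v))"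
    by (simp del: upt_Suc)
  also have "ambient_isotopic \<dots> (closed_braid n ((u @ [Suc j]) @ map Suc T @ [1..<Suc d] @ v))"
    by (rule Cons.IH) (use Cons.prems j in auto)
  finally show ?case by (simp del: upt_Suc)
qed

definition T_word :: "nat list \<Rightarrow> nat list" where
  "T_word d = concat (map (\<lambda>r. [1..<r]) d)"

lemma T_word_simps [simp]: "T_word [] = []" "T_word (r # d) = [1..<r] @ T_word d"
  by (simp_all add: T_word_def)

lemma lorenz_word_eq_Nil: "\<forall>x\<in>set ds. 1 \<le> x \<Longrightarrow> lorenz_word ds = [] \<longleftrightarrow> ds = []"
  by (cases ds) auto

text \<open>
  One step of the induction: sliding \<open>T\<close> through the block of the first overcrossing strand leaves
  a single \<open>\<sigma>\<^sub>1\<close>, which conjugation puts last. Destabilisation removes it and lowers all other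
  indices, so that \<open>T\<close> reappears together with the new block. The hypothesis on
  \<open>T @ T_word ds\<close> keeps the word that remains after each destabilisation nonempty.
\<close>

lemma remove_overcrossing_strands:
  assumes "sorted ds" "\<forall>x\<in>set ds. 1 \<le> x \<and> r \<le> x \<and> x \<le> N" "set T \<subseteq> {1..<r}" "braid_word N T"
      "T @ T_word ds \<noteq> []"
  shows "ambient_isotopic (closed_braid (length ds + N) (lorenz_word ds @ T))
      (closed_braid N (T @ T_word ds))"
  using assms
proof (induction ds arbitrary: T r)
  case Nil
  then show ?case by (simp add: ambient_isotopic_refl)
next
  case (Cons d ds)
  let ?n = "length ds + N" and ?w = "lorenz_word ds"
  have d: "1 \<le> d" "r \<le> d" "d \<le> N" using Cons.prems by auto
  have w: "braid_word ?n ?w" by (rule braid_word_lorenz_word) (use Cons.prems in auto)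
  have T: "braid_word ?n T" by (rule braid_word_mono[OF Cons.prems(4)]) simp
  have dn: "braid_word ?n [1..<d]" using d by (simp add: braid_word_upt)
  have "?w = [] \<longleftrightarrow> ds = []" by (rule lorenz_word_eq_Nil) (use Cons.prems in auto)
  then have ne: "[1..<d] @ ?w @ T \<noteq> []" using Cons.prems(5) by auto
  have "ambient_isotopic (closed_braid (Suc ?n) (map Suc ?w @ [1..<Suc d] @ T @ []))
      (closed_braid (Suc ?n) (map Suc ?w @ map Suc T @ [1..<Suc d] @ []))"
    by (rule slide_word) (use Cons.prems d w in \<open>auto simp: braid_word_map_Suc\<close>)
  moreover have "[1..<Suc d] = [1] @ map Suc [1..<d]"
    using d by (simp add: map_Suc_upt upt_conv_Cons del: upt_Suc)
  ultimately have "ambient_isotopic (closed_braid (Suc ?n) (lorenz_word (d # ds) @ T))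
      (closed_braid (Suc ?n) ((map Suc (?w @ T) @ [1]) @ map Suc [1..<d]))"
    by (simp del: upt_Suc)
  also have "ambient_isotopic \<dots> (closed_braid (Suc ?n) (map Suc [1..<d] @ map Suc (?w @ T) @ [1]))"
    by (rule closed_braid_conjugation)
  also have "\<dots> = closed_braid (Suc ?n) (map Suc ([1..<d] @ ?w @ T) @ [1])" by simp
  also have "ambient_isotopic \<dots> (closed_braid ?n ([1..<d] @ ?w @ T))"
    by (rule closed_braid_destabilisation[OF _ ne]) (use w T dn in simp)
  also have "ambient_isotopic \<dots> (closed_braid ?n (?w @ (T @ [1..<d])))"
    using closed_braid_conjugation[of ?n "[1..<d]" "?w @ T"] by simp
  also have "ambient_isotopic \<dots> (closed_braid N ((T @ [1..<d]) @ T_word ds))"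
    by (rule Cons.IH[of d]) (use Cons.prems d in \<open>auto simp: braid_word_upt\<close>)
  finally show ?case by simp
qed

text \<open>
  For the vector \<open>\<langle>1, \<dots>, 1\<rangle>\<close> the procedure would end with the empty word on one strand. Stopping
  before the last step gives \<open>T((2,1))\<close>.
\<close>

lemma lorenz_word_ones:
  "ambient_isotopic (closed_braid (Suc (Suc p)) (lorenz_word (replicate (Suc p) 1)))
      (closed_braid 2 [1])"
proof (induction p)
  case 0
  then show ?case by (simp add: ambient_isotopic_refl numeral_2_eq_2)
next
  case (Suc p)
  let ?w = "lorenz_word (replicate (Suc p) 1)"
  have "ambient_isotopic (closed_braid (Suc (Suc (Suc p))) (map Suc ?w @ [1]))
      (closed_braid (Suc (Suc p)) ?w)"
  proof (rule closed_braid_destabilisation)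
    show "braid_word (Suc (Suc p)) ?w"
      using braid_word_lorenz_word[of "replicate (Suc p) 1" 1] by simp
  qed simp
  also note Suc
  finally show ?case by simp
qed

section \<open>Parameters of T-links\<close>

lemma power_vector_simps [simp]: "power_vector [] = []"
    "power_vector ((r, s) # rs) = replicate s r @ power_vector rs"
  by (simp_all add: power_vector_def)

lemma T_braid_eq_T_word: "T_braid rs = T_word (power_vector rs)"
  by (induction rs) (auto simp: T_braid_def T_word_def)

lemma length_power_vector: "length (power_vector rs) = sum_list (map snd rs)"
  by (induction rs) auto

lemma set_power_vector: "\<forall>(r, s)\<in>set rs. 0 < s \<Longrightarrow> set (power_vector rs) = fst ` set rs"
  by (induction rs) force+

lemma power_vector_eq_Nil: "\<forall>(r, s)\<in>set rs. 0 < s \<Longrightarrow> power_vector rs = [] \<longleftrightarrow> rs = []"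
  by (cases rs) auto

lemma last_power_vector: "rs \<noteq> [] \<Longrightarrow> \<forall>(r, s)\<in>set rs. 0 < s \<Longrightarrow> last (power_vector rs) = fst (last rs)"
  by (induction rs) (auto simp: last_append power_vector_eq_Nil)

lemma sorted_power_vector:
  assumes "sorted (map fst rs)" "\<forall>(r, s)\<in>set rs. 0 < s"
  shows "sorted (power_vector rs)"
  using assms by (induction rs) (auto simp: sorted_append set_power_vector)

lemma T_params_power_vector:
  assumes "T_params rs"
  shows "sorted (power_vector rs)" "power_vector rs \<noteq> []" "\<forall>x\<in>set (power_vector rs). 2 \<le> x"
    "last (power_vector rs) = fst (last rs)"
proof -
  have s: "\<forall>(r, s)\<in>set rs. 0 < s" "rs \<noteq> []" "sorted (map fst rs)" "\<forall>(r, s)\<in>set rs. 2 \<le> r"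
    using assms by (auto simp: T_params_def)
  show "sorted (power_vector rs)" "power_vector rs \<noteq> []" "last (power_vector rs) = fst (last rs)"
    using sorted_power_vector[OF s(3,1)] power_vector_eq_Nil[OF s(1)] last_power_vector[OF s(2,1)]
        s(2) by auto
  show "\<forall>x\<in>set (power_vector rs). 2 \<le> x" using set_power_vector[OF s(1)] s(4) by auto
qed

text \<open>
  Grouping equal entries turns any vector without entries \<open>1\<close> into parameters with strictly
  increasing \<open>r\<^sub>i\<close>. The clause on the heads tells the induction whether the new entry joins the
  first group.
\<close>

lemma run_lengths:
  assumes "sorted d" "d \<noteq> []" "\<forall>x\<in>set d. 2 \<le> x"
  shows "\<exists>rs. rs \<noteq> [] \<and> sorted_wrt (<) (map fst rs) \<and> (\<forall>(r, s)\<in>set rs. 2 \<le> r \<and> 1 \<le> s) \<and>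
    power_vector rs = d \<and> fst (hd rs) = hd d"
  using assms
proof (induction d)
  case (Cons x d)
  show ?case
  proof (cases "d = []")
    case True
    then show ?thesis using Cons.prems by (intro exI[of _ "[(x, 1)]"]) auto
  next
    case False
    then obtain rs where rs: "rs \<noteq> []" "sorted_wrt (<) (map fst rs)" "\<forall>(r, s)\<in>set rs. 2 \<le> r \<and> 1 \<le> s"
      "power_vector rs = d" "fst (hd rs) = hd d" using Cons by auto
    then obtain r s rs' where split: "rs = (r, s) # rs'" by (cases rs) auto
    have "x \<le> r" using Cons.prems(1) False rs(5) split by (cases d) auto
    show ?thesis
    proof (cases "x = r")
      case True
      then show ?thesis using rs split by (intro exI[of _ "(r, Suc s) # rs'"]) auto
    next
      case False
      then show ?thesis using rs split \<open>x \<le> r\<close> Cons.prems(3)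
        by (intro exI[of _ "(x, 1) # rs"]) auto
    qed
  qed
qed simp

lemma run_lengths_T_params:
  assumes "rs \<noteq> []" "sorted_wrt (<) (map fst rs)" "\<forall>(r, s)\<in>set rs. 2 \<le> r \<and> 1 \<le> s"
  shows "T_params rs"
  using assms strict_sorted_imp_sorted unfolding T_params_def by fastforce

lemma represented_by_transfer:
  assumes "represented_by L n w" "ambient_isotopic (closed_braid n w) (closed_braid n' w')"
      "braid_word n' w'"
  shows "represented_by L n' w'"
  using assms ambient_isotopic_trans unfolding represented_by_def by blast

lemma braid_word_T_word:
  assumes "\<forall>x\<in>set d. x \<le> N"
  shows "braid_word N (T_word d)"
  using assms by (induction d) (auto simp: braid_word_upt)

theorem lorenz_braid_isotopic_T_word:
  assumes w: "lorenz_braid d w" and last: "2 \<le> last d"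
  shows "ambient_isotopic (closed_braid (length d + last d) w) (closed_braid (last d) (T_word d))"
proof -
  have d: "lorenz_vector d" using w by (simp add: lorenz_braid_def)
  then have d': "d \<noteq> []" "sorted d" "\<forall>x\<in>set d. 1 \<le> x \<and> 1 \<le> x \<and> x \<le> last d"
    using sorted_le_last by (auto simp: lorenz_vector_def)
  have "T_word d \<noteq> []"
    using d'(1) last last_in_set[OF d'(1)] by (auto simp: T_word_def intro!: bexI[of _ "last d"])
  then have "ambient_isotopic (closed_braid (length d + last d) (lorenz_word d @ []))
      (closed_braid (last d) ([] @ T_word d))"
    by (intro remove_overcrossing_strands[OF d'(2,3)]) auto
  moreover have "ambient_isotopic (closed_braid (length d + last d) w)
      (closed_braid (length d + last d) (lorenz_word d))"
    by (rule lorenz_braids_isotopic[OF w lorenz_braid_lorenz_word[OF d]])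
  ultimately show ?thesis using ambient_isotopic_trans by auto
qed

lemma lorenz_represented_by_T_braid:
  assumes rs: "T_params rs" and w: "lorenz_braid (power_vector rs) w"
    and L: "represented_by L (sum_list (map snd rs) + fst (last rs)) w"
  shows "represented_by L (fst (last rs)) (T_braid rs)"
proof (rule represented_by_transfer[OF L])
  note pv = T_params_power_vector[OF rs]
  have "2 \<le> last (power_vector rs)" using pv(2,3) by simp
  from lorenz_braid_isotopic_T_word[OF w this]
  show "ambient_isotopic (closed_braid (sum_list (map snd rs) + fst (last rs)) w)
      (closed_braid (fst (last rs)) (T_braid rs))"
    by (simp add: length_power_vector pv(4) T_braid_eq_T_word)
  show "braid_word (fst (last rs)) (T_braid rs)"
    unfolding T_braid_eq_T_word pv(4)[symmetric]
    by (rule braid_word_T_word) (use sorted_le_last[OF pv(1)] in auto)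
qed

lemma T_link_is_lorenz_link:
  assumes "T_link_with rs' L"
  shows "\<exists>rs p w. rs \<noteq> [] \<and> sorted_wrt (<) (map fst rs) \<and> (\<forall>(r, s)\<in>set rs. 2 \<le> r \<and> 1 \<le> s) \<and>
    p = sum_list (map snd rs) \<and>
    lorenz_braid (power_vector rs) w \<and> represented_by L (p + fst (last rs)) w \<and>
    T_braid rs = T_braid rs' \<and> T_link_with rs L"
proof -
  have rs': "T_params rs'" "represented_by L (fst (last rs')) (T_braid rs')"
    using assms by (auto simp: T_link_with_def)
  note pv' = T_params_power_vector[OF rs'(1)]
  obtain rs where rs: "rs \<noteq> []" "sorted_wrt (<) (map fst rs)" "\<forall>(r, s)\<in>set rs. 2 \<le> r \<and> 1 \<le> s"
    "power_vector rs = power_vector rs'"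
    using run_lengths[OF pv'(1-3)] by blast
  note params = run_lengths_T_params[OF rs(1-3)]
  note pv = T_params_power_vector[OF params]
  have T: "T_braid rs = T_braid rs'" by (simp add: T_braid_eq_T_word rs(4))
  have last: "fst (last rs) = fst (last rs')" using pv(4) pv'(4) rs(4) by simp
  let ?d = "power_vector rs" and ?w = "lorenz_word (power_vector rs)"
  have "lorenz_vector ?d" using pv by (auto simp: lorenz_vector_def)
  then have w: "lorenz_braid ?d ?w" by (rule lorenz_braid_lorenz_word)
  have "2 \<le> last ?d" using pv(2,3) by simp
  from lorenz_braid_isotopic_T_word[OF w this]
  have "ambient_isotopic (closed_braid (fst (last rs)) (T_braid rs))
      (closed_braid (sum_list (map snd rs) + fst (last rs)) ?w)"
    by (simp add: length_power_vector pv(4) T_braid_eq_T_word ambient_isotopic_sym)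
  moreover have "braid_word (sum_list (map snd rs) + fst (last rs)) ?w"
    using w by (simp add: lorenz_braid_def Let_def length_power_vector pv(4))
  ultimately have "represented_by L (sum_list (map snd rs) + fst (last rs)) ?w"
    using represented_by_transfer rs'(2) T last by metis
  moreover have "T_link_with rs L" using params rs'(2) T last by (simp add: T_link_with_def)
  ultimately show ?thesis using rs w T by blast
qed

text \<open>
  The entries \<open>1\<close> of a defining vector contribute nothing to the T-braid and are dropped, unless
  all entries are \<open>1\<close>.
\<close>

lemma lorenz_link_is_T_link:
  assumes "lorenz_link L"
  shows "T_link L"
proof -
  obtain d w where w: "lorenz_braid d w" and L: "represented_by L (length d + last d) w"
    using assms by (auto simp: lorenz_link_def)
  have d: "lorenz_vector d" using w by (simp add: lorenz_braid_def)
  then have d': "d \<noteq> []" "sorted d" "\<forall>x\<in>set d. 1 \<le> x" by (auto simp: lorenz_vector_def)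
  show ?thesis
  proof (cases "2 \<le> last d")
    case True
    let ?d = "filter (\<lambda>x. 2 \<le> x) d"
    have "d = butlast d @ [last d]" using d'(1) by simp
    then have "?d = filter (\<lambda>x. 2 \<le> x) (butlast d) @ [last d]"
      using True by (metis filter.simps filter_append)
    then have ne: "?d \<noteq> []" "last ?d = last d" by auto
    have "sorted ?d" "\<forall>x\<in>set ?d. 2 \<le> x" using d'(2) by (simp_all add: sorted_wrt_filter)
    from run_lengths[OF this(1) ne(1) this(2)] obtain rs
        where rs: "rs \<noteq> []" "sorted_wrt (<) (map fst rs)" "\<forall>(r, s)\<in>set rs. 2 \<le> r \<and> 1 \<le> s"
      "power_vector rs = ?d"
      by blast
    note params = run_lengths_T_params[OF rs(1-3)]
    note pv = T_params_power_vector[OF params]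
    have "T_word e = T_word (filter (\<lambda>x. 2 \<le> x) e)" for e by (induction e) auto
    then have T: "T_braid rs = T_word d" by (simp add: T_braid_eq_T_word rs(4))
    have last: "fst (last rs) = last d" using pv(4) rs(4) ne(2) by simp
    have "represented_by L (last d) (T_word d)"
      by (rule represented_by_transfer[OF L lorenz_braid_isotopic_T_word[OF w True]])
        (use braid_word_T_word[of d "last d"] sorted_le_last[OF d'(2)] in auto)
    then have "T_link_with rs L" using params T last by (simp add: T_link_with_def)
    then show ?thesis unfolding T_link_def by blast
  next
    case False
    have "x = 1" if "x \<in> set d" for x
      using sorted_le_last[OF d'(2) that] d'(3) that False by force
    then have d1: "d = replicate (length d) 1" by (metis replicate_length_same)
    obtain p where p: "length d = Suc p" using d'(1) by (cases d) auto
    have last: "last d = 1" using d1 p by (metis last_replicate nat.distinct(1))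
    have "ambient_isotopic (closed_braid (length d + last d) w) (closed_braid (length d + last d)
        (lorenz_word d))"
      by (rule lorenz_braids_isotopic[OF w lorenz_braid_lorenz_word[OF d]])
    also have "ambient_isotopic \<dots> (closed_braid 2 [1])"
      using lorenz_word_ones[of p] d1 p last by simp
    finally have "represented_by L 2 [1]"
      by (rule represented_by_transfer[OF L]) (simp add: braid_word_def)
    then have "T_link_with [(2, 1)] L"
      by (simp add: T_link_with_def T_params_def T_braid_def numeral_2_eq_2)
    then show ?thesis unfolding T_link_def by blast
  qed
qed

theorem theorem1:
  shows "(\<forall>L. lorenz_link L \<longleftrightarrow> T_link L) \<and>
    (\<forall>rs p w L.
       rs \<noteq> [] \<and> sorted_wrt (<) (map fst rs) \<and> (\<forall>(r, s)\<in>set rs. 2 \<le> r \<and> 1 \<le> s) \<and>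
       p = sum_list (map snd rs) \<and>
       lorenz_braid (power_vector rs) w \<and> represented_by L (p + fst (last rs)) w
       \<longrightarrow> represented_by L (fst (last rs)) (T_braid rs) \<and> T_link_with rs L) \<and>
    (\<forall>rs' L. T_link_with rs' L \<longrightarrow>
       (\<exists>rs p w.
          rs \<noteq> [] \<and> sorted_wrt (<) (map fst rs) \<and> (\<forall>(r, s)\<in>set rs. 2 \<le> r \<and> 1 \<le> s) \<and>
          p = sum_list (map snd rs) \<and>
          lorenz_braid (power_vector rs) w \<and> represented_by L (p + fst (last rs)) w \<and>
          T_braid rs = T_braid rs' \<and> T_link_with rs L))"
proof (intro conjI allI impI)
  fix L
  show "lorenz_link L \<longleftrightarrow> T_link L"
  proof
    assume "T_link L"
    then obtain rs' where "T_link_with rs' L" by (auto simp: T_link_def)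
    then obtain rs p w where rs: "rs \<noteq> []" "sorted_wrt (<) (map fst rs)"
        "\<forall>(r, s)\<in>set rs. 2 \<le> r \<and> 1 \<le> s"
      and p: "p = sum_list (map snd rs)"
      and w: "lorenz_braid (power_vector rs) w" "represented_by L (p + fst (last rs)) w"
      using T_link_is_lorenz_link by blast
    have "length (power_vector rs) + last (power_vector rs) = p + fst (last rs)"
      using T_params_power_vector(4)[OF run_lengths_T_params[OF rs]]
          by (simp add: length_power_vector p)
    with w show "lorenz_link L" unfolding lorenz_link_def by metis
  qed (rule lorenz_link_is_T_link)
next
  fix rs p w L
  assume a: "rs \<noteq> [] \<and> sorted_wrt (<) (map fst rs) \<and> (\<forall>(r, s)\<in>set rs. 2 \<le> r \<and> 1 \<le> s) \<and>
       p = sum_list (map snd rs) \<and>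
       lorenz_braid (power_vector rs) w \<and> represented_by L (p + fst (last rs)) w"
  then have params: "T_params rs" using run_lengths_T_params by blast
  show "represented_by L (fst (last rs)) (T_braid rs)"
    using lorenz_represented_by_T_braid[OF params] a by blast
  then show "T_link_with rs L" using params by (simp add: T_link_with_def)
qed (rule T_link_is_lorenz_link)

end
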